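(* Let $T>0$ and $\lambda\in\mathbb{R}\setminus\{0\}$, and consider the optimal control problems $(\mathcal{P}_N)$, $N\ge 2$, and $(\mathcal{P}_\infty)$ defined in the context. (i) Suppose $\lambda>T$ or $\lambda<0$. Then there exists a minimizer $u^*:[0,T]\times\mathbb{R}\to\mathbb{R}$ of $(\mathcal{P}_\infty)$ which is Lipschitz with respect to the space variable, uniformly in time. Moreover, this minimizer is the limit of optimal controls for $(\mathcal{P}_N)$ in the following sense: for each $N\ge 2$ there is an optimal control $\boldsymbol{u}^*_N=(u^*_{1,N},\dots,u^*_{N,N})$ of $(\mathcal{P}_N)$, with associated optimal trajectory $\boldsymbol{x}^*_N=(x^*_{1,N},\dots,x^*_{N,N})$, such that for every $t\in[0,T]$, every $x\in\mathbb{R}$ and every sequence of indices $i_N\in\{1,\dots,N\}$, $$\lim_{N\to+\infty}|x^*_{i_N,N}(t)-x|=0\quad\Longrightarrow\quad \lim_{N\to+\infty}|u^*_{i_N,N}(t)-u^*(t,x)|=0.$$ (ii) Suppose $\lambda\in(0,T]$. Then there does not exist a Lipschitz-in-space minimizer of $(\mathcal{P}_\infty)$; that is, no admissible control for $(\mathcal{P}_\infty)$ attains the infimum of the cost $\mathcal{C}_\infty(\mu^0,\cdot)$ over admissible controls.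
   Context: Fix $T>0$ and $\lambda\in\mathbb{R}\setminus\{0\}$. Variances: for $\boldsymbol{x}=(x_1,\dots,x_N)\in\mathbb{R}^N$, $\mathrm{Var}(\boldsymbol{x}):=\frac1N\sum_{i=1}^N x_i^2-\big(\frac1N\sum_{i=1}^N x_i\big)^2$. For a compactly supported probability measure $\mu$ on $\mathbb{R}$, $\mathrm{Var}(\mu):=\int_{\mathbb{R}}x^2\,d\mu(x)-\big(\int_{\mathbb{R}}x\,d\mu(x)\big)^2$. Problem $(\mathcal{P}_N)$ ($N\ge 2$): minimize $$\mathcal{C}_N(\boldsymbol{x}^0,\boldsymbol{u}):=\frac{1}{2N}\sum_{i=1}^N\int_0^T u_i^2(t)\,dt-\frac{1}{2\lambda}\mathrm{Var}(\boldsymbol{x}(T))$$ over all Lebesgue measurable controls $\boldsymbol{u}=(u_1,\dots,u_N):[0,T]\to[-1,1]^N$, where $\boldsymbol{x}(\cdot)=(x_1(\cdot),\dots,x_N(\cdot))$ is the unique (absolutely continuous) solution of $\dot x_i(t)=u_i(t)$, $x_i(0)=x_i^0:=\frac{2i-N-1}{N-1}$, $i\in\{1,\dots,N\}$. A minimizing $\boldsymbol{u}$ is called an optimal control, and the corresponding $\boldsymbol{x}(\cdot)$ is the associated optimal trajectory. Problem $(\mathcal{P}_\infty)$: minimize $$\mathcal{C}_\infty(\mu^0,u):=\frac12\int_0^T\int_{\mathbb{R}}u^2(t,x)\,d\mu(t)(x)\,dt-\frac{1}{2\lambda}\mathrm{Var}(\mu(T))$$ over admissible controls. An admissible control is a function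 $u:[0,T]\times\mathbb{R}\to[-1,1]$ that is measurable in $t$ and Lipschitz in $x$, meaning that there is a constant $L\ge0$, independent of $t$, such that $|u(t,x)-u(t,y)|\le L|x-y|$ for all $t\in[0,T]$ and $x,y\in\mathbb{R}$. Here $\mu(\cdot)\in C^0([0,T],\mathcal{P}_c(\mathbb{R}))$ is the unique solution of the continuity equation $\partial_t\mu(t)+\nabla\cdot(u(t,\cdot)\mu(t))=0$, $\mu(0)=\mu^0$, with $\mu^0:=\frac12\chi_{[-1,1]}$ (the uniform probability measure on $[-1,1]$). The space $\mathcal{P}_c(\mathbb{R})$ is the set of compactly supported probability measures on $\mathbb{R}$ with the weak topology, in which $\mu_n\rightharpoonup\mu$ means $\int f\,d\mu_n\to\int f\,d\mu$ for all $f\in C_c^\infty(\mathbb{R})$. The equation is understood in the sense of distributions, i.e. $\int_0^T\int_{\mathbb{R}}\big(\partial_t\xi+u\,\partial_x\xi\big)\,d\mu(t)(x)\,dt=0$ for all $\xi\in C_c^\infty((0,T)\times\mathbb{R})$. The solution is given by $\mu(t)=(\Phi^u_t)_\#\mu^0$, where $\Phi^u_t$ is the flow map at time $t$ of $\dot x=u(t,x)$ starting at time $0$. *)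

theory Defs
  imports "HOL-Probability.Probability"
begin

text \<open>Absolute continuity on an interval \<open>S\<close>. Here \<open>D\<close> ranges over the finite families of
  non-overlapping compact subintervals of \<open>S\<close>.\<close>

definition abs_continuous_on :: "real set \<Rightarrow> (real \<Rightarrow> real) \<Rightarrow> bool" where
  "abs_continuous_on S f \<longleftrightarrow>
     (\<forall>\<epsilon>>0. \<exists>\<delta>>0. \<forall>D. D division_of \<Union>D \<longrightarrow> \<Union>D \<subseteq> S \<longrightarrow>
        (\<Sum>K\<in>D. measure lborel K) < \<delta> \<longrightarrow> (\<Sum>K\<in>D. \<bar>f (Sup K) - f (Inf K)\<bar>) < \<epsilon>)"

text \<open>Vectors of length \<open>N\<close> are functions on \<open>nat\<close>, of which only the values at the indices
  \<open>1..N\<close> matter. Likewise, functions of time matter only on \<open>{0..T}\<close>.\<close>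

definition var_vec :: "nat \<Rightarrow> (nat \<Rightarrow> real) \<Rightarrow> real" where
  "var_vec N x = (\<Sum>i=1..N. (x i)\<^sup>2) / real N - ((\<Sum>i=1..N. x i) / real N)\<^sup>2"

definition x_init :: "nat \<Rightarrow> nat \<Rightarrow> real" where
  "x_init N i = (2 * real i - real N - 1) / (real N - 1)"

definition admissible_N :: "real \<Rightarrow> nat \<Rightarrow> (nat \<Rightarrow> real \<Rightarrow> real) \<Rightarrow> bool" where
  "admissible_N T N u \<longleftrightarrow>
     (\<forall>i\<in>{1..N}. u i \<in> borel_measurable (lebesgue_on {0..T}) \<and> (\<forall>t\<in>{0..T}. u i t \<in> {-1..1}))"

definition trajectory_N ::
  "real \<Rightarrow> nat \<Rightarrow> (nat \<Rightarrow> real \<Rightarrow> real) \<Rightarrow> (nat \<Rightarrow> real \<Rightarrow> real) \<Rightarrow> bool" where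
  "trajectory_N T N u x \<longleftrightarrow>
     (\<forall>i\<in>{1..N}. abs_continuous_on {0..T} (x i) \<and> x i 0 = x_init N i \<and>
        (AE t in lebesgue_on {0..T}. (x i has_real_derivative u i t) (at t within {0..T})))"

definition cost_N ::
  "real \<Rightarrow> real \<Rightarrow> nat \<Rightarrow> (nat \<Rightarrow> real \<Rightarrow> real) \<Rightarrow> (nat \<Rightarrow> real \<Rightarrow> real) \<Rightarrow> real" where
  "cost_N T lam N u x =
     1 / (2 * real N) * (\<Sum>i=1..N. LINT t|lebesgue_on {0..T}. (u i t)\<^sup>2)
     - 1 / (2 * lam) * var_vec N (\<lambda>i. x i T)"

text \<open>The trajectory of an admissible control is unique on \<open>{0..T}\<close>, so the cost below is a
  function of the control alone.\<close>

definition optimal_control_N :: "real \<Rightarrow> real \<Rightarrow> nat \<Rightarrow> (nat \<Rightarrow> real \<Rightarrow> real) \<Rightarrow> bool" where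
  "optimal_control_N T lam N u \<longleftrightarrow>
     admissible_N T N u \<and>
     (\<exists>x. trajectory_N T N u x \<and>
        (\<forall>v y. admissible_N T N v \<longrightarrow> trajectory_N T N v y \<longrightarrow>
           cost_N T lam N u x \<le> cost_N T lam N v y))"

fun Ck :: "nat \<Rightarrow> ('a::euclidean_space \<Rightarrow> real) \<Rightarrow> bool" where
  "Ck 0 f \<longleftrightarrow> continuous_on UNIV f"
| "Ck (Suc k) f \<longleftrightarrow>
     (\<forall>x. f differentiable (at x)) \<and> (\<forall>v. Ck k (\<lambda>x. frechet_derivative f (at x) v))"

definition test_function_on :: "'a::euclidean_space set \<Rightarrow> ('a \<Rightarrow> real) \<Rightarrow> bool" where
  "test_function_on S f \<longleftrightarrow>
     (\<forall>k. Ck k f) \<and> compact (closure {x. f x \<noteq> 0}) \<and> closure {x. f x \<noteq> 0} \<subseteq> S"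

definition Pc :: "real measure set" where
  "Pc = {M. prob_space M \<and> sets M = sets borel \<and> (\<exists>K. compact K \<and> measure M K = 1)}"

definition var_measure :: "real measure \<Rightarrow> real" where
  "var_measure M = (LINT x|M. x\<^sup>2) - (LINT x|M. x)\<^sup>2"

definition mu_init :: "real measure" where
  "mu_init = uniform_measure lborel {-1..1}"

text \<open>A control is written \<open>u t x\<close>, with time first.\<close>

definition admissible_inf :: "real \<Rightarrow> (real \<Rightarrow> real \<Rightarrow> real) \<Rightarrow> bool" where
  "admissible_inf T u \<longleftrightarrow>
     (\<forall>t\<in>{0..T}. \<forall>x. u t x \<in> {-1..1}) \<and>
     (\<forall>x. (\<lambda>t. u t x) \<in> borel_measurable (lebesgue_on {0..T})) \<and>
     (\<exists>L\<ge>0. \<forall>t\<in>{0..T}. \<forall>x y. \<bar>u t x - u t y\<bar> \<le> L * \<bar>x - y\<bar>)"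

text \<open>Distributional solutions in \<open>C([0,T], Pc)\<close> of the continuity equation with velocity \<open>u\<close>.
  The second conjunct is continuity for the weak topology, which is the initial topology
  for the integrals of the test functions.\<close>

definition continuity_equation ::
  "real \<Rightarrow> (real \<Rightarrow> real \<Rightarrow> real) \<Rightarrow> (real \<Rightarrow> real measure) \<Rightarrow> bool" where
  "continuity_equation T u \<mu> \<longleftrightarrow>
     (\<forall>t\<in>{0..T}. \<mu> t \<in> Pc) \<and>
     (\<forall>f. test_function_on UNIV f \<longrightarrow> continuous_on {0..T} (\<lambda>t. LINT x|\<mu> t. f x)) \<and>
     \<mu> 0 = mu_init \<and>
     (\<forall>\<xi> :: real \<times> real \<Rightarrow> real. test_function_on ({0<..<T} \<times> UNIV) \<xi> \<longrightarrow>
        (LINT t|lebesgue_on {0..T}. LINT x|\<mu> t.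
           deriv (\<lambda>s. \<xi> (s, x)) t + u t x * deriv (\<lambda>y. \<xi> (t, y)) x) = 0)"

definition cost_inf ::
  "real \<Rightarrow> real \<Rightarrow> (real \<Rightarrow> real \<Rightarrow> real) \<Rightarrow> (real \<Rightarrow> real measure) \<Rightarrow> real" where
  "cost_inf T lam u \<mu> =
     1 / 2 * (LINT t|lebesgue_on {0..T}. LINT x|\<mu> t. (u t x)\<^sup>2)
     - 1 / (2 * lam) * var_measure (\<mu> T)"

text \<open>An admissible control has exactly one solution of the continuity equation on \<open>{0..T}\<close>, so
  the cost below is a function of the control alone.\<close>

definition minimizer_inf :: "real \<Rightarrow> real \<Rightarrow> (real \<Rightarrow> real \<Rightarrow> real) \<Rightarrow> bool" where
  "minimizer_inf T lam u \<longleftrightarrow>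
     admissible_inf T u \<and>
     (\<exists>\<mu>. continuity_equation T u \<mu> \<and>
        (\<forall>v \<nu>. admissible_inf T v \<longrightarrow> continuity_equation T v \<nu> \<longrightarrow>
           cost_inf T lam u \<mu> \<le> cost_inf T lam v \<nu>))"

end

theory Submission
  imports Defs
begin

text \<open>
  For a Lipschitz control \<open>u\<close> with flow \<open>\<Phi>\<close>, every solution of the continuity equation is
  \<open>\<mu> t = distr (\<mu> 0) borel (\<Phi> t)\<close>: in dimension one it suffices that the mass to the right of a characteristic is
  constant, and this follows by testing the equation with slowly varying (logarithmic) approximations of
  the indicator of a half line. By Jensen's inequality in time, the cost is then at least that of
  moving each \<open>a\<close> to \<open>\<Phi> T a\<close> with the constant speed \<open>w = (\<Phi> T a - a) / T\<close>, so only a static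
  minimisation over \<open>w\<close> remains. It is the same for \<open>N\<close> particles and for the limit.

  If \<open>lam > T\<close> or \<open>lam < 0\<close>, the static problem is convex and is solved by the projection of
  \<open>a / (lam - T)\<close> to \<open>{-1..1}\<close>. The trajectories \<open>a + t * w\<close> are those of the Lipschitz feedback
  \<open>u t x = clip (x / (lam - T + t))\<close>, which also generates the optimal \<open>N\<close>-particle trajectories. If
  \<open>0 < lam \<le> T\<close>, the pointwise optimum is \<open>w = sgn a\<close>. The controls \<open>clip (x / (\<epsilon> + t))\<close> approach its
  cost, but the flow of a Lipschitz control is continuous in \<open>a\<close> and so cannot attain it.
\<close>

subsection \<open>Smooth functions with compact support\<close>

text \<open>A solution is tested only against smooth functions, while the control is only Lipschitz
  in space and measurable in time. The usual duality proof of uniqueness, which transports a test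
  function along the flow, would therefore leave the class of test functions. Moving only the centre
  \<open>y\<close> of a cutoff \<open>h\<close> along a characteristic stays inside it and leaves
  the commutator \<open>(u t x - u t y) * h' (x - y)\<close>, which is at most
  \<open>L * \<bar>z * h' z\<bar>\<close> with \<open>z = x - y\<close>. A cutoff for which
  \<open>z * h' z\<close> is uniformly small must vary on a logarithmic scale, since only there the
  divergence of the integral of \<open>1 / z\<close> at 0 leaves room for it. For positive
  \<open>lam\<close>, the threshold \<open>lam = T\<close> is where the curvature
  \<open>T / 2 * (1 - T / lam)\<close> of the static integrand changes sign. The particles interact
  only through the squared mean in the variance. The initial data are symmetric about 0, so the
  candidates end with mean zero; for \<open>lam < 0\<close> the squared mean of a competitor has an
  unfavourable sign and is absorbed by the curvature term.\<close>

coinductive smooth :: "(real \<Rightarrow> real) \<Rightarrow> bool" where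
  "(\<And>x. (f has_real_derivative f' x) (at x)) \<Longrightarrow> smooth f' \<Longrightarrow> smooth f"

lemma smooth_deriv:
  assumes "smooth f"
  shows "(f has_real_derivative deriv f x) (at x)" and "smooth (deriv f)"
proof -
  obtain f' where f': "\<And>x. (f has_real_derivative f' x) (at x)" "smooth f'"
    using assms by (rule smooth.cases) blast
  then have "deriv f = f'" by (auto intro: DERIV_imp_deriv)
  with f' show "(f has_real_derivative deriv f x) (at x)" "smooth (deriv f)" by auto
qed

lemma smooth_continuous_on: "smooth f \<Longrightarrow> continuous_on S f"
  by (metis DERIV_isCont continuous_at_imp_continuous_on smooth_deriv(1))

text \<open>Reduces smoothness to exhibiting a family that contains the function and is closed under
  differentiation. Every use below picks a parametrised family, so that higher derivatives never
  have to be computed.\<close>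

lemma smooth_coinduct:
  assumes "X h" and step: "\<And>h. X h \<Longrightarrow> \<exists>h'. (\<forall>x. (h has_real_derivative h' x) (at x)) \<and> X h'"
  shows "smooth h"
proof (rule smooth.coinduct[of X, OF assms(1)])
  fix h assume "X h"
  from step[OF this] obtain h' where "\<forall>x. (h has_real_derivative h' x) (at x)" "X h'" by blast
  then show "\<exists>f f'. h = f \<and> (\<forall>x. (f has_real_derivative f' x) (at x)) \<and> (X f' \<or> smooth f')"
    by (intro exI[of _ h] exI[of _ h'] conjI refl disjI1)
qed

text \<open>Differentiation multiplies each coefficient by the inner slope and replaces
  \<open>f\<close> and \<open>g\<close> by their derivatives, so this family is closed. Scaling,
  translation, sums and differences are all instances of it.\<close>

lemma smooth_affine_comb:
  assumes "smooth f" "smooth g"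
  shows "smooth (\<lambda>x. c * f (a * x + b) + d * g (a' * x + b'))"
proof -
  define X where "X h \<longleftrightarrow> (\<exists>f g c d a b a' b'. smooth f \<and> smooth g \<and>
      h = (\<lambda>x. c * f (a * x + b) + d * g (a' * x + b')))" for h :: "real \<Rightarrow> real"
  have XI: "X (\<lambda>x. c * f (a * x + b) + d * g (a' * x + b'))" if "smooth f" "smooth g" for f g c a b d a' b'
    unfolding X_def
    by (rule exI[of _ f], rule exI[of _ g], rule exI[of _ c], rule exI[of _ d], rule exI[of _ a],
        rule exI[of _ b], rule exI[of _ a'], rule exI[of _ b']) (simp only: that)
  have step: "\<exists>h'. (\<forall>x. (h has_real_derivative h' x) (at x)) \<and> X h'" if "X h" for h
  proof -
    obtain f g c d a b a' b' where fg: "smooth f" "smooth g"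
      and h: "h = (\<lambda>x. c * f (a * x + b) + d * g (a' * x + b'))"
      using \<open>X h\<close> unfolding X_def by (elim exE conjE) (rule that)
    have "(h has_real_derivative (c * a) * deriv f (a * x + b) + (d * a') * deriv g (a' * x + b')) (at x)" for x
    proof -
      have "((\<lambda>x. f (a * x + b)) has_real_derivative deriv f (a * x + b) * a) (at x)"
        by (rule DERIV_chain2[OF smooth_deriv(1)[OF fg(1)]]) (auto intro!: derivative_eq_intros)
      moreover have "((\<lambda>x. g (a' * x + b')) has_real_derivative deriv g (a' * x + b') * a') (at x)"
        by (rule DERIV_chain2[OF smooth_deriv(1)[OF fg(2)]]) (auto intro!: derivative_eq_intros)
      ultimately show ?thesis
        unfolding h by (auto intro!: DERIV_cong[OF DERIV_add[OF DERIV_cmult DERIV_cmult]])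
    qed
    then have "\<forall>x. (h has_real_derivative (c * a) * deriv f (a * x + b) + (d * a') * deriv g (a' * x + b')) (at x)"
      by (rule allI)
    moreover have "X (\<lambda>x. (c * a) * deriv f (a * x + b) + (d * a') * deriv g (a' * x + b'))"
      by (intro XI smooth_deriv(2) fg)
    ultimately show ?thesis by (intro exI conjI)
  qed
  show ?thesis by (rule smooth_coinduct[of X, OF XI[OF assms] step])
qed

lemma smooth_const: "smooth (\<lambda>x. c)"
proof -
  define X where "X h \<longleftrightarrow> (\<exists>c. h = (\<lambda>x::real. c::real))" for h
  have X: "X (\<lambda>x. c)" for c unfolding X_def by blast
  show ?thesis
  proof (rule smooth_coinduct[of X, OF X])
    fix h assume "X h"
    then obtain c where h: "h = (\<lambda>x. c)" unfolding X_def by blast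
    have "\<forall>x. (h has_real_derivative 0) (at x)" unfolding h by simp
    with X[of 0] show "\<exists>h'. (\<forall>x. (h has_real_derivative h' x) (at x)) \<and> X h'"
      by (intro exI[of _ "\<lambda>_. 0"] conjI)
  qed
qed

lemma smooth_affine: "smooth f \<Longrightarrow> smooth (\<lambda>x. f (a * x + b))"
  using smooth_affine_comb[OF _ smooth_const[of 0], where c = 1 and d = 0] by simp

lemma smooth_scale: "smooth f \<Longrightarrow> smooth (\<lambda>x. c * f x)"
  using smooth_affine_comb[OF _ smooth_const[of 0], where a = 1 and b = 0 and d = 0] by simp

lemma smooth_frechet:
  "smooth f \<Longrightarrow> frechet_derivative f (at x) = (\<lambda>v. v * deriv f x)"
  using smooth_deriv(1)[of f x] unfolding has_field_derivative_def
  by (subst frechet_derivative_at[symmetric]) (auto simp: fun_eq_iff)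

lemma smooth_Ck: "smooth f \<Longrightarrow> Ck k f"
proof (induction k arbitrary: f)
  case 0 then show ?case by (simp add: smooth_continuous_on)
next
  case (Suc k)
  have "f differentiable (at x)" for x
    using smooth_deriv(1)[OF Suc.prems, of x] by (meson has_field_derivative_def differentiable_def)
  moreover have "Ck k (\<lambda>x. frechet_derivative f (at x) v)" for v
    using Suc.IH[OF smooth_scale[OF smooth_deriv(2)[OF Suc.prems], of v]]
    by (simp add: smooth_frechet[OF Suc.prems])
  ultimately show ?case by simp
qed

lemma Ck_add: "Ck k f \<Longrightarrow> Ck k g \<Longrightarrow> Ck k (\<lambda>x. f x + g x)"
proof (induction k arbitrary: f g)
  case 0 then show ?case by (auto intro: continuous_intros)
next
  case (Suc k)
  then have "frechet_derivative (\<lambda>x. f x + g x) (at x) v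
      = frechet_derivative f (at x) v + frechet_derivative g (at x) v" for x v
    by (subst frechet_derivative_at[OF has_derivative_add, symmetric, of f _ x g])
      (auto simp: frechet_derivative_works[symmetric])
  with Suc show ?case by simp
qed

lemma smooth_tensor_derivative:
  fixes p :: "real \<times> real"
  assumes "smooth f" "smooth g"
  shows "((\<lambda>p. f (fst p) * g (snd p)) has_derivative
      (\<lambda>v. (fst v * deriv f (fst p)) * g (snd p) + f (fst p) * (snd v * deriv g (snd p)))) (at p)"
proof -
  have f: "((\<lambda>p. f (fst p)) has_derivative (\<lambda>v. fst v * deriv f (fst p))) (at p)"
    using has_derivative_compose[OF has_derivative_fst[OF has_derivative_ident]
        smooth_deriv(1)[OF assms(1), unfolded has_field_derivative_def], of p]
    by (simp add: mult.commute)
  have g: "((\<lambda>p. g (snd p)) has_derivative (\<lambda>v. snd v * deriv g (snd p))) (at p)"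
    using has_derivative_compose[OF has_derivative_snd[OF has_derivative_ident]
        smooth_deriv(1)[OF assms(2), unfolded has_field_derivative_def], of p]
    by (simp add: mult.commute)
  show ?thesis
    by (rule has_derivative_eq_rhs[OF has_derivative_mult[OF f g]]) (auto simp: algebra_simps)
qed

text \<open>A directional derivative of a product in separate variables is a sum of two such
  products, with the components of the direction absorbed into the factors; this closes the
  induction on \<open>k\<close>.\<close>

lemma smooth_tensor_Ck:
  assumes "smooth f" "smooth g"
  shows "Ck k (\<lambda>p :: real \<times> real. f (fst p) * g (snd p))"
  using assms
proof (induction k arbitrary: f g)
  case 0
  have "continuous_on UNIV (\<lambda>p :: real \<times> real. f (fst p))"
    by (rule continuous_on_compose2[OF smooth_continuous_on[OF 0(1), of UNIV]]) (auto intro: continuous_intros)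
  moreover have "continuous_on UNIV (\<lambda>p :: real \<times> real. g (snd p))"
    by (rule continuous_on_compose2[OF smooth_continuous_on[OF 0(2), of UNIV]]) (auto intro: continuous_intros)
  ultimately show ?case by (simp add: continuous_on_mult)
next
  case (Suc k)
  note D = smooth_tensor_derivative[OF Suc.prems]
  have "Ck k (\<lambda>p. frechet_derivative (\<lambda>p. f (fst p) * g (snd p)) (at p) v)" for v
    using Ck_add[OF Suc.IH[OF smooth_scale[OF smooth_deriv(2)[OF Suc.prems(1)], of "fst v"] Suc.prems(2)]
        Suc.IH[OF Suc.prems(1) smooth_scale[OF smooth_deriv(2)[OF Suc.prems(2)], of "snd v"]]]
    by (simp add: frechet_derivative_at[OF D, symmetric])
  moreover have "(\<lambda>p. f (fst p) * g (snd p)) differentiable (at p)" for p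
    using D unfolding differentiable_def by blast
  ultimately show ?case by simp
qed


section \<open>A bump function and a smooth step\<close>

lemma DERIV_zero_if_quadratic_bound:
  fixes f :: "real \<Rightarrow> real"
  assumes "\<And>y. \<bar>f y - f x\<bar> \<le> C * (y - x)\<^sup>2"
  shows "(f has_real_derivative 0) (at x)"
  unfolding has_field_derivative_iff
proof (rule Lim_null_comparison)
  show "\<forall>\<^sub>F y in at x. norm ((f y - f x) / (y - x)) \<le> C * \<bar>y - x\<bar>"
    unfolding eventually_at_filter
  proof (rule always_eventually, intro allI impI)
    fix y assume "y \<noteq> x"
    then show "norm ((f y - f x) / (y - x)) \<le> C * \<bar>y - x\<bar>"
      using assms[of y] by (simp add: field_simps power2_eq_square abs_mult_self_eq)
  qed
  show "((\<lambda>y. C * \<bar>y - x\<bar>) \<longlongrightarrow> 0) (at x)"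
    by (auto intro!: tendsto_eq_intros)
qed

lemma power_le_fact_exp:
  fixes s :: real assumes "0 \<le> s" shows "s ^ n \<le> fact n * exp s"
proof -
  have "s ^ n /\<^sub>R fact n \<le> (\<Sum>k. s ^ k /\<^sub>R fact k)"
    using sum_le_suminf[OF summable_exp_generic, of "{n}" s] assms by auto
  then show ?thesis
    by (simp add: exp_def divide_simps mult.commute)
qed

text \<open>The general form of a derivative of \<open>exp (- 1 / (1 - x\<^sup>2))\<close>:
  polynomials \<open>p\<close> and powers \<open>m\<close> make the family closed under
  differentiation.\<close>

definition bump_fun :: "real poly \<Rightarrow> nat \<Rightarrow> real \<Rightarrow> real" where
  "bump_fun p m x = (if \<bar>x\<bar> < 1 then poly p x / (1 - x\<^sup>2) ^ m * exp (- 1 / (1 - x\<^sup>2)) else 0)"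

text \<open>With \<open>w = 1 - y\<^sup>2\<close>, the exponential is at most
  \<open>fact (m + 2) * w ^ (m + 2)\<close>. Dividing by \<open>w ^ m\<close> leaves two powers of
  \<open>w\<close>, and \<open>w\<close> is at most \<open>2 * \<bar>y - x\<bar>\<close> because
  \<open>x\<close> lies outside the open unit interval. This flatness makes the derivative 0 at the
  gluing points.\<close>

lemma bump_fun_quadratic_bound:
  "\<exists>C. \<forall>x y. \<bar>x\<bar> \<ge> 1 \<longrightarrow> \<bar>bump_fun p m y\<bar> \<le> C * (y - x)\<^sup>2"
proof -
  have "bounded (poly p ` {-1..1})"
    by (intro compact_imp_bounded compact_continuous_image continuous_intros) simp
  then obtain P where P: "\<And>x. x \<in> {-1..1} \<Longrightarrow> \<bar>poly p x\<bar> \<le> P"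
    unfolding bounded_iff by force
  have P0: "0 \<le> P" using P[of 0] by simp
  have "\<bar>bump_fun p m y\<bar> \<le> (4 * P * fact (m + 2)) * (y - x)\<^sup>2" if x: "\<bar>x\<bar> \<ge> 1" for x y
  proof (cases "\<bar>y\<bar> < 1")
    case True
    define w where "w = 1 - y\<^sup>2"
    have w0: "0 < w" using True by (simp add: w_def abs_square_less_1)
    have "w = (1 - \<bar>y\<bar>) * (1 + \<bar>y\<bar>)" by (simp add: w_def algebra_simps power2_eq_square)
    also have "\<dots> \<le> (1 - \<bar>y\<bar>) * 2" using True by (intro mult_left_mono) auto
    also have "\<dots> = 2 - 2 * \<bar>y\<bar>" by simp
    also have "\<dots> \<le> 2 * \<bar>y - x\<bar>" using x abs_triangle_ineq2[of x y] by (simp add: abs_minus_commute)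
    finally have w2: "w\<^sup>2 \<le> 4 * (y - x)\<^sup>2"
      using power_mono[of w "2 * \<bar>y - x\<bar>" 2] w0 by (simp add: power_mult_distrib)
    have "(1 / w) ^ (m + 2) \<le> fact (m + 2) * exp (1 / w)"
      by (rule power_le_fact_exp) (use w0 in simp)
    then have e: "exp (- 1 / w) \<le> fact (m + 2) * w ^ (m + 2)"
      using w0 by (simp add: power_one_over exp_minus field_simps del: power_Suc)
    have "\<bar>bump_fun p m y\<bar> = \<bar>poly p y\<bar> / w ^ m * exp (- 1 / w)"
      using True w0 by (simp add: bump_fun_def w_def[symmetric] abs_mult)
    also have "\<dots> \<le> P / w ^ m * (fact (m + 2) * w ^ (m + 2))"
      using P[of y] True w0 e P0 by (intro mult_mono divide_right_mono) (simp_all add: abs_less_iff)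
    also have "\<dots> = P * fact (m + 2) * w\<^sup>2"
      using w0 by (simp add: power_add del: fact_Suc power_Suc add_2_eq_Suc')
    also have "\<dots> \<le> P * fact (m + 2) * (4 * (y - x)\<^sup>2)"
      using w2 P0 by (intro mult_left_mono) auto
    finally show ?thesis by (simp only: mult_ac)
  next
    case False then show ?thesis using P0 by (simp add: bump_fun_def)
  qed
  then show ?thesis by blast
qed

text \<open>The polynomial is what the product rule gives over the common denominator
  \<open>w ^ (m + 2)\<close>, where \<open>[:1, 0, -1:]\<close> is \<open>w = 1 - x\<^sup>2\<close>:
  the terms come from \<open>p\<close>, from the power of \<open>w\<close>, and from the
  exponential.\<close>

lemma bump_fun_DERIV:
  "(bump_fun p m has_real_derivative
     bump_fun (pderiv p * [:1, 0, -1:]\<^sup>2 + [:0, 2 * real m:] * [:1, 0, -1:] * p - [:0, 2:] * p) (m + 2) x) (at x)"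
  (is "(_ has_real_derivative bump_fun ?q _ x) _")
proof (cases "\<bar>x\<bar> < 1")
  case True
  define w where "w = 1 - x\<^sup>2"
  have w0: "w > 0" using True by (simp add: w_def abs_square_less_1)
  have dw: "((\<lambda>x. 1 - x\<^sup>2) has_real_derivative - 2 * x) (at x)"
    by (auto intro!: derivative_eq_intros)
  have "((\<lambda>x. (1 - x\<^sup>2) ^ m) has_real_derivative real m * w ^ (m - 1) * (- 2 * x)) (at x)"
    using DERIV_power[OF dw, of m] by (simp add: w_def mult_ac)
  from DERIV_divide[OF poly_DERIV this, of p]
  have d1: "((\<lambda>x. poly p x / (1 - x\<^sup>2) ^ m) has_real_derivative
      (poly (pderiv p) x * w ^ m - poly p x * (real m * w ^ (m - 1) * (- 2 * x))) / (w ^ m * w ^ m)) (at x)"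
    using w0 by (simp add: w_def)
  have "((\<lambda>x. - 1 / (1 - x\<^sup>2)) has_real_derivative - 2 * x / (w * w)) (at x)"
    using DERIV_divide[OF DERIV_const dw, of "- 1"] w0 by (simp add: w_def)
  from DERIV_chain2[OF DERIV_exp this]
  have d2: "((\<lambda>x. exp (- 1 / (1 - x\<^sup>2))) has_real_derivative exp (- 1 / w) * (- 2 * x / (w * w))) (at x)"
    by (simp add: w_def)
  have "((\<lambda>x. poly p x / (1 - x\<^sup>2) ^ m * exp (- 1 / (1 - x\<^sup>2))) has_real_derivative
      (poly (pderiv p) x * w ^ m - poly p x * (real m * w ^ (m - 1) * (- 2 * x))) / (w ^ m * w ^ m) * exp (- 1 / w)
      + poly p x / w ^ m * (exp (- 1 / w) * (- 2 * x / (w * w)))) (at x)"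
    by (rule DERIV_cong[OF DERIV_mult[OF d1 d2]]) (simp add: w_def mult_ac)
  also have "(poly (pderiv p) x * w ^ m - poly p x * (real m * w ^ (m - 1) * (- 2 * x))) / (w ^ m * w ^ m) * exp (- 1 / w)
      + poly p x / w ^ m * (exp (- 1 / w) * (- 2 * x / (w * w))) = bump_fun ?q (m + 2) x"
  proof -
    have q: "poly ?q x = poly (pderiv p) x * w\<^sup>2 + 2 * real m * x * w * poly p x - 2 * x * poly p x"
      by (simp add: w_def algebra_simps power2_eq_square)
    have m: "real m * w ^ (m - 1) = real m * w ^ m / w"
      using w0 by (cases m) auto
    \<comment> \<open>The power \<open>w ^ m\<close> is generalised to \<open>D\<close> and the
      reciprocals get names, so that the identity becomes polynomial and \<open>algebra\<close> can
      decide it.\<close>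
    have alg: "(p' * D - b * (k * D / w * (- 2 * x))) / (D * D) * E + b / D * (E * (- 2 * x / (w * w)))
        = (p' * w\<^sup>2 + 2 * k * x * w * b - 2 * x * b) / (D * w\<^sup>2) * E" if "D \<noteq> 0" for p' D b k E :: real
    proof -
      define i j where "i = 1 / w" and "j = 1 / D"
      have "w * i = 1" "D * j = 1" using that w0 by (auto simp: i_def j_def)
      then have "(p' * D - b * (k * D * i * (- 2 * x))) * (j * j) * E + b * j * (E * (- 2 * x * (i * i)))
        = (p' * w\<^sup>2 + 2 * k * x * w * b - 2 * x * b) * (j * i * i) * E"
        by algebra
      then show ?thesis by (simp add: i_def j_def power2_eq_square)
    qed
    have "bump_fun ?q (m + 2) x = poly ?q x / (w ^ m * w\<^sup>2) * exp (- 1 / w)"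
      using True by (simp only: bump_fun_def w_def power_add if_True)
    then show ?thesis
      unfolding m q using alg[of "w ^ m"] w0 by simp
  qed
  finally show ?thesis
    by (rule has_field_derivative_transform_within_open[of _ _ _ "{-1<..<1}"])
      (use True in \<open>auto simp: bump_fun_def\<close>)
next
  case False
  obtain C where "\<And>y. \<bar>bump_fun p m y\<bar> \<le> C * (y - x)\<^sup>2"
    using bump_fun_quadratic_bound[of p m] False by (meson not_less)
  then have "(bump_fun p m has_real_derivative 0) (at x)"
    using False by (intro DERIV_zero_if_quadratic_bound[of _ _ C]) (simp add: bump_fun_def[of _ _ x])
  with False show ?thesis by (simp add: bump_fun_def[of _ _ x])
qed

lemma smooth_bump_fun: "smooth (bump_fun p m)"
proof -
  define X where "X h \<longleftrightarrow> (\<exists>p m. h = bump_fun p m)" for h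
  have X: "X (bump_fun p m)" for p m unfolding X_def by blast
  show ?thesis
  proof (rule smooth_coinduct[of X, OF X])
    fix h assume "X h"
    then obtain p m where h: "h = bump_fun p m" unfolding X_def by blast
    show "\<exists>h'. (\<forall>x. (h has_real_derivative h' x) (at x)) \<and> X h'"
      unfolding h by (rule exI, rule conjI, rule allI, rule bump_fun_DERIV, rule X)
  qed
qed

definition bump :: "real \<Rightarrow> real" where
  "bump x = (if \<bar>x\<bar> < 1 then exp (- 1 / (1 - x\<^sup>2)) else 0)"

lemma smooth_bump: "smooth bump"
proof -
  have "bump = bump_fun 1 0" by (auto simp: bump_def bump_fun_def fun_eq_iff)
  then show ?thesis using smooth_bump_fun[of 1 0] by simp
qed

lemma bump_nonneg: "0 \<le> bump x"
  by (simp add: bump_def)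

lemma bump_le_1: "bump x \<le> 1"
  by (auto simp: bump_def less_imp_le abs_square_less_1)

lemma smooth_step_exists:
  "\<exists>P. smooth P \<and> (\<forall>x. 0 \<le> deriv P x) \<and> (\<forall>x\<le>-1. P x = 0) \<and> (\<forall>x\<ge>1. P x = 1)"
proof -
  \<comment> \<open>The lower limit lies strictly to the left of the support, so that every
    \<open>x \<ge> -1\<close> is an interior point of \<open>{-2..x + 1}\<close>.\<close>
  define I where "I x = integral {-2..x} bump" for x
  have int: "bump integrable_on {a..b}" for a b
    by (intro integrable_continuous_real smooth_continuous_on smooth_bump)
  have I0: "I x = 0" if "x \<le> -1" for x
    unfolding I_def using that
    by (intro integral_unique has_integral_is_0) (auto simp: bump_def)
  have D: "(I has_real_derivative bump x) (at x)" for x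
  proof (cases "x < -1")
    case True
    have "((\<lambda>_. 0) has_real_derivative 0) (at x)" by simp
    then have "(I has_real_derivative 0) (at x)"
      by (rule has_field_derivative_transform_within_open[of _ _ _ "{..<-1}"]) (use True I0 in auto)
    with True show ?thesis by (simp add: bump_def)
  next
    case False
    have "(I has_real_derivative bump x) (at x within {-2..x + 1})"
      unfolding I_def using False
      by (intro integral_has_real_derivative smooth_continuous_on smooth_bump) auto
    moreover have "at x within {-2..x + 1} = at x"
      using False by (intro at_within_interior) auto
    ultimately show ?thesis by simp
  qed
  have I1: "I x = I 1" if "x \<ge> 1" for x
  proof -
    have "integral {1..x} bump = 0"
      by (intro integral_unique has_integral_is_0) (auto simp: bump_def)
    moreover have "integral {-2..1} bump + integral {1..x} bump = integral {-2..x} bump"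
      using that by (intro Henstock_Kurzweil_Integration.integral_combine int) auto
    ultimately show ?thesis by (simp add: I_def)
  qed
  have "I 1 > I (-1)"
  proof (rule DERIV_pos_imp_increasing_open[of "-1" 1 I])
    show "\<exists>y. (I has_real_derivative y) (at x) \<and> 0 < y" if "- 1 < x" "x < 1" for x
    proof -
      have "0 < bump x" using that by (simp add: bump_def abs_less_iff)
      with D[of x] show ?thesis by blast
    qed
    show "continuous_on {- 1..1} I"
      using D by (meson DERIV_isCont continuous_at_imp_continuous_on)
  qed simp
  then have pos: "I 1 > 0" using I0[of "-1"] by simp
  have sI: "smooth I" using D smooth_bump by (rule smooth.intros)
  define P where "P = (\<lambda>x. (1 / I 1) * I x)"
  have "(P has_real_derivative (1 / I 1) * bump x) (at x)" for x
    unfolding P_def by (rule DERIV_cmult[OF D])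
  then have "deriv P x = (1 / I 1) * bump x" for x by (rule DERIV_imp_deriv)
  moreover have "smooth P" unfolding P_def by (rule smooth_scale[OF sI])
  moreover have "P x = 0" if "x \<le> -1" for x using I0[OF that] by (simp add: P_def)
  moreover have "P x = 1" if "1 \<le> x" for x using I1[OF that] pos by (simp add: P_def)
  moreover have "0 \<le> (1 / I 1) * bump x" for x using pos bump_nonneg by simp
  ultimately show ?thesis by (intro exI[of _ P]) simp
qed

section \<open>Compactly supported test functions on the line\<close>

definition test_fun :: "(real \<Rightarrow> real) \<Rightarrow> bool" where
  "test_fun f \<longleftrightarrow> smooth f \<and> (\<exists>R. \<forall>x. \<bar>x\<bar> \<ge> R \<longrightarrow> f x = 0)"

lemma test_fun_smooth: "test_fun f \<Longrightarrow> smooth f"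
  by (simp add: test_fun_def)

lemma test_fun_deriv: "test_fun f \<Longrightarrow> test_fun (deriv f)"
proof -
  assume f: "test_fun f"
  then obtain R where R: "\<And>x. \<bar>x\<bar> \<ge> R \<Longrightarrow> f x = 0" by (auto simp: test_fun_def)
  have "deriv f x = 0" if "\<bar>x\<bar> \<ge> R + 1" for x
  proof -
    have "open ((\<lambda>x. \<bar>x\<bar>) -` {R<..})"
      by (intro open_vimage continuous_intros open_greaterThan)
    moreover have "((\<lambda>_. 0) has_real_derivative 0) (at x)" by simp
    ultimately have "(f has_real_derivative 0) (at x)"
      by (elim has_field_derivative_transform_within_open[where S = "(\<lambda>x. \<bar>x\<bar>) -` {R<..}"])
        (use that R in auto)
    then show ?thesis by (rule DERIV_imp_deriv)
  qed
  with f smooth_deriv(2) show ?thesis unfolding test_fun_def by blast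
qed

lemma test_fun_translate:
  assumes "test_fun f" shows "test_fun (\<lambda>x. f (x - z))"
proof -
  obtain R where R: "\<And>x. \<bar>x\<bar> \<ge> R \<Longrightarrow> f x = 0" using assms by (auto simp: test_fun_def)
  have "f (x - z) = 0" if "\<bar>x\<bar> \<ge> R + \<bar>z\<bar>" for x using that by (intro R) linarith
  moreover have "smooth (\<lambda>x. f (x - z))"
    using smooth_affine[OF test_fun_smooth[OF assms], of 1 "- z"] by simp
  ultimately show ?thesis unfolding test_fun_def by blast
qed

lemma deriv_translate:
  assumes "smooth f" shows "deriv (\<lambda>x. f (x - z)) x = deriv f (x - z)"
  by (rule DERIV_imp_deriv, rule DERIV_cong[OF DERIV_chain2[OF smooth_deriv(1)[OF assms]]])
    (auto intro!: derivative_eq_intros)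

lemma test_fun_bounded:
  assumes "test_fun f" obtains B where "B \<ge> 0" "\<And>x. \<bar>f x\<bar> \<le> B"
proof -
  obtain R where R: "\<And>x. \<bar>x\<bar> \<ge> R \<Longrightarrow> f x = 0" using assms by (auto simp: test_fun_def)
  have "bounded (f ` {-R..R})"
    by (intro compact_imp_bounded compact_continuous_image smooth_continuous_on test_fun_smooth assms) simp
  then obtain B where B: "\<And>x. x \<in> {-R..R} \<Longrightarrow> \<bar>f x\<bar> \<le> B"
    unfolding bounded_iff by force
  have "\<bar>f x\<bar> \<le> max B 0" for x
  proof (cases "\<bar>x\<bar> \<ge> R")
    case False
    then have "x \<in> {-R..R}" by auto
    from B[OF this] show ?thesis by simp
  qed (simp add: R)
  then show ?thesis by (intro that[of "max B 0"]) auto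
qed

lemma test_fun_lipschitz:
  assumes "smooth f" "\<And>x. \<bar>deriv f x\<bar> \<le> B" shows "\<bar>f x - f y\<bar> \<le> B * \<bar>x - y\<bar>"
  using field_differentiable_bound[of UNIV f "deriv f" B x y] assms
  by (auto intro: smooth_deriv(1))

lemma compact_support_if_bounded:
  fixes f :: "'a::euclidean_space \<Rightarrow> real"
  assumes "closed K" "bounded K" "\<And>x. x \<notin> K \<Longrightarrow> f x = 0"
  shows "compact (closure {x. f x \<noteq> 0})" "closure {x. f x \<noteq> 0} \<subseteq> K"
proof -
  have "{x. f x \<noteq> 0} \<subseteq> K" using assms(3) by auto
  then show "closure {x. f x \<noteq> 0} \<subseteq> K" by (rule closure_minimal) fact
  with assms(2) show "compact (closure {x. f x \<noteq> 0})"
    by (meson bounded_subset closed_closure compact_eq_bounded_closed)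
qed

lemma test_fun_test_function: 
  assumes "test_fun f" shows "test_function_on UNIV f"
proof -
  obtain R where R: "\<And>x. \<bar>x\<bar> \<ge> R \<Longrightarrow> f x = 0" using assms by (auto simp: test_fun_def)
  have "f x = 0" if "x \<notin> {-R..R}" for x using that by (intro R) auto
  from compact_support_if_bounded(1)[OF closed_atLeastAtMost bounded_closed_interval this]
  show ?thesis
    unfolding test_function_on_def using smooth_Ck[OF test_fun_smooth[OF assms]] by simp
qed

text \<open>Products of a time cutoff and a function of space are the only space-time test functions
  that the uniqueness argument inserts into the continuity equation.\<close>

lemma tensor_test_function:
  assumes f: "smooth f" "\<And>t. t \<notin> {a..b} \<Longrightarrow> f t = 0" and ab: "0 < a" "b < T" and g: "test_fun g"
  shows "test_function_on ({0<..<T} \<times> UNIV) (\<lambda>p. f (fst p) * g (snd p))"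
proof -
  obtain R where R: "\<And>x. \<bar>x\<bar> \<ge> R \<Longrightarrow> g x = 0" using g by (auto simp: test_fun_def)
  have g0: "g x = 0" if "x \<notin> {-R..R}" for x using that by (intro R) auto
  have z: "f (fst p) * g (snd p) = 0" if "p \<notin> {a..b} \<times> {-R..R}" for p
    using that f(2) g0 by (cases p) auto
  have c: "closed ({a..b} \<times> {-R..R})" "bounded ({a..b} \<times> {-R..R})"
    by (intro closed_Times bounded_Times; simp)+
  show ?thesis
    unfolding test_function_on_def
    using compact_support_if_bounded[OF c z] smooth_tensor_Ck[OF f(1) test_fun_smooth[OF g]] ab by fastforce
qed


section \<open>Cutoffs on a logarithmic scale\<close>

definition log_profile :: "(real \<Rightarrow> real) \<Rightarrow> real \<Rightarrow> nat \<Rightarrow> real \<Rightarrow> real" where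
  "log_profile f d m z = (if 0 < z then f (d * ln z) / z ^ m else 0)"

text \<open>Each derivative brings one more factor \<open>1 / z\<close> and turns \<open>f\<close>
  into \<open>d * f' - m * f\<close>, again a test function. This is why the exponent
  \<open>m\<close> is carried along.\<close>

lemma log_profile_DERIV:
  assumes "test_fun f" "d > 0"
  shows "(log_profile f d m has_real_derivative
    log_profile (\<lambda>w. d * deriv f w - real m * f w) d (Suc m) z) (at z)"
proof (cases "0 < z")
  case True
  have 1: "((\<lambda>z. f (d * ln z)) has_real_derivative deriv f (d * ln z) * (d * (1 / z))) (at z)"
    by (rule DERIV_chain2[OF smooth_deriv(1)[OF test_fun_smooth[OF assms(1)]] DERIV_cmult[OF DERIV_ln_divide[OF True]]])
  have alg: "(a * (d * (1 / z)) * z ^ m - b * (real m * z ^ (m - 1))) / (z ^ m * z ^ m)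
      = (d * a - real m * b) / z ^ Suc m" for a b
  proof -
    have m: "real m * z ^ (m - 1) = real m * z ^ m / z"
      using True by (cases m) auto
    show ?thesis unfolding m using True by (simp add: field_simps)
  qed
  have "((\<lambda>z. f (d * ln z) / z ^ m) has_real_derivative
      log_profile (\<lambda>w. d * deriv f w - real m * f w) d (Suc m) z) (at z)"
    using DERIV_divide[OF 1 DERIV_pow[of m z]] alg[of "deriv f (d * ln z)" "f (d * ln z)"] True
    by (simp add: log_profile_def)
  then show ?thesis
    by (rule has_field_derivative_transform_within_open[of _ _ _ "{0<..}"])
      (use True in \<open>auto simp: log_profile_def\<close>)
next
  case False
  obtain R where R: "\<And>x. \<bar>x\<bar> \<ge> R \<Longrightarrow> f x = 0" using assms by (auto simp: test_fun_def)
  \<comment> \<open>As \<open>z\<close> decreases to 0 the argument \<open>d * ln z\<close> leaves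
    the support of \<open>f\<close>, so the profile vanishes on a whole neighbourhood of the
    nonpositive reals and the gluing at 0 is trivial.\<close>
  have z: "log_profile f d m y = 0" if "y < exp (- \<bar>R\<bar> / d)" for y
  proof (cases "0 < y")
    case True
    then have "ln y < - \<bar>R\<bar> / d" using that by (metis exp_less_cancel_iff exp_ln)
    then have "d * ln y \<le> - \<bar>R\<bar>" using assms(2) by (simp add: field_simps)
    then have "f (d * ln y) = 0" by (intro R) linarith
    then show ?thesis by (simp add: log_profile_def)
  qed (simp add: log_profile_def)
  have "((\<lambda>_. 0) has_real_derivative 0) (at z)" by simp
  then have "(log_profile f d m has_real_derivative 0) (at z)"
    by (rule has_field_derivative_transform_within_open[of _ _ _ "{..<exp (- \<bar>R\<bar> / d)}"])
      (use False z in \<open>auto intro: le_less_trans[of _ 0]\<close>)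
  with False show ?thesis by (simp add: log_profile_def)
qed

lemma test_fun_log_profile:
  assumes "test_fun f" "d > 0" shows "test_fun (log_profile f d m)"
proof -
  define X where "X h \<longleftrightarrow> (\<exists>f m. test_fun f \<and> h = log_profile f d m)" for h
  have X: "X (log_profile f d m)" if "test_fun f" for f m
    unfolding X_def by (rule exI[of _ f], rule exI[of _ m]) (simp add: that)
  have "smooth (log_profile f d m)"
  proof (rule smooth_coinduct[of X, OF X[OF assms(1)]])
    fix h assume "X h"
    then obtain f m where f: "test_fun f" and h: "h = log_profile f d m"
      unfolding X_def by (elim exE conjE) (rule that)
    have "test_fun (\<lambda>w. d * deriv f w - real m * f w)"
    proof -
      have "smooth (\<lambda>w. d * deriv f w - real m * f w)"
        using smooth_affine_comb[OF test_fun_smooth[OF test_fun_deriv[OF f]] test_fun_smooth[OF f], of d 1 0 "- real m" 1 0] by simp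
      moreover obtain R where R: "\<And>x. \<bar>x\<bar> \<ge> R \<Longrightarrow> f x = 0" using f by (auto simp: test_fun_def)
      moreover obtain R' where R': "\<And>x. \<bar>x\<bar> \<ge> R' \<Longrightarrow> deriv f x = 0" using test_fun_deriv[OF f] by (auto simp: test_fun_def)
      ultimately show ?thesis unfolding test_fun_def by (intro conjI exI[of _ "max R R'"]) auto
    qed
    then have "X (log_profile (\<lambda>w. d * deriv f w - real m * f w) d (Suc m))" by (rule X)
    moreover have "\<forall>z. (h has_real_derivative log_profile (\<lambda>w. d * deriv f w - real m * f w) d (Suc m) z) (at z)"
      unfolding h by (rule allI) (rule log_profile_DERIV[OF f assms(2)])
    ultimately show "\<exists>h'. (\<forall>x. (h has_real_derivative h' x) (at x)) \<and> X h'"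
      by (intro exI conjI)
  qed
  moreover obtain R where R: "\<And>x. \<bar>x\<bar> \<ge> R \<Longrightarrow> f x = 0" using assms by (auto simp: test_fun_def)
  have "log_profile f d m z = 0" if "\<bar>z\<bar> \<ge> exp (R / d)" for z
  proof (cases "0 < z")
    case True
    then have "R / d \<le> ln z" using that by (simp add: ln_ge_iff)
    then have "R \<le> d * ln z" using assms(2) by (simp add: field_simps)
    then have "f (d * ln z) = 0" by (intro R) linarith
    then show ?thesis by (simp add: log_profile_def)
  qed (simp add: log_profile_def)
  ultimately show ?thesis unfolding test_fun_def by blast
qed

lemma test_fun_bump: "test_fun bump"
  unfolding test_fun_def by (intro conjI smooth_bump exI[of _ 1]) (simp add: bump_def)

text \<open>The derivative of \<open>bump (d * ln z)\<close> in \<open>z\<close> is of size \<open>d / z\<close>: this lets the commutator of a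
  Lipschitz velocity with an approximate indicator of a half line tend to \<open>0\<close>.\<close>

lemma log_cutoff_exists:
  "\<exists>C\<ge>0. \<forall>d>0. \<exists>h. test_fun h \<and> (\<forall>z. \<bar>z * deriv h z\<bar> \<le> d * C) \<and>
     (\<forall>z. h z = (if 0 < z then bump (d * ln z) else 0))"
proof -
  obtain C where C: "C \<ge> 0" "\<And>x. \<bar>deriv bump x\<bar> \<le> C"
    using test_fun_bounded[OF test_fun_deriv[OF test_fun_bump]] by blast
  have "\<exists>h. test_fun h \<and> (\<forall>z. \<bar>z * deriv h z\<bar> \<le> d * C) \<and> (\<forall>z. h z = (if 0 < z then bump (d * ln z) else 0))"
    if d: "d > 0" for d
  proof (intro exI conjI allI)
    show "test_fun (log_profile bump d 0)" by (rule test_fun_log_profile[OF test_fun_bump d])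
    show "log_profile bump d 0 z = (if 0 < z then bump (d * ln z) else 0)" for z
      by (simp add: log_profile_def)
    have "deriv (log_profile bump d 0) z = log_profile (\<lambda>w. d * deriv bump w) d (Suc 0) z" for z
      using log_profile_DERIV[OF test_fun_bump d, of 0 z] by (auto intro: DERIV_imp_deriv)
    then show "\<bar>z * deriv (log_profile bump d 0) z\<bar> \<le> d * C" for z
      using C d by (auto simp: log_profile_def abs_mult)
  qed
  with C(1) show ?thesis by blast
qed

subsection \<open>Solutions of the continuity equation\<close>

text \<open>The cutoffs with \<open>d = 1 / Suc n\<close>: for fixed \<open>z > 0\<close>,
  \<open>d * ln z\<close> tends to 0. As \<open>bump\<close> is not normalised, the limit carries
  the positive factor \<open>bump 0\<close>, which is cancelled where the sequence is used.\<close>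

lemma cutoff_sequence:
  obtains h C where "\<And>n. test_fun (h n)" "\<And>n z. \<bar>z * deriv (h n) z\<bar> \<le> C / real (Suc n)"
    "\<And>n z. \<bar>h n z\<bar> \<le> 1" "\<And>z. (\<lambda>n. h n z) \<longlonglongrightarrow> bump 0 * indicator {0<..} z"
proof -
  obtain C where C: "\<forall>d>0. \<exists>h. test_fun h \<and> (\<forall>z. \<bar>z * deriv h z\<bar> \<le> d * C) \<and>
     (\<forall>z. h z = (if 0 < z then bump (d * ln z) else 0))"
    using log_cutoff_exists by blast
  have "\<exists>h. test_fun h \<and> (\<forall>z. \<bar>z * deriv h z\<bar> \<le> (1 / real (Suc n)) * C) \<and>
     (\<forall>z. h z = (if 0 < z then bump ((1 / real (Suc n)) * ln z) else 0))" for n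
    by (rule C[rule_format]) simp
  then obtain h where h: "\<And>n. test_fun (h n)" "\<And>n z. \<bar>z * deriv (h n) z\<bar> \<le> (1 / real (Suc n)) * C"
     "\<And>n z. h n z = (if 0 < z then bump ((1 / real (Suc n)) * ln z) else 0)"
    by metis
  have "(\<lambda>n. h n z) \<longlonglongrightarrow> bump 0 * indicator {0<..} z" for z
  proof (cases "0 < z")
    case True
    have "(\<lambda>n. (1 / real (Suc n)) * ln z) \<longlonglongrightarrow> 0 * ln z"
      by (intro tendsto_mult_right LIMSEQ_Suc lim_1_over_n)
    moreover have "isCont bump 0"
      using smooth_deriv(1)[OF smooth_bump] by (rule DERIV_isCont)
    ultimately have "(\<lambda>n. bump ((1 / real (Suc n)) * ln z)) \<longlonglongrightarrow> bump 0"
      using isCont_tendsto_compose by fastforce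
    then show ?thesis unfolding h(3) using True by simp
  qed (simp add: h(3))
  moreover have "\<bar>h n z\<bar> \<le> 1" for n z
    unfolding h(3) using bump_nonneg bump_le_1 by simp
  ultimately show ?thesis using that[of h C] h(1,2) by simp
qed

lemma bump_0_pos: "bump 0 > 0"
  by (simp add: bump_def)

section \<open>Measurability in time and space\<close>

lemma test_fun_measurable: "test_fun f \<Longrightarrow> f \<in> borel_measurable borel"
  by (intro borel_measurable_continuous_onI smooth_continuous_on test_fun_smooth)

text \<open>The bridge between the two integrals in use: costs and the continuity equation are
  written with the Lebesgue integral, while the calculus in time is done with the gauge
  integral.\<close>

lemma lebesgue_on_interval_bounded:
  fixes f :: "real \<Rightarrow> real"
  assumes "f \<in> borel_measurable (lebesgue_on {a..b})" "\<And>x. x \<in> {a..b} \<Longrightarrow> \<bar>f x\<bar> \<le> C"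
  shows "f integrable_on {a..b}" "integrable (lebesgue_on {a..b}) f"
    "(LINT x|lebesgue_on {a..b}. f x) = integral {a..b} f"
proof -
  interpret finite_measure "lebesgue_on {a..b}" by (rule finite_measure_lebesgue_on) simp
  show 1: "integrable (lebesgue_on {a..b}) f"
    by (rule integrable_const_bound[of _ C]) (use assms in auto)
  show "(LINT x|lebesgue_on {a..b}. f x) = integral {a..b} f"
    by (rule lebesgue_integral_eq_integral[OF 1]) simp
  show "f integrable_on {a..b}"
    using 1 by (rule integrable_on_lebesgue_on) simp
qed

lemma continuous_lebesgue_on_measurable:
  fixes f :: "real \<Rightarrow> real"
  assumes "continuous_on {a..b} f" shows "f \<in> borel_measurable (lebesgue_on {a..b})"
  by (rule continuous_imp_measurable_on_sets_lebesgue[OF assms]) simp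

text \<open>Rounding \<open>x\<close> down to the grid of mesh \<open>1 / Suc n\<close> leaves
  countably many space points, for each of which measurability in \<open>t\<close> is given; the
  rounding error is at most \<open>L / Suc n\<close>.\<close>

lemma borel_measurable_lipschitz_pair:
  fixes f :: "'a \<Rightarrow> real \<Rightarrow> real"
  assumes meas: "\<And>x. (\<lambda>t. f t x) \<in> borel_measurable M" and L: "L \<ge> 0"
    and lip: "\<And>t x y. t \<in> space M \<Longrightarrow> \<bar>f t x - f t y\<bar> \<le> L * \<bar>x - y\<bar>"
  shows "(\<lambda>(t, x). f t x) \<in> borel_measurable (M \<Otimes>\<^sub>M borel)"
proof (rule borel_measurable_LIMSEQ_metric)
  fix n :: nat
  have 1: "(\<lambda>p. f (fst p) (real_of_int k / real (Suc n))) \<in> borel_measurable (M \<Otimes>\<^sub>M (borel :: real measure))" for k :: int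
    using measurable_compose[OF measurable_fst meas] by simp
  have 2: "(\<lambda>p. \<lfloor>real (Suc n) * snd p\<rfloor>) \<in> measurable (M \<Otimes>\<^sub>M borel) (count_space UNIV)"
    by measurable
  show "(\<lambda>p. f (fst p) (real_of_int \<lfloor>real (Suc n) * snd p\<rfloor> / real (Suc n)))
      \<in> borel_measurable (M \<Otimes>\<^sub>M borel)"
    by (rule measurable_compose_countable[OF 1 2])
next
  fix p assume "p \<in> space (M \<Otimes>\<^sub>M (borel :: real measure))"
  then have t: "fst p \<in> space M" by (auto simp: space_pair_measure)
  obtain t x where p: "p = (t, x)" by force
  have "(\<lambda>n. f t (real_of_int \<lfloor>real (Suc n) * x\<rfloor> / real (Suc n)) - f t x) \<longlonglongrightarrow> 0"
  proof (rule Lim_null_comparison)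
    show "\<forall>\<^sub>F n in sequentially. norm (f t (real_of_int \<lfloor>real (Suc n) * x\<rfloor> / real (Suc n)) - f t x)
        \<le> L * (1 / real (Suc n))"
    proof (rule always_eventually, rule allI)
      fix n
      have "\<bar>real_of_int \<lfloor>real (Suc n) * x\<rfloor> - real (Suc n) * x\<bar> \<le> 1" by linarith
      then have "\<bar>(real_of_int \<lfloor>real (Suc n) * x\<rfloor> - real (Suc n) * x) / real (Suc n)\<bar> \<le> 1 / real (Suc n)"
        by (simp only: abs_divide abs_of_nat) (rule divide_right_mono, simp_all)
      then have "\<bar>real_of_int \<lfloor>real (Suc n) * x\<rfloor> / real (Suc n) - x\<bar> \<le> 1 / real (Suc n)"
        by (simp only: diff_divide_distrib) simp
      then have "L * \<bar>real_of_int \<lfloor>real (Suc n) * x\<rfloor> / real (Suc n) - x\<bar> \<le> L * (1 / real (Suc n))"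
        by (rule mult_left_mono[OF _ L])
      with lip[of t "real_of_int \<lfloor>real (Suc n) * x\<rfloor> / real (Suc n)" x] t p
      show "norm (f t (real_of_int \<lfloor>real (Suc n) * x\<rfloor> / real (Suc n)) - f t x) \<le> L * (1 / real (Suc n))"
        by simp
    qed
    show "(\<lambda>n. L * (1 / real (Suc n))) \<longlonglongrightarrow> 0"
      using tendsto_mult_right_zero[OF LIMSEQ_Suc[OF lim_1_over_n], of L] by simp
  qed
  then show "(\<lambda>n. f (fst p) (real_of_int \<lfloor>real (Suc n) * snd p\<rfloor> / real (Suc n))) \<longlonglongrightarrow> (case p of (t, x) \<Rightarrow> f t x)"
    unfolding p by (simp add: LIM_zero_iff)
qed

locale velocity =
  fixes T :: real and u :: "real \<Rightarrow> real \<Rightarrow> real" and L :: real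
  assumes T: "T > 0"
    and bound: "t \<in> {0..T} \<Longrightarrow> \<bar>u t x\<bar> \<le> 1"
    and meas: "(\<lambda>t. u t x) \<in> borel_measurable (lebesgue_on {0..T})"
    and L: "L \<ge> 0"
    and lip: "t \<in> {0..T} \<Longrightarrow> \<bar>u t x - u t y\<bar> \<le> L * \<bar>x - y\<bar>"
begin

lemma joint_measurable [measurable]:
  "(\<lambda>(t, x). u t x) \<in> borel_measurable (lebesgue_on {0..T} \<Otimes>\<^sub>M borel)"
  by (rule borel_measurable_lipschitz_pair[OF meas L lip]) simp

lemma continuous: "t \<in> {0..T} \<Longrightarrow> continuous_on UNIV (u t)"
  by (rule lipschitz_on_continuous_on[of L], rule lipschitz_onI) (use lip L in \<open>auto simp: dist_real_def\<close>)

lemma borel_measurable_space: "t \<in> {0..T} \<Longrightarrow> u t \<in> borel_measurable borel"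
  by (intro borel_measurable_continuous_onI continuous)

end

locale cont_eq = velocity +
  fixes \<mu> :: "real \<Rightarrow> real measure"
  assumes ce: "continuity_equation T u \<mu>"
begin

lemma prob: "t \<in> {0..T} \<Longrightarrow> prob_space (\<mu> t)"
  and sets: "t \<in> {0..T} \<Longrightarrow> sets (\<mu> t) = sets borel"
  using ce by (auto simp: continuity_equation_def Pc_def)

lemma borel_measurable_eq: "t \<in> {0..T} \<Longrightarrow> borel_measurable (\<mu> t) = borel_measurable borel"
  by (rule measurable_cong_sets[OF sets refl])

lemma test_fun_integral_continuous: "test_fun f \<Longrightarrow> continuous_on {0..T} (\<lambda>t. LINT x|\<mu> t. f x)"
  using ce test_fun_test_function by (auto simp: continuity_equation_def)

lemma integrable_bounded:
  fixes f :: "real \<Rightarrow> real"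
  assumes "t \<in> {0..T}" "f \<in> borel_measurable borel" "\<And>x. \<bar>f x\<bar> \<le> B"
  shows "integrable (\<mu> t) f"
proof -
  interpret prob_space "\<mu> t" by (rule prob[OF assms(1)])
  show ?thesis
    by (rule integrable_const_bound[of _ B])
      (use assms borel_measurable_eq[OF assms(1)] in auto)
qed

lemma integral_bounded:
  fixes f :: "real \<Rightarrow> real"
  assumes "t \<in> {0..T}" "f \<in> borel_measurable borel" "\<And>x. \<bar>f x\<bar> \<le> B"
  shows "\<bar>LINT x|\<mu> t. f x\<bar> \<le> B"
proof -
  interpret prob_space "\<mu> t" by (rule prob[OF assms(1)])
  have "\<bar>LINT x|\<mu> t. f x\<bar> \<le> (LINT x|\<mu> t. \<bar>f x\<bar>)"
    using integral_norm_bound[of "\<mu> t" f] by simp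
  also have "\<dots> \<le> (LINT x|\<mu> t. B)"
    by (intro integral_mono integrable_abs integrable_bounded[OF assms]) (use assms(3) in auto)
  finally show ?thesis by (simp add: prob_space)
qed

lemma half_line_limit:
  assumes t: "t \<in> {0..T}" and h: "\<And>n. test_fun (h n)" "\<And>n z. \<bar>h n z\<bar> \<le> 1"
    "\<And>z. (\<lambda>n. h n z) \<longlonglongrightarrow> bump 0 * indicator {0<..} z"
  shows "(\<lambda>n. LINT x|\<mu> t. h n (x - a)) \<longlonglongrightarrow> bump 0 * measure (\<mu> t) {a<..}"
proof -
  interpret prob_space "\<mu> t" by (rule prob[OF t])
  have [simp]: "sets (\<mu> t) = sets borel" by (rule sets[OF t])
  have [simp]: "space (\<mu> t) = UNIV" using sets_eq_imp_space_eq[OF sets[OF t]] by simp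
  have "(\<lambda>n. LINT x|\<mu> t. h n (x - a)) \<longlonglongrightarrow> (LINT x|\<mu> t. bump 0 * indicator {a<..} x)"
  proof (rule integral_dominated_convergence[where w = "\<lambda>_. 1"])
    show "(\<lambda>x. h n (x - a)) \<in> borel_measurable (\<mu> t)" for n
      unfolding borel_measurable_eq[OF t] by (rule test_fun_measurable[OF test_fun_translate[OF h(1)]])
    show "(\<lambda>x. bump 0 * indicator {a<..} x) \<in> borel_measurable (\<mu> t)"
      unfolding borel_measurable_eq[OF t] by measurable
    have "(\<lambda>n. h n (x - a)) \<longlonglongrightarrow> bump 0 * indicator {a<..} x" for x
      using h(3)[of "x - a"] by (simp add: indicator_def)
    then show "AE x in \<mu> t. (\<lambda>n. h n (x - a)) \<longlonglongrightarrow> bump 0 * indicator {a<..} x" by simp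
  qed (use h(2) in simp_all)
  then show ?thesis by simp
qed

text \<open>The equation provides only weak continuity of \<open>\<mu>\<close>. The open half lines
  generate the Borel sets, and the mass of each is a pointwise limit of the continuous functions
  obtained from the cutoffs.\<close>

lemma kernel [measurable]: "\<mu> \<in> lebesgue_on {0..T} \<rightarrow>\<^sub>M prob_algebra borel"
proof (rule measurable_prob_algebra_generated[where \<Omega> = UNIV and G = "range greaterThan"])
  show "sets borel = sigma_sets UNIV (range (greaterThan :: real \<Rightarrow> _))"
    
    using arg_cong[OF borel_eq_greaterThan[where 'a = real], of sets] by (simp add: eucl_less_def greaterThan_def)
  show "Int_stable (range (greaterThan :: real \<Rightarrow> _))"
  proof (rule Int_stableI_image)
    show "\<exists>c\<in>UNIV. {a<..} \<inter> {b<..} = {c<..}" for a b :: real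
      by (rule bexI[of _ "max a b"]) auto
  qed
  fix A :: "real set" assume "A \<in> range greaterThan"
  then obtain a where A: "A = {a<..}" by auto
  obtain h C where h: "\<And>n. test_fun (h n)" "\<And>n z. \<bar>z * deriv (h n) z\<bar> \<le> C / real (Suc n)"
    "\<And>n z. \<bar>h n z\<bar> \<le> 1" "\<And>z. (\<lambda>n. h n z) \<longlonglongrightarrow> bump 0 * indicator {0<..} z"
    by (rule cutoff_sequence, rule that)
  have "(\<lambda>t. bump 0 * measure (\<mu> t) {a<..}) \<in> borel_measurable (lebesgue_on {0..T})"
  proof (rule borel_measurable_LIMSEQ_metric)
    show "(\<lambda>t. LINT x|\<mu> t. h n (x - a)) \<in> borel_measurable (lebesgue_on {0..T})" for n
      by (intro continuous_lebesgue_on_measurable test_fun_integral_continuous test_fun_translate h)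
    show "(\<lambda>n. LINT x|\<mu> t. h n (x - a)) \<longlonglongrightarrow> bump 0 * measure (\<mu> t) {a<..}"
      if "t \<in> space (lebesgue_on {0..T})" for t
      using that by (intro half_line_limit h) simp
  qed
  then have "(\<lambda>t. (1 / bump 0) * (bump 0 * measure (\<mu> t) {a<..})) \<in> borel_measurable (lebesgue_on {0..T})"
    by (rule borel_measurable_times[OF borel_measurable_const])
  then have "(\<lambda>t. measure (\<mu> t) A) \<in> borel_measurable (lebesgue_on {0..T})"
    using bump_0_pos by (simp add: A)
  then have "(\<lambda>t. ennreal (measure (\<mu> t) A)) \<in> borel_measurable (lebesgue_on {0..T})"
    by measurable
  then show "(\<lambda>t. emeasure (\<mu> t) A) \<in> borel_measurable (lebesgue_on {0..T})"
    by (rule subst[OF measurable_cong, rotated])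
      (auto simp: finite_measure.emeasure_eq_measure[OF prob_space.finite_measure[OF prob]])
qed (auto simp: prob sets)

lemma integral_kernel_measurable:
  fixes f :: "real \<Rightarrow> real \<Rightarrow> real"
  assumes "(\<lambda>(t, x). f t x) \<in> borel_measurable (lebesgue_on {0..T} \<Otimes>\<^sub>M borel)"
    and "\<And>t x. t \<in> {0..T} \<Longrightarrow> \<bar>f t x\<bar> \<le> B"
  shows "(\<lambda>t. LINT x|\<mu> t. f t x) \<in> borel_measurable (lebesgue_on {0..T})"
proof -
  have f: "f t \<in> borel_measurable borel" if "t \<in> {0..T}" for t
    using measurable_compose[OF measurable_Pair1' assms(1), of t] that by simp
  \<comment> \<open>Adding \<open>B\<close> makes the integrand nonnegative, so that measurability
    of nonnegative integrals against a kernel applies.\<close>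
  have "(\<lambda>(t, x). ennreal (f t x + B)) \<in> borel_measurable (lebesgue_on {0..T} \<Otimes>\<^sub>M borel)"
    using assms(1) by (simp add: split_beta)
  from nn_integral_measurable_subprob_algebra2[OF this measurable_prob_algebraD[OF kernel]]
  have "(\<lambda>t. enn2real (\<integral>\<^sup>+x. ennreal (f t x + B) \<partial>\<mu> t) - B) \<in> borel_measurable (lebesgue_on {0..T})"
    by simp
  then show ?thesis
  proof (rule subst[OF measurable_cong, rotated])
    fix t assume "t \<in> space (lebesgue_on {0..T})"
    then have t: "t \<in> {0..T}" by simp
    interpret prob_space "\<mu> t" by (rule prob[OF t])
    have "0 \<le> f t x + B" for x using assms(2)[OF t, of x] by (simp add: abs_le_iff)
    then have "enn2real (\<integral>\<^sup>+x. ennreal (f t x + B) \<partial>\<mu> t) = (LINT x|\<mu> t. f t x + B)"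
      by (intro integral_eq_nn_integral[symmetric])
        (simp_all only: borel_measurable_eq[OF t] borel_measurable_add[OF f[OF t] borel_measurable_const] AE_I2)
    also have "\<dots> = (LINT x|\<mu> t. f t x) + B"
      using integrable_bounded[OF t f[OF t] assms(2)[OF t]] by (simp add: prob_space)
    finally show "enn2real (\<integral>\<^sup>+x. ennreal (f t x + B) \<partial>\<mu> t) - B = (LINT x|\<mu> t. f t x)" by simp
  qed
qed

end

section \<open>The weak form between two times\<close>

lemma mollified_evaluation:
  assumes P: "smooth P" "\<And>x. 0 \<le> deriv P x" "\<And>x. x \<le> -1 \<Longrightarrow> P x = 0" "\<And>x. 1 \<le> x \<Longrightarrow> P x = 1"
    and G: "continuous_on {0..T} G" and s: "0 < s" "s < T"
  shows "(\<lambda>n. integral {0..T} (\<lambda>\<tau>. real (Suc n) * deriv P (real (Suc n) * (\<tau> - s)) * G \<tau>)) \<longlonglongrightarrow> G s"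
proof (rule LIMSEQ_I)
  fix e :: real assume e: "0 < e"
  have "s \<in> {0..T}" using s by simp
  with G e have "\<exists>d>0. \<forall>\<tau>\<in>{0..T}. dist \<tau> s < d \<longrightarrow> dist (G \<tau>) (G s) < e / 2"
    unfolding continuous_on_iff by (meson half_gt_zero)
  then obtain d where d: "d > 0" "\<And>\<tau>. \<tau> \<in> {0..T} \<Longrightarrow> \<bar>\<tau> - s\<bar> < d \<Longrightarrow> \<bar>G \<tau> - G s\<bar> < e / 2"
    unfolding dist_real_def by blast
  \<comment> \<open>The distances of \<open>s\<close> to 0 and to \<open>T\<close> are included so
    that the kernel fits inside \<open>{0..T}\<close> and none of its mass is lost.\<close>
  define d' where "d' = min d (min s (T - s))"
  have "d' > 0" using d s by (simp add: d'_def)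
  from this obtain n0 where n0: "1 / real (Suc n0) < d'" by (rule nat_approx_posE)
  have P': "deriv P x = 0" if "\<bar>x\<bar> > 1" for x
  proof (rule DERIV_imp_deriv)
    show "(P has_real_derivative 0) (at x)"
    proof (cases "x > 1")
      case True
      show ?thesis
        by (rule has_field_derivative_transform_within_open[OF DERIV_const open_greaterThan, of x 1 1])
          (use True P(4) in simp_all)
    next
      case False
      with that have "x < -1" by auto
      then show ?thesis
        by (intro has_field_derivative_transform_within_open[OF DERIV_const open_lessThan, of x "-1" 0])
          (use P(3) in simp_all)
    qed
  qed
  have "norm (integral {0..T} (\<lambda>\<tau>. real (Suc n) * deriv P (real (Suc n) * (\<tau> - s)) * G \<tau>) - G s) < e"
    if n: "n \<ge> n0" for n
  proof -
    define N where "N = real (Suc n)"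
    have N: "N > 0" "1 / N < d'"
    proof -
      have "1 / N \<le> 1 / real (Suc n0)" unfolding N_def using n by (intro divide_left_mono) auto
      then show "1 / N < d'" using n0 by simp
    qed (simp add: N_def)
    define K where "K \<tau> = P (N * (\<tau> - s))" for \<tau>
    \<comment> \<open>An approximate identity: nonnegative, concentrated within \<open>1 / N\<close>
      of \<open>s\<close>, and of integral 1 because its primitive \<open>K\<close> climbs from 0 to
      1.\<close>
    define k where "k \<tau> = N * deriv P (N * (\<tau> - s))" for \<tau>
    have Kk: "(K has_real_derivative k \<tau>) (at \<tau>)" for \<tau>
      unfolding K_def k_def
      by (rule DERIV_cong[OF DERIV_chain2[OF smooth_deriv(1)[OF P(1)]]]) (auto intro!: derivative_eq_intros)
    have "1 / N < s" "1 / N < T - s" using N by (auto simp: d'_def)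
    then have "N * (0 - s) \<le> -1" "N * (T - s) \<ge> 1"
      using N by (simp_all add: field_simps)
    then have K0T: "K 0 = 0" "K T = 1" using P by (auto simp: K_def)
    have "(k has_integral K T - K 0) {0..T}"
    proof (rule fundamental_theorem_of_calculus)
      show "(K has_vector_derivative k \<tau>) (at \<tau> within {0..T})" for \<tau>
        unfolding has_real_derivative_iff_has_vector_derivative[symmetric]
        by (rule has_field_derivative_at_within[OF Kk])
    qed (use s in simp)
    then have k1: "(k has_integral 1) {0..T}" by (simp add: K0T)
    have "k = (\<lambda>\<tau>. N * deriv P (N * \<tau> + - N * s))" by (simp add: k_def fun_eq_iff right_diff_distrib)
    then have kc: "continuous_on {0..T} k"
      using smooth_continuous_on[OF smooth_scale[OF smooth_affine[OF smooth_deriv(2)[OF P(1)],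
          of N "- N * s"]], of "{0..T}" N] by simp
    have i1: "(\<lambda>\<tau>. k \<tau> * G \<tau>) integrable_on {0..T}"
      by (intro integrable_continuous_real continuous_intros kc G)
    have i2: "(\<lambda>\<tau>. k \<tau> * (G \<tau> - G s)) integrable_on {0..T}"
      by (intro integrable_continuous_real continuous_intros kc G)
    have "integral {0..T} (\<lambda>\<tau>. k \<tau> * G \<tau>) - G s
        = integral {0..T} (\<lambda>\<tau>. k \<tau> * G \<tau>) - integral {0..T} (\<lambda>\<tau>. k \<tau> * G s)"
      by (simp only: integral_unique[OF has_integral_mult_left[OF k1]] mult_1)
    also have "\<dots> = integral {0..T} (\<lambda>\<tau>. k \<tau> * G \<tau> - k \<tau> * G s)"
      by (rule integral_diff[symmetric, OF i1 has_integral_integrable[OF has_integral_mult_left[OF k1]]])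
    also have "\<dots> = integral {0..T} (\<lambda>\<tau>. k \<tau> * (G \<tau> - G s))"
      by (simp add: right_diff_distrib)
    also have "norm \<dots> \<le> integral {0..T} (\<lambda>\<tau>. k \<tau> * (e / 2))"
    proof (rule integral_norm_bound_integral[OF i2 has_integral_integrable[OF has_integral_mult_left[OF k1]]])
      fix \<tau> assume \<tau>: "\<tau> \<in> {0..T}"
      have k0: "0 \<le> k \<tau>" using P(2) N by (simp add: k_def)
      show "norm (k \<tau> * (G \<tau> - G s)) \<le> k \<tau> * (e / 2)"
      proof (cases "\<bar>\<tau> - s\<bar> < d")
        case True
        from mult_left_mono[OF less_imp_le[OF d(2)[OF \<tau> True]] k0] k0 show ?thesis by (simp only: real_norm_def abs_mult abs_of_nonneg)
      next
        case False
        then have "1 / N < \<bar>\<tau> - s\<bar>" using N by (simp add: d'_def)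
        then have "N * \<bar>\<tau> - s\<bar> > 1" using N by (simp add: field_simps)
        then have "\<bar>N * (\<tau> - s)\<bar> > 1" using N by (simp only: abs_mult abs_of_pos)
        from P'[OF this] show ?thesis by (simp add: k_def)
      qed
    qed
    also have "\<dots> = e / 2" by (simp only: integral_unique[OF has_integral_mult_left[OF k1]] mult_1)
    also have "\<dots> < e" using e by simp
    finally show ?thesis by (simp add: k_def N_def)
  qed
  then show "\<exists>no. \<forall>n\<ge>no. norm (integral {0..T} (\<lambda>\<tau>. real (Suc n) * deriv P (real (Suc n) * (\<tau> - s)) * G \<tau>) - G s) < e"
    by blast
qed

context cont_eq begin

text \<open>The formal time derivative of the integral of \<open>f\<close> against
  \<open>\<mu> t\<close>.\<close>

definition flux :: "(real \<Rightarrow> real) \<Rightarrow> real \<Rightarrow> real" where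
  "flux f t = (LINT x|\<mu> t. u t x * deriv f x)"

lemma flux_facts:
  assumes f: "test_fun f" and B: "\<And>x. \<bar>deriv f x\<bar> \<le> B"
  shows "flux f \<in> borel_measurable (lebesgue_on {0..T})"
    and "t \<in> {0..T} \<Longrightarrow> \<bar>flux f t\<bar> \<le> B"
    and "t \<in> {0..T} \<Longrightarrow> integrable (\<mu> t) (\<lambda>x. u t x * deriv f x)"
proof -
  have f': "deriv f \<in> borel_measurable borel" by (rule test_fun_measurable[OF test_fun_deriv[OF f]])
  have b: "\<bar>u t x * deriv f x\<bar> \<le> B" if "t \<in> {0..T}" for t x
    using mult_mono[OF bound[OF that, of x] B[of x]] by (simp add: abs_mult)
  have m: "(\<lambda>x. u t x * deriv f x) \<in> borel_measurable borel" if "t \<in> {0..T}" for t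
    using borel_measurable_space[OF that] f' by simp
  have "(\<lambda>(t, x). u t x * deriv f x) \<in> borel_measurable (lebesgue_on {0..T} \<Otimes>\<^sub>M borel)"
    using borel_measurable_times[OF joint_measurable measurable_compose[OF measurable_snd f']]
    by (simp add: split_beta)
  from integral_kernel_measurable[OF this b]
  show "flux f \<in> borel_measurable (lebesgue_on {0..T})" by (simp add: flux_def[abs_def])
  show "\<bar>flux f t\<bar> \<le> B" if "t \<in> {0..T}"
    unfolding flux_def by (rule integral_bounded[OF that m[OF that] b[OF that]])
  show "integrable (\<mu> t) (\<lambda>x. u t x * deriv f x)" if "t \<in> {0..T}"
    by (rule integrable_bounded[OF that m[OF that] b[OF that]])
qed

lemma flux_integrable_on:
  assumes "test_fun f" "0 \<le> s" "t \<le> T" shows "flux f integrable_on {s..t}"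
proof -
  obtain B where B: "\<And>x. \<bar>deriv f x\<bar> \<le> B" using test_fun_bounded[OF test_fun_deriv[OF assms(1)]] by blast
  note F = flux_facts[OF assms(1) B]
  have "flux f integrable_on {0..T}" by (rule lebesgue_on_interval_bounded(1)[OF F(1,2)])
  then show ?thesis by (rule integrable_on_subinterval) (use assms in auto)
qed

lemma weak_form_tensor:
  assumes f: "test_fun f" and a: "smooth \<alpha>" "\<And>t. t \<notin> {a..b} \<Longrightarrow> \<alpha> t = 0" and ab: "0 < a" "b < T"
  shows "integral {0..T} (\<lambda>t. deriv \<alpha> t * (LINT x|\<mu> t. f x)) + integral {0..T} (\<lambda>t. \<alpha> t * flux f t) = 0"
proof -
  obtain B where B: "\<And>x. \<bar>deriv f x\<bar> \<le> B" using test_fun_bounded[OF test_fun_deriv[OF f]] by blast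
  obtain B0 where B0: "\<And>x. \<bar>f x\<bar> \<le> B0" using test_fun_bounded[OF f] by blast
  note F = flux_facts[OF f B]
  have "test_fun \<alpha>" unfolding test_fun_def
    by (intro conjI a(1) exI[of _ "max \<bar>a\<bar> \<bar>b\<bar> + 1"] allI impI a(2)) auto
  then obtain A where A: "\<And>x. \<bar>\<alpha> x\<bar> \<le> A" using test_fun_bounded by blast
  have inner: "(LINT x|\<mu> t. deriv (\<lambda>s. \<alpha> s * f x) t + u t x * deriv (\<lambda>y. \<alpha> t * f y) x)
      = deriv \<alpha> t * (LINT x|\<mu> t. f x) + \<alpha> t * flux f t" if t: "t \<in> {0..T}" for t
  proof -
    have "deriv (\<lambda>s. \<alpha> s * f x) t = deriv \<alpha> t * f x" for x
      by (rule DERIV_imp_deriv, rule DERIV_cmult_right, rule smooth_deriv(1)[OF a(1)])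
    moreover have "deriv (\<lambda>y. \<alpha> t * f y) x = \<alpha> t * deriv f x" for x
      by (rule DERIV_imp_deriv, rule DERIV_cmult, rule smooth_deriv(1)[OF test_fun_smooth[OF f]])
    ultimately have "(LINT x|\<mu> t. deriv (\<lambda>s. \<alpha> s * f x) t + u t x * deriv (\<lambda>y. \<alpha> t * f y) x)
      = (LINT x|\<mu> t. deriv \<alpha> t * f x + \<alpha> t * (u t x * deriv f x))" by (simp add: mult_ac)
    also have "\<dots> = (LINT x|\<mu> t. deriv \<alpha> t * f x) + (LINT x|\<mu> t. \<alpha> t * (u t x * deriv f x))"
      by (intro Bochner_Integration.integral_add integrable_mult_right F(3)[OF t]
          integrable_bounded[OF t test_fun_measurable[OF f] B0])
    finally show ?thesis by (simp add: flux_def)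
  qed
  have G: "continuous_on {0..T} (\<lambda>t. deriv \<alpha> t * (LINT x|\<mu> t. f x))"
    by (intro continuous_intros test_fun_integral_continuous f smooth_continuous_on smooth_deriv(2) a)
  have mG: "(\<lambda>t. deriv \<alpha> t * (LINT x|\<mu> t. f x)) \<in> borel_measurable (lebesgue_on {0..T})"
    by (rule continuous_lebesgue_on_measurable[OF G])
  have "bounded ((\<lambda>t. deriv \<alpha> t * (LINT x|\<mu> t. f x)) ` {0..T})"
    by (intro compact_imp_bounded compact_continuous_image G) simp
  then obtain C where C: "\<And>t. t \<in> {0..T} \<Longrightarrow> \<bar>deriv \<alpha> t * (LINT x|\<mu> t. f x)\<bar> \<le> C"
    unfolding bounded_iff by force
  have ma: "(\<lambda>t. \<alpha> t * flux f t) \<in> borel_measurable (lebesgue_on {0..T})"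
    by (intro borel_measurable_times F(1) continuous_lebesgue_on_measurable smooth_continuous_on a)
  have ba: "\<bar>\<alpha> t * flux f t\<bar> \<le> A * B" if "t \<in> {0..T}" for t
    using mult_mono[OF A[of t] F(2)[OF that]] A[of t] by (simp add: abs_mult)
  note L1 = lebesgue_on_interval_bounded[OF mG C] and L2 = lebesgue_on_interval_bounded[OF ma ba]
  have "0 = (LINT t|lebesgue_on {0..T}. LINT x|\<mu> t. deriv (\<lambda>s. \<alpha> s * f x) t + u t x * deriv (\<lambda>y. \<alpha> t * f y) x)"
    using ce tensor_test_function[OF a ab f] unfolding continuity_equation_def by fastforce
  also have "\<dots> = (LINT t|lebesgue_on {0..T}. deriv \<alpha> t * (LINT x|\<mu> t. f x) + \<alpha> t * flux f t)"
    by (rule Bochner_Integration.integral_cong) (simp_all add: inner)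
  also have "\<dots> = integral {0..T} (\<lambda>t. deriv \<alpha> t * (LINT x|\<mu> t. f x)) + integral {0..T} (\<lambda>t. \<alpha> t * flux f t)"
    by (simp only: Bochner_Integration.integral_add[OF L1(2) L2(2)] L1(3) L2(3))
  finally show ?thesis by simp
qed

text \<open>The time factor is a smoothed indicator of \<open>{s..t}\<close>: its derivative tends
  to a unit mass at \<open>s\<close> minus one at \<open>t\<close>, while the factor itself tends to
  the indicator under the flux integral.\<close>

lemma weak_form_interior:
  assumes f: "test_fun f" and st: "0 < s" "s < t" "t < T"
  shows "(LINT x|\<mu> t. f x) - (LINT x|\<mu> s. f x) = integral {s..t} (flux f)"
proof -
  obtain P where P: "smooth P" "\<And>x. 0 \<le> deriv P x" "\<And>x. x \<le> -1 \<Longrightarrow> P x = 0" "\<And>x. 1 \<le> x \<Longrightarrow> P x = 1"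
    using smooth_step_exists by auto
  define G where "G \<tau> = (LINT x|\<mu> \<tau>. f x)" for \<tau>
  have G: "continuous_on {0..T} G"
    unfolding G_def by (rule test_fun_integral_continuous[OF f])
  obtain B where B: "\<And>x. \<bar>deriv f x\<bar> \<le> B" using test_fun_bounded[OF test_fun_deriv[OF f]] by blast
  note F = flux_facts[OF f B]
  define \<alpha> where "\<alpha> n \<tau> = P (real (Suc n) * (\<tau> - s)) - P (real (Suc n) * (\<tau> - t))" for n \<tau>
  have K: "((\<lambda>\<tau>. P (real (Suc n) * (\<tau> - r))) has_real_derivative
      real (Suc n) * deriv P (real (Suc n) * (\<tau> - r))) (at \<tau>)" for n \<tau> r
    by (rule DERIV_cong[OF DERIV_chain2[OF smooth_deriv(1)[OF P(1)]]]) (auto intro!: derivative_eq_intros)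
  have d\<alpha>: "deriv (\<alpha> n) \<tau> = real (Suc n) * deriv P (real (Suc n) * (\<tau> - s))
      - real (Suc n) * deriv P (real (Suc n) * (\<tau> - t))" for n \<tau>
    unfolding \<alpha>_def by (rule DERIV_imp_deriv, rule DERIV_diff[OF K K])
  have s\<alpha>: "smooth (\<alpha> n)" for n
  proof -
    have "\<alpha> n = (\<lambda>\<tau>. 1 * P (real (Suc n) * \<tau> + - real (Suc n) * s) + (-1) * P (real (Suc n) * \<tau> + - real (Suc n) * t))"
      by (simp add: \<alpha>_def fun_eq_iff algebra_simps)
    then show ?thesis by (simp only: smooth_affine_comb[OF P(1) P(1)])
  qed
  have supp: "\<alpha> n \<tau> = 0" if "\<tau> \<notin> {s - 1 / real (Suc n)..t + 1 / real (Suc n)}" for n \<tau>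
  proof -
    have "\<tau> < s - 1 / real (Suc n) \<or> \<tau> > t + 1 / real (Suc n)"
      using that by (simp only: atLeastAtMost_iff de_Morgan_conj not_le)
    then consider "\<tau> < s - 1 / real (Suc n)" | "\<tau> > t + 1 / real (Suc n)" by blast
    then show ?thesis
    proof cases
      case 1
      then have "real (Suc n) * (\<tau> - s) \<le> -1" by (simp add: field_simps)
      moreover have "real (Suc n) * (\<tau> - t) \<le> real (Suc n) * (\<tau> - s)"
        using st by (intro mult_left_mono) auto
      ultimately show ?thesis unfolding \<alpha>_def by (metis P(3) order_trans diff_self)
    next
      case 2
      then have "1 \<le> real (Suc n) * (\<tau> - t)" by (simp add: field_simps)
      moreover have "real (Suc n) * (\<tau> - t) \<le> real (Suc n) * (\<tau> - s)"
        using st by (intro mult_left_mono) auto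
      ultimately show ?thesis unfolding \<alpha>_def by (metis P(4) order_trans diff_self)
    qed
  qed
  have Pmono: "P x \<le> P y" if "x \<le> y" for x y
    using DERIV_nonneg_imp_nondecreasing[OF that] smooth_deriv(1)[OF P(1)] P(2) by blast
  have P01: "0 \<le> P x \<and> P x \<le> 1" for x
    using Pmono[of "min x (-1)" x] Pmono[of x "max x 1"] P(3)[of "min x (-1)"] P(4)[of "max x 1"] by auto
  have \<alpha>1: "\<bar>\<alpha> n \<tau>\<bar> \<le> 1" for n \<tau>
    using P01[of "real (Suc n) * (\<tau> - s)"] P01[of "real (Suc n) * (\<tau> - t)"] unfolding \<alpha>_def by (simp add: abs_le_iff)
  \<comment> \<open>The pointwise limit of the steepened steps. The value \<open>P 0\<close> is
    attained only at the two times \<open>s\<close> and \<open>t\<close>, a negligible set removed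
    by \<open>integral_spike\<close>.\<close>
  define PL where "PL z = (if z < 0 then 0 else if z > 0 then 1 else P 0)" for z :: real
  have PL: "(\<lambda>n. P (real (Suc n) * z)) \<longlonglongrightarrow> PL z" for z
  proof (cases z "0 :: real" rule: linorder_cases)
    case less
    obtain n0 where n0: "1 / real (Suc n0) < - z" by (rule nat_approx_posE[of "- z"]) (use less in simp)
    have "P (real (Suc n) * z) = 0" if "n \<ge> n0" for n
    proof (rule P(3))
      have "1 / real (Suc n) \<le> 1 / real (Suc n0)" using that by (intro divide_left_mono) auto
      then have "1 / real (Suc n) < - z" using n0 by linarith
      then show "real (Suc n) * z \<le> -1" by (simp add: field_simps)
    qed
    then have "\<forall>\<^sub>F n in sequentially. P (real (Suc n) * z) = PL z"
      using less by (auto simp: PL_def eventually_sequentially)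
    then show ?thesis by (rule tendsto_eventually)
  next
    case greater
    obtain n0 where n0: "1 / real (Suc n0) < z" by (rule nat_approx_posE[OF greater])
    have "P (real (Suc n) * z) = 1" if "n \<ge> n0" for n
    proof (rule P(4))
      have "1 / real (Suc n) \<le> 1 / real (Suc n0)" using that by (intro divide_left_mono) auto
      then have "1 / real (Suc n) < z" using n0 by linarith
      then show "1 \<le> real (Suc n) * z" by (simp add: field_simps)
    qed
    then have "\<forall>\<^sub>F n in sequentially. P (real (Suc n) * z) = PL z"
      using greater by (auto simp: PL_def eventually_sequentially)
    then show ?thesis by (rule tendsto_eventually)
  qed (simp add: PL_def)
  have lim1: "(\<lambda>n. integral {0..T} (\<lambda>\<tau>. deriv (\<alpha> n) \<tau> * G \<tau>)) \<longlonglongrightarrow> G s - G t"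
  proof -
    have i: "(\<lambda>\<tau>. real (Suc n) * deriv P (real (Suc n) * (\<tau> - r)) * G \<tau>) integrable_on {0..T}" for n r
    proof -
      have "continuous_on {0..T} (\<lambda>\<tau>. real (Suc n) * deriv P (real (Suc n) * \<tau> + - real (Suc n) * r))"
        by (rule smooth_continuous_on[OF smooth_scale[OF smooth_affine[OF smooth_deriv(2)[OF P(1)]]]])
      then have "continuous_on {0..T} (\<lambda>\<tau>. real (Suc n) * deriv P (real (Suc n) * (\<tau> - r)))"
        by (simp add: algebra_simps)
      then show ?thesis by (rule integrable_continuous_real[OF continuous_on_mult[OF _ G]])
    qed
    have "integral {0..T} (\<lambda>\<tau>. deriv (\<alpha> n) \<tau> * G \<tau>) =
        integral {0..T} (\<lambda>\<tau>. real (Suc n) * deriv P (real (Suc n) * (\<tau> - s)) * G \<tau>) -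
        integral {0..T} (\<lambda>\<tau>. real (Suc n) * deriv P (real (Suc n) * (\<tau> - t)) * G \<tau>)" for n
      by (subst integral_diff[OF i i, symmetric]) (simp only: d\<alpha> left_diff_distrib)
    then show ?thesis
      using tendsto_diff[OF mollified_evaluation[OF P G, of s] mollified_evaluation[OF P G, of t]] st by simp
  qed
  have lim2: "(\<lambda>n. integral {0..T} (\<lambda>\<tau>. \<alpha> n \<tau> * flux f \<tau>)) \<longlonglongrightarrow> integral {s..t} (flux f)"
  proof -
    have "(\<lambda>n. integral {0..T} (\<lambda>\<tau>. \<alpha> n \<tau> * flux f \<tau>)) \<longlonglongrightarrow>
        integral {0..T} (\<lambda>\<tau>. (PL (\<tau> - s) - PL (\<tau> - t)) * flux f \<tau>)"
    proof (rule dominated_convergence(2)[where h = "\<lambda>_. B"])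
      show "(\<lambda>\<tau>. \<alpha> n \<tau> * flux f \<tau>) integrable_on {0..T}" for n
      proof (rule lebesgue_on_interval_bounded(1))
        show "(\<lambda>\<tau>. \<alpha> n \<tau> * flux f \<tau>) \<in> borel_measurable (lebesgue_on {0..T})"
          by (intro borel_measurable_times F(1) continuous_lebesgue_on_measurable smooth_continuous_on s\<alpha>)
        show "\<bar>\<alpha> n \<tau> * flux f \<tau>\<bar> \<le> B" if "\<tau> \<in> {0..T}" for \<tau>
          using mult_mono[OF \<alpha>1[of n \<tau>] F(2)[OF that]] by (simp add: abs_mult)
      qed
      show "norm (\<alpha> n \<tau> * flux f \<tau>) \<le> B" if "\<tau> \<in> {0..T}" for n \<tau>
        using mult_mono[OF \<alpha>1[of n \<tau>] F(2)[OF that]] by (simp add: abs_mult)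
      show "(\<lambda>n. \<alpha> n \<tau> * flux f \<tau>) \<longlonglongrightarrow> (PL (\<tau> - s) - PL (\<tau> - t)) * flux f \<tau>" for \<tau>
        unfolding \<alpha>_def by (intro tendsto_mult_right tendsto_diff PL)
      show "(\<lambda>_. B) integrable_on {0..T}" by (rule integrable_const_ivl)
    qed
    also have "integral {0..T} (\<lambda>\<tau>. (PL (\<tau> - s) - PL (\<tau> - t)) * flux f \<tau>)
        = integral {0..T} (\<lambda>\<tau>. if \<tau> \<in> {s..t} then flux f \<tau> else 0)"
      by (rule integral_spike[of "{s, t}"]) (use st in \<open>auto simp: PL_def\<close>)
    also have "\<dots> = integral {s..t} (flux f)"
      using st by (subst integral_restrict_Int) (simp add: Int_absorb1 min_def max_def)
    finally show ?thesis .
  qed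
  obtain n0 where n0: "1 / real (Suc n0) < min s (T - t)"
    by (rule nat_approx_posE[of "min s (T - t)"]) (use st in simp)
  have "integral {0..T} (\<lambda>\<tau>. deriv (\<alpha> n) \<tau> * G \<tau>) + integral {0..T} (\<lambda>\<tau>. \<alpha> n \<tau> * flux f \<tau>) = 0" if "n \<ge> n0" for n
  proof -
    have "1 / real (Suc n) \<le> 1 / real (Suc n0)" using that by (intro divide_left_mono) auto
    then have "0 < s - 1 / real (Suc n)" "t + 1 / real (Suc n) < T" using n0 by auto
    from weak_form_tensor[OF f s\<alpha> supp this] show ?thesis by (simp add: G_def)
  qed
  then have "(\<lambda>n. integral {0..T} (\<lambda>\<tau>. deriv (\<alpha> n) \<tau> * G \<tau>) + integral {0..T} (\<lambda>\<tau>. \<alpha> n \<tau> * flux f \<tau>)) \<longlonglongrightarrow> 0"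
    by (intro tendsto_eventually) (auto simp: eventually_sequentially)
  from LIMSEQ_unique[OF this tendsto_add[OF lim1 lim2]] show ?thesis by (simp add: G_def)
qed

text \<open>Admissible test functions vanish near times 0 and \<open>T\<close>, so the end points
  are reached only through weak continuity. This is how the initial measure enters the
  argument.\<close>

lemma weak_form:
  assumes f: "test_fun f" and st: "0 \<le> s" "s \<le> t" "t \<le> T"
  shows "(LINT x|\<mu> t. f x) - (LINT x|\<mu> s. f x) = integral {s..t} (flux f)"
proof -
  define E where "E \<tau> = (LINT x|\<mu> \<tau>. f x) - integral {0..\<tau>} (flux f)" for \<tau>
  have split: "integral {0..a} (flux f) + integral {a..b} (flux f) = integral {0..b} (flux f)"
    if "0 \<le> a" "a \<le> b" "b \<le> T" for a b
    using that by (intro Henstock_Kurzweil_Integration.integral_combine flux_integrable_on f) auto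
  have E: "E a = E b" if "0 < a" "a < b" "b < T" for a b
    using weak_form_interior[OF f that] split[of a b] that by (simp add: E_def)
  have c: "continuous_on (closure {0<..<T}) E"
    unfolding E_def closure_greaterThanLessThan[OF T]
    by (intro continuous_on_diff test_fun_integral_continuous[OF f] indefinite_integral_continuous_1
        flux_integrable_on[OF f]) simp_all
  have const: "E a = E (T / 2)" if "a \<in> {0<..<T}" for a
  proof (cases a "T / 2" rule: linorder_cases)
    case less with that T show ?thesis by (intro E) simp_all
  next
    case greater with that T show ?thesis by (intro E[symmetric]) simp_all
  qed (simp only:)
  have "E a = E (T / 2)" if "a \<in> {0..T}" for a
    by (rule continuous_constant_on_closure[OF c const]) (use that T in auto)
  from this[of s] this[of t] split[OF st] st show ?thesis by (simp add: E_def)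
qed

end

subsection \<open>Mass to the right of a characteristic\<close>

lemma integral_abs_le:
  fixes f :: "real \<Rightarrow> real"
  assumes "f integrable_on {s..t}" "s \<le> t" "\<And>x. x \<in> {s..t} \<Longrightarrow> \<bar>f x\<bar> \<le> B"
  shows "\<bar>integral {s..t} f\<bar> \<le> B * (t - s)"
proof -
  have "norm (integral {s..t} f) \<le> integral {s..t} (\<lambda>_. B)"
    by (rule integral_norm_bound_integral) (use assms in auto)
  then show ?thesis using assms(2) by (simp add: mult.commute)
qed

text \<open>Splitting \<open>{0..t}\<close> into \<open>Suc m\<close> equal steps adds up the linear
  parts to \<open>K * t\<close>, while the quadratic parts sum to
  \<open>C * t\<^sup>2 / Suc m\<close> and disappear. It stands in for differentiating
  \<open>g\<close>, which is not assumed differentiable.\<close>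

lemma lipschitz_if_quadratic_error:
  fixes g :: "real \<Rightarrow> real"
  assumes "\<And>s t. 0 \<le> s \<Longrightarrow> s \<le> t \<Longrightarrow> t \<le> T \<Longrightarrow> \<bar>g t - g s\<bar> \<le> K * (t - s) + C * (t - s)\<^sup>2"
    and t: "0 \<le> t" "t \<le> T"
  shows "\<bar>g t - g 0\<bar> \<le> K * t"
proof -
  have "\<bar>g t - g 0\<bar> \<le> K * t + (C * t\<^sup>2) * (1 / real (Suc m))" for m
  proof -
    define N where "N = real (Suc m)"
    have N: "N > 0" by (simp add: N_def)
    have "\<bar>g (real k * (t / N)) - g 0\<bar> \<le> real k * (K * (t / N) + C * (t / N)\<^sup>2)" if "k \<le> Suc m" for k
      using that
    proof (induction k)
      case (Suc k)
      have "real (Suc k) * (t / N) \<le> N * (t / N)"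
        using Suc.prems t N by (intro mult_right_mono) (auto simp: N_def)
      then have le: "real (Suc k) * (t / N) \<le> T" using N t by simp
      have diff: "real (Suc k) * (t / N) - real k * (t / N) = t / N"
        by (simp add: algebra_simps)
      have "real k * (t / N) \<le> real (Suc k) * (t / N)" "0 \<le> real k * (t / N)"
        using t N by (intro mult_right_mono mult_nonneg_nonneg; simp)+
      then have "\<bar>g (real (Suc k) * (t / N)) - g (real k * (t / N))\<bar> \<le> K * (t / N) + C * (t / N)\<^sup>2"
        using assms(1)[of "real k * (t / N)" "real (Suc k) * (t / N)"] le unfolding diff by blast
      moreover have "\<bar>g (real k * (t / N)) - g 0\<bar> \<le> real k * (K * (t / N) + C * (t / N)\<^sup>2)"
        using Suc by simp
      moreover have "real (Suc k) * (K * (t / N) + C * (t / N)\<^sup>2)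
          = real k * (K * (t / N) + C * (t / N)\<^sup>2) + (K * (t / N) + C * (t / N)\<^sup>2)"
        by (simp only: of_nat_Suc distrib_right mult_1_left add.commute)
      ultimately show ?case by linarith
    qed simp
    from this[of "Suc m"] have "\<bar>g (N * (t / N)) - g 0\<bar> \<le> N * (K * (t / N) + C * (t / N)\<^sup>2)"
      by (simp only: N_def)
    moreover have "N * (K * (t / N) + C * (t / N)\<^sup>2) = K * t + C * t\<^sup>2 * (1 / N)"
      using N by (simp add: field_simps power2_eq_square)
    ultimately show ?thesis using N by (simp add: N_def)
  qed
  moreover have "(\<lambda>m. K * t + (C * t\<^sup>2) * (1 / real (Suc m))) \<longlonglongrightarrow> K * t + (C * t\<^sup>2) * 0"
    by (intro tendsto_intros LIMSEQ_Suc lim_1_over_n)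
  ultimately show ?thesis
    by (intro LIMSEQ_le_const[of _ "K * t"]) auto
qed

text \<open>The mean value bound for \<open>h x - x * deriv h p\<close> on the segment, whose
  derivative is at most \<open>B * \<bar>p - q\<bar>\<close> there.\<close>

lemma smooth_taylor:
  assumes h: "smooth h" and B: "\<And>x. \<bar>deriv (deriv h) x\<bar> \<le> B"
  shows "\<bar>h p - h q - (p - q) * deriv h p\<bar> \<le> B * (p - q)\<^sup>2"
proof -
  have "norm ((h p - p * deriv h p) - (h q - q * deriv h p)) \<le> (B * \<bar>p - q\<bar>) * norm (p - q)"
  proof (rule field_differentiable_bound[of "closed_segment p q" _ "\<lambda>x. deriv h x - deriv h p"])
    show "((\<lambda>x. h x - x * deriv h p) has_field_derivative deriv h x - deriv h p) (at x within closed_segment p q)" for x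
      by (rule has_field_derivative_at_within, rule DERIV_cong[OF DERIV_diff[OF smooth_deriv(1)[OF h]
            DERIV_cmult_right[OF DERIV_ident]]]) simp
    show "norm (deriv h x - deriv h p) \<le> B * \<bar>p - q\<bar>" if "x \<in> closed_segment p q" for x
    proof -
      have "\<bar>deriv h x - deriv h p\<bar> \<le> B * \<bar>x - p\<bar>" by (rule test_fun_lipschitz[OF smooth_deriv(2)[OF h] B])
      also have "\<dots> \<le> B * \<bar>p - q\<bar>"
        using B[of 0] segment_bound1[OF that] by (intro mult_left_mono) (auto simp: abs_minus_commute)
      finally show ?thesis by simp
    qed
  qed auto
  then show ?thesis by (simp add: power2_eq_square algebra_simps)
qed

context velocity begin

text \<open>The equation is taken in integral form because a velocity that is only measurable in
  time does not give a derivative at every time.\<close>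

definition characteristic :: "real \<Rightarrow> (real \<Rightarrow> real) \<Rightarrow> bool" where
  "characteristic a y \<longleftrightarrow> continuous_on {0..T} y \<and>
     (\<forall>t\<in>{0..T}. y t = a + integral {0..t} (\<lambda>s. u s (y s)))"

lemma velocity_along_measurable:
  assumes "continuous_on {0..T} y"
  shows "(\<lambda>s. u s (y s)) \<in> borel_measurable (lebesgue_on {0..T})"
proof -
  have "y \<in> borel_measurable (lebesgue_on {0..T})" by (rule continuous_lebesgue_on_measurable[OF assms])
  then have "(\<lambda>s. (s, y s)) \<in> lebesgue_on {0..T} \<rightarrow>\<^sub>M lebesgue_on {0..T} \<Otimes>\<^sub>M borel" by measurable
  from measurable_compose[OF this joint_measurable] show ?thesis by simp
qed

lemma velocity_along_integrable:
  assumes "continuous_on {0..T} y" "0 \<le> s" "t \<le> T"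
  shows "(\<lambda>s. u s (y s)) integrable_on {s..t}"
proof -
  have "(\<lambda>s. u s (y s)) integrable_on {0..T}"
    by (rule lebesgue_on_interval_bounded(1)[OF velocity_along_measurable[OF assms(1)], of 1]) (rule bound)
  then show ?thesis by (rule integrable_on_subinterval) (use assms in auto)
qed

lemma characteristic_diff:
  assumes y: "characteristic a y" and st: "0 \<le> s" "s \<le> t" "t \<le> T"
  shows "y t - y s = integral {s..t} (\<lambda>r. u r (y r))" "\<bar>y t - y s\<bar> \<le> t - s"
proof -
  have c: "continuous_on {0..T} y" using y by (simp add: characteristic_def)
  have "integral {0..s} (\<lambda>r. u r (y r)) + integral {s..t} (\<lambda>r. u r (y r)) = integral {0..t} (\<lambda>r. u r (y r))"
    using st by (intro Henstock_Kurzweil_Integration.integral_combine velocity_along_integrable c) auto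
  moreover have "y s = a + integral {0..s} (\<lambda>r. u r (y r))" "y t = a + integral {0..t} (\<lambda>r. u r (y r))"
    using y st by (auto simp: characteristic_def)
  ultimately show 1: "y t - y s = integral {s..t} (\<lambda>r. u r (y r))" by linarith
  have "\<bar>integral {s..t} (\<lambda>r. u r (y r))\<bar> \<le> 1 * (t - s)"
    using st by (intro integral_abs_le velocity_along_integrable c bound) auto
  then show "\<bar>y t - y s\<bar> \<le> t - s" by (simp add: 1)
qed

end

context cont_eq begin

text \<open>Formally the derivative of the integral of \<open>h (x - y t)\<close> is the integral of
  \<open>(u t x - u t (y t)) * h' (x - y t)\<close>, bounded by \<open>L * K\<close>. This is the
  finite-increment version; all errors from freezing the centre, the velocity or the measure are of
  second order in \<open>t - s\<close>.\<close>

lemma along_characteristic_increment: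
  assumes y: "characteristic a y" and h: "test_fun h"
    and K: "\<And>z. \<bar>z * deriv h z\<bar> \<le> K"
    and B: "\<And>z. \<bar>deriv h z\<bar> \<le> B" and B2: "\<And>z. \<bar>deriv (deriv h) z\<bar> \<le> B2"
    and st: "0 \<le> s" "s \<le> t" "t \<le> T"
  shows "\<bar>(LINT x|\<mu> t. h (x - y t)) - (LINT x|\<mu> s. h (x - y s))\<bar>
    \<le> (L * K) * (t - s) + (2 * B2 + L * B) * (t - s)\<^sup>2"
proof -
  have c: "continuous_on {0..T} y" using y by (simp add: characteristic_def)
  have sT: "s \<in> {0..T}" and tT: "t \<in> {0..T}" using st by auto
  \<comment> \<open>The centre is frozen at its final position. The increment then splits into a
    shift of the centre at time \<open>s\<close> (\<open>space\<close>) and an evolution with a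
    fixed test function (\<open>time\<close>), and their terms \<open>(z - y s) * I s\<close>
    cancel.\<close>
  define z where "z = y t"
  define \<beta> where "\<beta> = (\<lambda>x. h (x - z))"
  have \<beta>: "test_fun \<beta>" unfolding \<beta>_def by (rule test_fun_translate[OF h])
  have d\<beta>: "deriv \<beta> x = deriv h (x - z)" for x
    unfolding \<beta>_def by (rule deriv_translate[OF test_fun_smooth[OF h]])
  have h': "test_fun (\<lambda>x. deriv h (x - z))" by (rule test_fun_translate[OF test_fun_deriv[OF h]])
  have dh': "deriv (\<lambda>x. deriv h (x - z)) x = deriv (deriv h) (x - z)" for x
    by (rule deriv_translate[OF test_fun_smooth[OF test_fun_deriv[OF h]]])
  define I where "I r = (LINT x|\<mu> r. deriv h (x - z))" for r
  have B2nn: "0 \<le> B2" using B2[of 0] by simp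
  have int_h': "integrable (\<mu> r) (\<lambda>x. deriv h (x - z))" if "r \<in> {0..T}" for r
    by (rule integrable_bounded[OF that test_fun_measurable[OF h'] B])
  have IB: "\<bar>I r\<bar> \<le> B" if "r \<in> {0..T}" for r
    unfolding I_def by (rule integral_bounded[OF that test_fun_measurable[OF h'] B])
  have flux_B: "\<bar>flux (\<lambda>x. deriv h (x - z)) r\<bar> \<le> B2" if "r \<in> {0..T}" for r
    by (rule flux_facts(2)[OF h' _ that]) (simp add: dh' B2)
  have I_lip: "\<bar>I r - I s\<bar> \<le> B2 * (r - s)" if "s \<le> r" "r \<le> T" for r
    unfolding I_def weak_form[OF h' st(1) that]
    using st that by (intro integral_abs_le flux_integrable_on h' flux_B) auto
  obtain B0 where B0: "\<And>x. \<bar>h x\<bar> \<le> B0" using test_fun_bounded[OF h] by blast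
  have int_h: "integrable (\<mu> s) (\<lambda>x. h (x - w))" for w
    by (rule integrable_bounded[OF sT test_fun_measurable[OF test_fun_translate[OF h]] B0])
  have space: "\<bar>(LINT x|\<mu> s. h (x - z)) - (LINT x|\<mu> s. h (x - y s)) + (z - y s) * I s\<bar> \<le> B2 * (t - s)\<^sup>2"
  proof -
    have "(LINT x|\<mu> s. h (x - z)) - (LINT x|\<mu> s. h (x - y s)) + (z - y s) * I s
        = (LINT x|\<mu> s. h (x - z) - h (x - y s) + (z - y s) * deriv h (x - z))"
      unfolding I_def using int_h int_h'[OF sT] by simp
    also have "\<bar>\<dots>\<bar> \<le> B2 * (t - s)\<^sup>2"
    proof (rule integral_bounded[OF sT])
      show "(\<lambda>x. h (x - z) - h (x - y s) + (z - y s) * deriv h (x - z)) \<in> borel_measurable borel"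
        using test_fun_measurable[OF test_fun_translate[OF h]] test_fun_measurable[OF h'] by simp
      fix x
      have "\<bar>h (x - z) - h (x - y s) - ((x - z) - (x - y s)) * deriv h (x - z)\<bar> \<le> B2 * ((x - z) - (x - y s))\<^sup>2"
        by (rule smooth_taylor[OF test_fun_smooth[OF h] B2])
      also have "((x - z) - (x - y s))\<^sup>2 = \<bar>y t - y s\<bar>\<^sup>2" by (simp add: z_def power2_commute)
      also have "B2 * \<dots> \<le> B2 * (t - s)\<^sup>2"
        using characteristic_diff(2)[OF y st] B2nn by (intro mult_left_mono power_mono) auto
      also have "h (x - z) - h (x - y s) - ((x - z) - (x - y s)) * deriv h (x - z)
          = h (x - z) - h (x - y s) + (z - y s) * deriv h (x - z)" by (simp add: algebra_simps)
      finally show "\<bar>h (x - z) - h (x - y s) + (z - y s) * deriv h (x - z)\<bar> \<le> B2 * (t - s)\<^sup>2" .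
    qed
    finally show ?thesis .
  qed
  have i1: "flux \<beta> integrable_on {s..t}" by (rule flux_integrable_on[OF \<beta> st(1,3)])
  have i2: "(\<lambda>r. u r (y r) * I s) integrable_on {s..t}"
    by (rule integrable_on_mult_left[OF velocity_along_integrable[OF c st(1,3)]])
  have "(z - y s) * I s = integral {s..t} (\<lambda>r. u r (y r) * I s)"
    unfolding z_def characteristic_diff(1)[OF y st] by simp
  then have time: "((LINT x|\<mu> t. h (x - z)) - (LINT x|\<mu> s. h (x - z))) - (z - y s) * I s
      = integral {s..t} (\<lambda>r. flux \<beta> r - u r (y r) * I s)"
    using weak_form[OF \<beta> st] integral_diff[OF i1 i2] by (simp add: \<beta>_def)
  have pt: "\<bar>flux \<beta> r - u r (y r) * I s\<bar> \<le> L * K + (B2 + L * B) * (t - s)" if r: "r \<in> {s..t}" for r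
  proof -
    have rT: "r \<in> {0..T}" using r st by auto
    have "flux \<beta> r - u r z * I r = (LINT x|\<mu> r. u r x * deriv h (x - z) - u r z * deriv h (x - z))"
      using flux_facts(3)[OF \<beta> _ rT, of B] B int_h'[OF rT]
      by (simp add: flux_def I_def d\<beta>)
    also have "\<bar>\<dots>\<bar> \<le> L * K"
    proof (rule integral_bounded[OF rT])
      show "(\<lambda>x. u r x * deriv h (x - z) - u r z * deriv h (x - z)) \<in> borel_measurable borel"
        using borel_measurable_space[OF rT] test_fun_measurable[OF h'] by simp
      fix x
      have "\<bar>u r x * deriv h (x - z) - u r z * deriv h (x - z)\<bar> = \<bar>u r x - u r z\<bar> * \<bar>deriv h (x - z)\<bar>"
        by (simp add: abs_mult[symmetric] left_diff_distrib)
      also have "\<dots> \<le> (L * \<bar>x - z\<bar>) * \<bar>deriv h (x - z)\<bar>"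
        by (intro mult_right_mono lip[OF rT]) simp
      also have "\<dots> = L * \<bar>(x - z) * deriv h (x - z)\<bar>" by (simp add: abs_mult)
      also have "\<dots> \<le> L * K" by (intro mult_left_mono K L)
      finally show "\<bar>u r x * deriv h (x - z) - u r z * deriv h (x - z)\<bar> \<le> L * K" .
    qed
    finally have 1: "\<bar>flux \<beta> r - u r z * I r\<bar> \<le> L * K" .
    have 2: "\<bar>u r z * (I r - I s)\<bar> \<le> B2 * (t - s)"
    proof -
      have "\<bar>u r z * (I r - I s)\<bar> \<le> 1 * (B2 * (r - s))"
        unfolding abs_mult using bound[OF rT] I_lip[of r] r st by (intro mult_mono) auto
      also have "\<dots> \<le> B2 * (t - s)" using r B2nn by (simp add: mult_left_mono)
      finally show ?thesis .
    qed
    have 3: "\<bar>(u r z - u r (y r)) * I s\<bar> \<le> L * B * (t - s)"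
    proof -
      have "\<bar>u r z - u r (y r)\<bar> \<le> L * \<bar>z - y r\<bar>" by (rule lip[OF rT])
      also have "\<dots> \<le> L * (t - s)"
        using characteristic_diff(2)[OF y, of r t] r st L unfolding z_def by (intro mult_left_mono) auto
      finally have "\<bar>(u r z - u r (y r)) * I s\<bar> \<le> (L * (t - s)) * B"
        unfolding abs_mult using IB[OF sT] L st by (intro mult_mono) auto
      then show ?thesis by (simp add: mult_ac)
    qed
    \<comment> \<open>The first bracket is the commutator, bounded by \<open>L * K\<close>. The
      other two, from replacing \<open>I r\<close> by \<open>I s\<close> and \<open>z\<close> by
      \<open>y r\<close>, are of order \<open>t - s\<close>.\<close>
    have "flux \<beta> r - u r (y r) * I s = (flux \<beta> r - u r z * I r) + u r z * (I r - I s) + (u r z - u r (y r)) * I s"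
      by (simp add: algebra_simps)
    with 1 2 3 show ?thesis unfolding distrib_right by linarith
  qed
  have "\<bar>integral {s..t} (\<lambda>r. flux \<beta> r - u r (y r) * I s)\<bar> \<le> (L * K + (B2 + L * B) * (t - s)) * (t - s)"
    by (rule integral_abs_le[OF integrable_diff[OF i1 i2] st(2) pt])
  with space time have "\<bar>(LINT x|\<mu> t. h (x - z)) - (LINT x|\<mu> s. h (x - y s))\<bar>
      \<le> (L * K + (B2 + L * B) * (t - s)) * (t - s) + B2 * (t - s)\<^sup>2" by linarith
  also have "\<dots> = (L * K) * (t - s) + (2 * B2 + L * B) * (t - s)\<^sup>2"
    by (simp add: algebra_simps power2_eq_square)
  finally show ?thesis by (simp add: z_def)
qed

text \<open>The order of limits matters. For a fixed cutoff the bounds \<open>B\<close> and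
  \<open>B2\<close>, which may grow with \<open>n\<close>, enter only the quadratic error and vanish
  by subdivision; afterwards the remaining bound \<open>L * C * t / Suc n\<close> tends to
  0.\<close>

lemma half_line_mass_constant:
  assumes y: "characteristic a y" and t: "t \<in> {0..T}"
  shows "measure (\<mu> t) {y t<..} = measure mu_init {a<..}"
proof -
  obtain h C where h: "\<And>n. test_fun (h n)" "\<And>n z. \<bar>z * deriv (h n) z\<bar> \<le> C / real (Suc n)"
    "\<And>n z. \<bar>h n z\<bar> \<le> 1" "\<And>z. (\<lambda>n. h n z) \<longlonglongrightarrow> bump 0 * indicator {0<..} z"
    by (rule cutoff_sequence, rule that)
  have T0: "0 \<in> {0..T}" using T by simp
  have \<mu>0: "\<mu> 0 = mu_init" using ce by (simp add: continuity_equation_def)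
  have y0: "y 0 = a" using y T by (simp add: characteristic_def)
  have "\<bar>(LINT x|\<mu> t. h n (x - y t)) - (LINT x|\<mu> 0. h n (x - y 0))\<bar> \<le> L * (C / real (Suc n)) * t" for n
  proof -
    obtain B where B: "\<And>x. \<bar>deriv (h n) x\<bar> \<le> B"
      by (rule test_fun_bounded[OF test_fun_deriv[OF h(1)[of n]]], rule that)
    obtain B2 where B2: "\<And>x. \<bar>deriv (deriv (h n)) x\<bar> \<le> B2"
      by (rule test_fun_bounded[OF test_fun_deriv[OF test_fun_deriv[OF h(1)[of n]]]], rule that)
    define g where "g r = (LINT x|\<mu> r. h n (x - y r))" for r
    have "\<bar>g q - g p\<bar> \<le> L * (C / real (Suc n)) * (q - p) + (2 * B2 + L * B) * (q - p)\<^sup>2"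
      if "0 \<le> p" "p \<le> q" "q \<le> T" for p q
      unfolding g_def by (rule along_characteristic_increment[OF y h(1) h(2) B B2 that])
    then have "\<bar>g t - g 0\<bar> \<le> L * (C / real (Suc n)) * t"
      by (rule lipschitz_if_quadratic_error) (use t in auto)
    then show ?thesis by (simp only: g_def)
  qed
  then have "norm ((LINT x|\<mu> t. h n (x - y t)) - (LINT x|\<mu> 0. h n (x - y 0))) \<le> L * (C / real (Suc n)) * t" for n
    by (simp only: real_norm_def)
  moreover have "(\<lambda>n. L * (C / real (Suc n)) * t) \<longlonglongrightarrow> 0"
    using tendsto_mult_left[OF LIMSEQ_Suc[OF lim_1_over_n], of "L * C * t"] by (simp add: mult_ac)
  ultimately have "(\<lambda>n. (LINT x|\<mu> t. h n (x - y t)) - (LINT x|\<mu> 0. h n (x - y 0))) \<longlonglongrightarrow> 0"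
    by (rule Lim_null_comparison[OF always_eventually[OF allI]])
  moreover have "(\<lambda>n. (LINT x|\<mu> t. h n (x - y t)) - (LINT x|\<mu> 0. h n (x - y 0)))
      \<longlonglongrightarrow> bump 0 * measure (\<mu> t) {y t<..} - bump 0 * measure (\<mu> 0) {y 0<..}"
    by (rule tendsto_diff[OF half_line_limit[OF t h(1,3,4)] half_line_limit[OF T0 h(1,3,4)]])
  ultimately have "bump 0 * measure (\<mu> t) {y t<..} - bump 0 * measure (\<mu> 0) {y 0<..} = 0"
    by (rule LIMSEQ_unique[rotated])
  then show ?thesis using bump_0_pos by (simp add: \<mu>0 y0)
qed

end

subsection \<open>The flow of a Lipschitz control\<close>

text \<open>With \<open>w\<close> the integral of \<open>\<bar>d\<bar>\<close>, the function
  \<open>exp (- L * (t - a)) * (c + L * w t)\<close> is nonincreasing, because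
  \<open>w' = \<bar>d\<bar>\<close> is at most \<open>c + L * w\<close>.\<close>

lemma gronwall:
  fixes d :: "real \<Rightarrow> real"
  assumes d: "continuous_on {a..b} d" and L: "0 \<le> L" and ab: "a \<le> b"
    and le: "\<And>t. t \<in> {a..b} \<Longrightarrow> \<bar>d t\<bar> \<le> c + L * integral {a..t} (\<lambda>r. \<bar>d r\<bar>)"
  shows "\<bar>d b\<bar> \<le> c * exp (L * (b - a))"
proof -
  define w where "w t = integral {a..t} (\<lambda>r. \<bar>d r\<bar>)" for t
  define \<phi> where "\<phi> t = exp (- (L * (t - a))) * (c + L * w t)" for t
  have dc: "continuous_on {a..b} (\<lambda>r. \<bar>d r\<bar>)" by (intro continuous_intros d)
  have w: "(w has_real_derivative \<bar>d t\<bar>) (at t within {a..b})" if "t \<in> {a..b}" for t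
    unfolding w_def by (rule integral_has_real_derivative[OF dc that])
  have \<phi>: "(\<phi> has_real_derivative exp (- (L * (t - a))) * (L * (\<bar>d t\<bar> - (c + L * w t)))) (at t within {a..b})"
    if "t \<in> {a..b}" for t
    unfolding \<phi>_def by (auto intro!: derivative_eq_intros w[OF that] simp: algebra_simps)
  have "\<phi> b \<le> \<phi> a"
  proof (rule DERIV_nonpos_imp_decreasing_open[OF ab])
    fix t assume t: "a < t" "t < b"
    have "(\<phi> has_real_derivative exp (- (L * (t - a))) * (L * (\<bar>d t\<bar> - (c + L * w t)))) (at t)"
      using \<phi>[of t] t by (simp add: at_within_Icc_at)
    moreover have "exp (- (L * (t - a))) * (L * (\<bar>d t\<bar> - (c + L * w t))) \<le> 0"
      using le[of t] t L by (intro mult_nonneg_nonpos) (auto simp: w_def)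
    ultimately show "\<exists>y. (\<phi> has_real_derivative y) (at t) \<and> y \<le> 0" by blast
  next
    show "continuous_on {a..b} \<phi>"
      by (rule DERIV_continuous_on[OF \<phi>])
  qed
  then have "exp (- (L * (b - a))) * (c + L * w b) \<le> c" by (simp add: \<phi>_def w_def)
  then have "exp (L * (b - a)) * (exp (- (L * (b - a))) * (c + L * w b)) \<le> exp (L * (b - a)) * c"
    by (rule mult_left_mono) simp
  then have "c + L * w b \<le> c * exp (L * (b - a))"
    by (simp only: mult.assoc[symmetric] exp_add[symmetric]) (simp add: mult.commute)
  with le[of b] ab show ?thesis by (simp add: w_def)
qed

text \<open>The fixed point argument runs in the complete space of bounded continuous functions on
  the whole line; clamping the argument extends a function from \<open>{0..T}\<close> into that
  space.\<close>

lemma continuous_clamp_bcontfun: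
  fixes f :: "real \<Rightarrow> real"
  assumes "continuous_on {0..T} f" "0 \<le> T"
  shows "(\<lambda>t. f (max 0 (min T t))) \<in> bcontfun"
unfolding bcontfun_def
proof (intro CollectI conjI)
  have c: "max 0 (min T t) \<in> {0..T}" for t using assms(2) by auto
  show "continuous_on UNIV (\<lambda>t. f (max 0 (min T t)))"
    by (rule continuous_on_compose2[OF assms(1)]) (use c in \<open>auto intro!: continuous_intros\<close>)
  have "bounded (f ` {0..T})" by (intro compact_imp_bounded compact_continuous_image assms) simp
  then show "bounded (range (\<lambda>t. f (max 0 (min T t))))"
    by (rule bounded_subset) (use c in auto)
qed

context velocity begin

lemma characteristic_exists: "\<exists>y. characteristic a y"
proof -
  \<comment> \<open>Picard's map, conjugated with the weight \<open>exp (- K * t)\<close>, is a contraction on all of \<open>{0..T}\<close> at once.\<close>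
  define K where "K = 2 * L + 1"
  have K: "K > 0" using L by (simp add: K_def)
  define cl where "cl t = max 0 (min T t)" for t
  have clI: "cl t \<in> {0..T}" for t using T by (auto simp: cl_def)
  have cl_id: "cl t = t" if "t \<in> {0..T}" for t using that by (auto simp: cl_def)
  define F where "F z t = exp (- (K * t)) * (a + integral {0..t} (\<lambda>s. u s (exp (K * s) * apply_bcontfun z s)))"
    for z :: "real \<Rightarrow>\<^sub>C real" and t
  have yc: "continuous_on {0..T} (\<lambda>s. exp (K * s) * apply_bcontfun z s)" for z :: "real \<Rightarrow>\<^sub>C real"
    by (intro continuous_intros continuous_on_apply_bcontfun)
  have int: "(\<lambda>s. u s (exp (K * s) * apply_bcontfun z s)) integrable_on {0..t}" if "t \<in> {0..T}"
    for z :: "real \<Rightarrow>\<^sub>C real" and t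
    using that by (intro velocity_along_integrable[OF yc]) auto
  have Fc: "continuous_on {0..T} (F z)" for z
    unfolding F_def by (intro continuous_intros indefinite_integral_continuous_1 int) (use T in auto)
  define A where "A z = Bcontfun (\<lambda>t. F z (cl t))" for z
  have A: "apply_bcontfun (A z) t = F z (cl t)" for z t
    unfolding A_def cl_def using Bcontfun_inverse[OF continuous_clamp_bcontfun[OF Fc]] T by simp
  have contr: "dist (A z) (A z') \<le> (1 / 2) * dist z z'" for z z'
  proof (rule dist_bound)
    fix t
    define \<tau> where "\<tau> = cl t"
    have \<tau>: "\<tau> \<in> {0..T}" unfolding \<tau>_def by (rule clI)
    define D where "D = dist z z'"
    have D: "D \<ge> 0" by (simp add: D_def)
    have eint: "((\<lambda>s. exp (K * s)) has_integral (exp (K * \<tau>) / K - exp (K * 0) / K)) {0..\<tau>}"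
    proof (rule fundamental_theorem_of_calculus)
      show "((\<lambda>s. exp (K * s) / K) has_vector_derivative exp (K * s)) (at s within {0..\<tau>})" for s
        unfolding has_real_derivative_iff_has_vector_derivative[symmetric]
        using K by (auto intro!: derivative_eq_intros)
    qed (use \<tau> in simp)
    have Dint: "((\<lambda>s. (L * D) * exp (K * s)) has_integral (L * D) * (exp (K * \<tau>) / K - exp (K * 0) / K)) {0..\<tau>}"
      by (rule has_integral_mult_right[OF eint])
    have "norm (integral {0..\<tau>} (\<lambda>s. u s (exp (K * s) * apply_bcontfun z s) - u s (exp (K * s) * apply_bcontfun z' s)))
        \<le> integral {0..\<tau>} (\<lambda>s. (L * D) * exp (K * s))"
    proof (rule integral_norm_bound_integral[OF integrable_diff[OF int[OF \<tau>] int[OF \<tau>]] has_integral_integrable[OF Dint]])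
      fix s assume "s \<in> {0..\<tau>}"
      then have s: "s \<in> {0..T}" using \<tau> by auto
      have "\<bar>u s (exp (K * s) * apply_bcontfun z s) - u s (exp (K * s) * apply_bcontfun z' s)\<bar>
          \<le> L * \<bar>exp (K * s) * apply_bcontfun z s - exp (K * s) * apply_bcontfun z' s\<bar>" by (rule lip[OF s])
      also have "\<dots> = (L * dist (apply_bcontfun z s) (apply_bcontfun z' s)) * exp (K * s)"
        by (simp add: right_diff_distrib[symmetric] abs_mult dist_real_def)
      also have "\<dots> \<le> (L * D) * exp (K * s)"
        unfolding D_def by (intro mult_right_mono mult_left_mono dist_bounded L) simp
      finally show "norm (u s (exp (K * s) * apply_bcontfun z s) - u s (exp (K * s) * apply_bcontfun z' s))
          \<le> (L * D) * exp (K * s)" by simp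
    qed
    also have "\<dots> = (L * D) * (exp (K * \<tau>) / K - exp (K * 0) / K)" by (rule integral_unique[OF Dint])
    also have "\<dots> \<le> (L * D) * (exp (K * \<tau>) / K)"
      using K L D by (intro mult_left_mono mult_nonneg_nonneg) auto
    finally have le: "\<bar>integral {0..\<tau>} (\<lambda>s. u s (exp (K * s) * apply_bcontfun z s)) -
        integral {0..\<tau>} (\<lambda>s. u s (exp (K * s) * apply_bcontfun z' s))\<bar> \<le> (L * D) * (exp (K * \<tau>) / K)"
      by (simp add: integral_diff[OF int[OF \<tau>] int[OF \<tau>]])
    have "dist (apply_bcontfun (A z) t) (apply_bcontfun (A z') t) = exp (- (K * \<tau>)) *
        \<bar>integral {0..\<tau>} (\<lambda>s. u s (exp (K * s) * apply_bcontfun z s)) -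
        integral {0..\<tau>} (\<lambda>s. u s (exp (K * s) * apply_bcontfun z' s))\<bar>"
      unfolding A \<tau>_def[symmetric] F_def dist_real_def right_diff_distrib[symmetric] abs_mult by simp
    also have "\<dots> \<le> exp (- (K * \<tau>)) * ((L * D) * (exp (K * \<tau>) / K))"
      by (rule mult_left_mono[OF le]) simp
    also have "\<dots> = (L / K) * D" by (simp add: exp_minus)
    \<comment> \<open>The weight \<open>K = 2 * L + 1\<close> was chosen so that
      \<open>L / K\<close> is at most \<open>1 / 2\<close>, independently of
      \<open>T\<close>.\<close>
    also have "\<dots> \<le> (1 / 2) * D"
      using K L D by (intro mult_right_mono) (auto simp: K_def field_simps)
    finally show "dist (apply_bcontfun (A z) t) (apply_bcontfun (A z') t) \<le> (1 / 2) * dist z z'"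
      by (simp add: D_def)
  qed
  have "\<exists>!z. A z = z"
    by (rule banach_fix_type[of "1 / 2" A]) (use contr in auto)
  then obtain z where z: "A z = z" by blast
  define y where "y t = exp (K * t) * apply_bcontfun z t" for t
  have "continuous_on {0..T} y" unfolding y_def by (rule yc)
  moreover have "y t = a + integral {0..t} (\<lambda>s. u s (y s))" if "t \<in> {0..T}" for t
  proof -
    have "apply_bcontfun z t = F z t" using A[of z t] z cl_id[OF that] by simp
    then have "y t = exp (K * t) * F z t" by (simp add: y_def)
    then show ?thesis by (simp add: F_def y_def exp_minus)
  qed
  ultimately show ?thesis unfolding characteristic_def by blast
qed

text \<open>The starting time \<open>s\<close> is left free: \<open>s = 0\<close> gives Lipschitz
  dependence on the initial point, and a meeting time \<open>s\<close> gives uniqueness from there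
  on.\<close>

lemma characteristic_stability:
  assumes y: "characteristic a y" and y': "characteristic a' y'" and st: "0 \<le> s" "s \<le> t" "t \<le> T"
  shows "\<bar>y t - y' t\<bar> \<le> \<bar>y s - y' s\<bar> * exp (L * (t - s))"
proof (rule gronwall[OF _ L st(2)])
  have c: "continuous_on {0..T} y" "continuous_on {0..T} y'" using y y' by (auto simp: characteristic_def)
  show cst: "continuous_on {s..t} (\<lambda>r. y r - y' r)"
    by (rule continuous_on_subset[of "{0..T}"]) (use st c in \<open>auto intro!: continuous_intros\<close>)
  fix r assume r: "r \<in> {s..t}"
  have sr: "s \<le> r" "r \<le> T" using r st by auto
  have ii: "(\<lambda>q. u q (y q) - u q (y' q)) integrable_on {s..r}"
    by (rule integrable_diff[OF velocity_along_integrable[OF c(1) st(1) sr(2)] velocity_along_integrable[OF c(2) st(1) sr(2)]])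
  have cc: "continuous_on {s..r} (\<lambda>q. \<bar>y q - y' q\<bar>)"
    by (intro continuous_on_rabs continuous_on_subset[OF cst]) (use r in auto)
  have "norm (integral {s..r} (\<lambda>q. u q (y q) - u q (y' q))) \<le> integral {s..r} (\<lambda>q. L * \<bar>y q - y' q\<bar>)"
  proof (rule integral_norm_bound_integral[OF ii])
    show "(\<lambda>q. L * \<bar>y q - y' q\<bar>) integrable_on {s..r}"
      by (intro integrable_continuous_real continuous_on_mult_left cc)
    show "norm (u q (y q) - u q (y' q)) \<le> L * \<bar>y q - y' q\<bar>" if "q \<in> {s..r}" for q
      using lip[of q] that st sr by simp
  qed
  also have "\<dots> = L * integral {s..r} (\<lambda>q. \<bar>y q - y' q\<bar>)" by simp
  finally have 1: "\<bar>integral {s..r} (\<lambda>q. u q (y q) - u q (y' q))\<bar> \<le> L * integral {s..r} (\<lambda>q. \<bar>y q - y' q\<bar>)" by simp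
  have "y r - y' r = (y s - y' s) + integral {s..r} (\<lambda>q. u q (y q) - u q (y' q))"
    using characteristic_diff(1)[OF y st(1) sr] characteristic_diff(1)[OF y' st(1) sr]
      integral_diff[OF velocity_along_integrable[OF c(1) st(1) sr(2)] velocity_along_integrable[OF c(2) st(1) sr(2)]]
    by linarith
  with 1 show "\<bar>y r - y' r\<bar> \<le> \<bar>y s - y' s\<bar> + L * integral {s..r} (\<lambda>q. \<bar>y q - y' q\<bar>)" by linarith
qed

lemma characteristic_0: "characteristic a y \<Longrightarrow> y 0 = a"
  using T by (simp add: characteristic_def)

text \<open>By stability any two choices of the characteristic agree on
  \<open>{0..T}\<close>.\<close>

definition flow :: "real \<Rightarrow> real \<Rightarrow> real" where
  "flow t a = (SOME y. characteristic a y) t"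

lemma characteristic_flow: "characteristic a (\<lambda>t. flow t a)"
  unfolding flow_def by (rule someI_ex[OF characteristic_exists])

lemma flow_0 [simp]: "flow 0 a = a"
  by (rule characteristic_0[OF characteristic_flow])

lemma flow_lipschitz:
  assumes "t \<in> {0..T}" shows "\<bar>flow t a - flow t b\<bar> \<le> exp (L * T) * \<bar>a - b\<bar>"
proof -
  have "\<bar>flow t a - flow t b\<bar> \<le> \<bar>a - b\<bar> * exp (L * t)"
    using characteristic_stability[OF characteristic_flow[of a] characteristic_flow[of b], of 0 t] assms by simp
  also have "\<dots> \<le> \<bar>a - b\<bar> * exp (L * T)" using assms L by (intro mult_left_mono) (auto intro: mult_left_mono)
  finally show ?thesis by (simp add: mult.commute)
qed

lemma flow_continuous: "t \<in> {0..T} \<Longrightarrow> continuous_on UNIV (flow t)"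
  by (rule lipschitz_on_continuous_on[of "exp (L * T)"], rule lipschitz_onI)
    (use flow_lipschitz in \<open>auto simp: dist_real_def\<close>)

lemma flow_measurable: "t \<in> {0..T} \<Longrightarrow> flow t \<in> borel_measurable borel"
  by (intro borel_measurable_continuous_onI flow_continuous)

lemma flow_displacement: "t \<in> {0..T} \<Longrightarrow> \<bar>flow t a - a\<bar> \<le> t"
  using characteristic_diff(2)[OF characteristic_flow[of a], of 0 t] by simp

text \<open>Two trajectories that exchange their order must meet at an earlier time, and by
  stability they coincide from then on.\<close>

lemma flow_mono:
  assumes t: "t \<in> {0..T}" and ab: "a \<le> b" shows "flow t a \<le> flow t b"
proof (rule ccontr)
  assume "\<not> flow t a \<le> flow t b"
  then have neg: "flow t b - flow t a < 0" by simp
  have c: "continuous_on {0..T} (\<lambda>t. flow t a)" for a using characteristic_flow by (simp add: characteristic_def)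
  have "\<exists>s. 0 \<le> s \<and> s \<le> t \<and> flow s b - flow s a = 0"
    by (rule IVT2'[of "\<lambda>s. flow s b - flow s a"])
      (use neg ab t in \<open>auto intro!: continuous_intros continuous_on_subset[OF c]\<close>)
  then obtain s where s: "0 \<le> s" "s \<le> t" "flow s b - flow s a = 0" by blast
  have "t \<le> T" using t by simp
  from characteristic_stability[OF characteristic_flow[of b] characteristic_flow[of a] s(1,2) this]
  show False using s(3) neg by simp
qed

lemma flow_joint_measurable:
  "(\<lambda>(t, a). flow t a) \<in> borel_measurable (lebesgue_on {0..T} \<Otimes>\<^sub>M borel)"
proof (rule borel_measurable_lipschitz_pair)
  show "(\<lambda>t. flow t a) \<in> borel_measurable (lebesgue_on {0..T})" for a
    using characteristic_flow by (intro continuous_lebesgue_on_measurable) (simp add: characteristic_def)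
  show "\<bar>flow t a - flow t b\<bar> \<le> exp (L * T) * \<bar>a - b\<bar>" if "t \<in> space (lebesgue_on {0..T})" for t a b
    using that by (intro flow_lipschitz) simp
qed simp

end

subsection \<open>The static problem\<close>

lemma prob_space_mu_init: "prob_space mu_init"
  unfolding mu_init_def by (rule prob_space_uniform_measure) auto

lemma sets_mu_init [simp, measurable_cong]: "sets mu_init = sets borel"
  by (simp add: mu_init_def)

lemma space_mu_init [simp]: "space mu_init = UNIV"
  by (simp add: mu_init_def)

lemma borel_measurable_mu_init: "borel_measurable mu_init = borel_measurable borel"
  by (rule measurable_cong_sets) simp_all

lemma AE_mu_init: "AE x in mu_init. \<bar>x\<bar> \<le> 1"
  unfolding mu_init_def by (rule AE_uniform_measureI) (auto simp: abs_le_iff)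

lemma integrable_mu_init:
  fixes f :: "real \<Rightarrow> real"
  assumes "f \<in> borel_measurable borel" "\<And>x. \<bar>x\<bar> \<le> 1 \<Longrightarrow> \<bar>f x\<bar> \<le> B"
  shows "integrable mu_init f"
proof -
  interpret prob_space mu_init by (rule prob_space_mu_init)
  show ?thesis
  proof (rule integrable_const_bound[of _ B])
    show "AE x in mu_init. norm (f x) \<le> B"
      using AE_mu_init by (rule eventually_mono) (simp add: assms(2))
  qed (use assms borel_measurable_mu_init in auto)
qed

lemma fubini_mu_init:
  fixes f :: "real \<Rightarrow> real \<Rightarrow> real"
  assumes m: "(\<lambda>(t, x). f t x) \<in> borel_measurable (lebesgue_on {0..T} \<Otimes>\<^sub>M borel)"
    and B: "\<And>t x. t \<in> {0..T} \<Longrightarrow> \<bar>f t x\<bar> \<le> B"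
  shows "(LINT t|lebesgue_on {0..T}. LINT x|mu_init. f t x) = (LINT x|mu_init. LINT t|lebesgue_on {0..T}. f t x)"
    and "integrable mu_init (\<lambda>x. LINT t|lebesgue_on {0..T}. f t x)"
proof -
  interpret M1: finite_measure "lebesgue_on {0..T}" by (rule finite_measure_lebesgue_on) simp
  interpret M2: prob_space mu_init by (rule prob_space_mu_init)
  interpret P: pair_sigma_finite "lebesgue_on {0..T}" mu_init ..
  interpret F: finite_measure "lebesgue_on {0..T} \<Otimes>\<^sub>M mu_init"
    by (rule finite_measure_pair_measure) (unfold_locales)
  have "sets (lebesgue_on {0..T} \<Otimes>\<^sub>M mu_init) = sets (lebesgue_on {0..T} \<Otimes>\<^sub>M borel)"
    by (rule sets_pair_measure_cong) simp_all
  then have m': "(\<lambda>(t, x). f t x) \<in> borel_measurable (lebesgue_on {0..T} \<Otimes>\<^sub>M mu_init)"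
    using m by (simp cong: measurable_cong_sets)
  have "integrable (lebesgue_on {0..T} \<Otimes>\<^sub>M mu_init) (case_prod f)"
    by (rule F.integrable_const_bound[OF _ m', of B], rule AE_I2) (auto simp: space_pair_measure B)
  from P.Fubini_integral[OF this] P.integrable_snd[OF this]
  show "(LINT t|lebesgue_on {0..T}. LINT x|mu_init. f t x) = (LINT x|mu_init. LINT t|lebesgue_on {0..T}. f t x)"
    "integrable mu_init (\<lambda>x. LINT t|lebesgue_on {0..T}. f t x)" by simp_all
qed

text \<open>Jensen's inequality for the square, obtained by integrating the tangent inequality
  \<open>2 * w * f t - w\<^sup>2 \<le> (f t)\<^sup>2\<close> at the mean value
  \<open>w\<close>.\<close>

lemma integral_square_ge:
  fixes f :: "real \<Rightarrow> real"
  assumes f: "f \<in> borel_measurable (lebesgue_on {0..T})" "\<And>t. t \<in> {0..T} \<Longrightarrow> \<bar>f t\<bar> \<le> 1" and T: "0 < T"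
  shows "(integral {0..T} f)\<^sup>2 / T \<le> (LINT t|lebesgue_on {0..T}. (f t)\<^sup>2)"
proof -
  define w where "w = integral {0..T} f / T"
  note I = lebesgue_on_interval_bounded[OF f]
  have "\<bar>(f t)\<^sup>2\<bar> \<le> 1" if "t \<in> {0..T}" for t
    using f(2)[OF that] by (simp add: abs_square_le_1)
  note I2 = lebesgue_on_interval_bounded[of "\<lambda>t. (f t)\<^sup>2", OF borel_measurable_power[OF f(1)] this]
  have "integral {0..T} (\<lambda>t. 2 * w * f t - w\<^sup>2) \<le> integral {0..T} (\<lambda>t. (f t)\<^sup>2)"
  proof (rule integral_le)
    show "(\<lambda>t. 2 * w * f t - w\<^sup>2) integrable_on {0..T}"
      by (intro integrable_diff integrable_on_mult_right I(1) integrable_const_ivl)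
    show "2 * w * f t - w\<^sup>2 \<le> (f t)\<^sup>2" if "t \<in> {0..T}" for t
      using zero_le_power2[of "f t - w"] by (simp add: power2_diff mult.commute mult.left_commute)
  qed (rule I2(1))
  moreover have "integral {0..T} (\<lambda>t. 2 * w * f t - w\<^sup>2) = 2 * w * integral {0..T} f - w\<^sup>2 * T"
    using T by (subst integral_diff) (auto intro!: integrable_on_mult_right I(1))
  moreover have "2 * w * integral {0..T} f - w\<^sup>2 * T = (integral {0..T} f)\<^sup>2 / T"
    using T by (simp add: w_def field_simps power2_eq_square)
  moreover have "(LINT t|lebesgue_on {0..T}. (f t)\<^sup>2) = integral {0..T} (\<lambda>t. (f t)\<^sup>2)"
    by (rule I2(3))
  ultimately show ?thesis by linarith
qed

text \<open>The cost of a displacement field \<open>w\<close> that moves the mass at \<open>a\<close> to \<open>a + T * w\<close> at constant speed.\<close>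

definition static_cost :: "real \<Rightarrow> real \<Rightarrow> 'a measure \<Rightarrow> ('a \<Rightarrow> real) \<Rightarrow> ('a \<Rightarrow> real) \<Rightarrow> real" where
  "static_cost T lam M a w = T / 2 * (LINT x|M. (w x)\<^sup>2) -
     1 / (2 * lam) * ((LINT x|M. (a x + T * w x)\<^sup>2) - (LINT x|M. a x + T * w x)\<^sup>2)"

section \<open>Solutions as push-forwards and the lower bound for their cost\<close>

context cont_eq begin

text \<open>A displacement of at most \<open>t\<close> makes the continuous map
  \<open>flow t\<close> surjective. Monotonicity is available in its weak form, so \<open>a\<close>
  is taken as the largest point that is not mapped beyond \<open>z\<close>; everything to its right
  is.\<close>

lemma half_line_preimage:
  assumes t: "t \<in> {0..T}"
  obtains a where "flow t -` {z<..} = {a<..}" "flow t a = z"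
proof -
  have ivt: "\<exists>a\<ge>z - t. a \<le> z + t \<and> flow t a = z"
    by (rule IVT') (use flow_displacement[OF t, of "z - t"] flow_displacement[OF t, of "z + t"] t
        in \<open>auto intro: continuous_on_subset[OF flow_continuous[OF t]] simp: abs_le_iff\<close>)
  then obtain b where b: "flow t b = z" by blast
  define S where "S = {a. flow t a \<le> z}"
  have "closed S"
    unfolding S_def by (intro closed_Collect_le flow_continuous t continuous_on_const)
  have bS: "b \<in> S" by (simp add: S_def b)
  have bdd: "bdd_above S"
  proof (rule bdd_aboveI)
    show "a \<le> z + t" if "a \<in> S" for a using flow_displacement[OF t, of a] that by (auto simp: S_def abs_le_iff)
  qed
  define a where "a = Sup S"
  have "a \<in> S" unfolding a_def using closed_contains_Sup[OF _ bdd \<open>closed S\<close>] bS by blast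
  have ub: "x \<le> a" if "x \<in> S" for x unfolding a_def by (rule cSup_upper[OF that bdd])
  have "flow t a = z"
    using flow_mono[OF t ub[OF bS]] b \<open>a \<in> S\<close> by (simp add: S_def)
  moreover have "flow t -` {z<..} = {a<..}"
  proof (intro set_eqI iffI)
    fix x assume "x \<in> flow t -` {z<..}"
    then have "\<not> x \<le> a" using flow_mono[OF t, of x a] \<open>a \<in> S\<close> by (auto simp: S_def)
    then show "x \<in> {a<..}" by simp
  next
    fix x assume "x \<in> {a<..}"
    then have "x \<notin> S" using ub[of x] by auto
    then show "x \<in> flow t -` {z<..}" by (simp add: S_def)
  qed
  ultimately show ?thesis by (rule that[rotated])
qed

text \<open>Each half line to the right of \<open>z\<close> lies to the right of the characteristic
  through some \<open>a\<close>, and both measures give it the initial mass of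
  \<open>{a<..}\<close>. Equal distribution functions identify the measures.\<close>

lemma solution_eq_pushforward:
  assumes t: "t \<in> {0..T}"
  shows "\<mu> t = distr mu_init borel (flow t)"
proof -
  have fm: "flow t \<in> mu_init \<rightarrow>\<^sub>M borel"
    unfolding borel_measurable_mu_init by (rule flow_measurable[OF t])
  have p: "prob_space (\<mu> t)" "prob_space (distr mu_init borel (flow t))"
    by (rule prob[OF t]) (rule prob_space.prob_space_distr[OF prob_space_mu_init fm])
  have sp: "space (\<mu> t) = UNIV" using sets_eq_imp_space_eq[OF sets[OF t]] by simp
  have half: "measure (\<mu> t) {z<..} = measure (distr mu_init borel (flow t)) {z<..}" for z
  proof -
    obtain a where a: "flow t -` {z<..} = {a<..}" "flow t a = z" by (rule half_line_preimage[OF t])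
    have "measure (distr mu_init borel (flow t)) {z<..} = measure mu_init {a<..}"
      by (subst measure_distr[OF fm]) (auto simp: a)
    moreover have "measure (\<mu> t) {z<..} = measure mu_init {a<..}"
      using half_line_mass_constant[OF characteristic_flow t, of a] by (simp add: a)
    ultimately show ?thesis by simp
  qed
  have compl: "measure M {..z} = 1 - measure M {z<..}" if "prob_space M" "sets M = sets borel" "space M = UNIV"
    for M and z :: real
  proof -
    have "{..z} = space M - {z<..}" by (auto simp: that)
    then show ?thesis using prob_space.prob_compl[OF that(1), of "{z<..}"] that by simp
  qed
  show ?thesis
  proof (rule cdf_unique)
    show "real_distribution (\<mu> t)" "real_distribution (distr mu_init borel (flow t))"
      using p sets[OF t] sp by (auto simp: real_distribution_def real_distribution_axioms_def)
    show "cdf (\<mu> t) = cdf (distr mu_init borel (flow t))"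
    proof
      fix z
      show "cdf (\<mu> t) z = cdf (distr mu_init borel (flow t)) z"
        unfolding cdf_def compl[OF p(1) sets[OF t] sp] half by (rule compl[symmetric, OF p(2)]) simp_all
    qed
  qed
qed

lemma integral_solution:
  fixes f :: "real \<Rightarrow> real"
  assumes "t \<in> {0..T}" "f \<in> borel_measurable borel"
  shows "(LINT x|\<mu> t. f x) = (LINT a|mu_init. f (flow t a))"
  unfolding solution_eq_pushforward[OF assms(1)]
  by (rule integral_distr) (use assms flow_measurable borel_measurable_mu_init in auto)

text \<open>Along the flow the kinetic energy is an average over starting points \<open>a\<close> of
  the energy of one trajectory; after exchanging the integrals, Jensen applies to each trajectory
  separately.\<close>

lemma action_ge: "(LINT a|mu_init. (flow T a - a)\<^sup>2 / T) \<le> (LINT t|lebesgue_on {0..T}. LINT x|\<mu> t. (u t x)\<^sup>2)"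
proof -
  have m: "(\<lambda>(t, a). (u t (flow t a))\<^sup>2) \<in> borel_measurable (lebesgue_on {0..T} \<Otimes>\<^sub>M borel)"
  proof -
    have "(\<lambda>p. (fst p, flow (fst p) (snd p))) \<in> lebesgue_on {0..T} \<Otimes>\<^sub>M borel \<rightarrow>\<^sub>M lebesgue_on {0..T} \<Otimes>\<^sub>M borel"
      using flow_joint_measurable by (intro measurable_Pair measurable_fst) (simp add: split_beta)
    from measurable_compose[OF this joint_measurable] show ?thesis
      by (simp add: split_beta borel_measurable_power)
  qed
  have b: "\<bar>(u t (flow t a))\<^sup>2\<bar> \<le> 1" if "t \<in> {0..T}" for t a
    using bound[OF that] by (simp add: abs_square_le_1)
  have "(LINT a|mu_init. (flow T a - a)\<^sup>2 / T) \<le> (LINT a|mu_init. LINT t|lebesgue_on {0..T}. (u t (flow t a))\<^sup>2)"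
  proof (rule integral_mono)
    have TT: "T \<in> {0..T}" using T by simp
    show "integrable mu_init (\<lambda>a. (flow T a - a)\<^sup>2 / T)"
    proof (rule integrable_mu_init[of _ "T\<^sup>2 / T"])
      show "(\<lambda>a. (flow T a - a)\<^sup>2 / T) \<in> borel_measurable borel"
        using flow_measurable[OF TT] by simp
      show "\<bar>(flow T a - a)\<^sup>2 / T\<bar> \<le> T\<^sup>2 / T" for a
        using power_mono[OF flow_displacement[OF TT, of a], of 2] T by (simp add: divide_right_mono)
    qed
    show "integrable mu_init (\<lambda>a. LINT t|lebesgue_on {0..T}. (u t (flow t a))\<^sup>2)"
      by (rule fubini_mu_init(2)[OF m b])
    fix a
    have c: "continuous_on {0..T} (\<lambda>t. flow t a)" using characteristic_flow by (simp add: characteristic_def)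
    have "flow T a - flow 0 a = integral {0..T} (\<lambda>r. u r (flow r a))"
      by (rule characteristic_diff(1)[OF characteristic_flow]) (use T in auto)
    then show "(flow T a - a)\<^sup>2 / T \<le> (LINT t|lebesgue_on {0..T}. (u t (flow t a))\<^sup>2)"
      using integral_square_ge[OF velocity_along_measurable[OF c] bound T] by simp
  qed
  also have "\<dots> = (LINT t|lebesgue_on {0..T}. LINT a|mu_init. (u t (flow t a))\<^sup>2)"
    by (rule fubini_mu_init(1)[OF m b, symmetric])
  also have "\<dots> = (LINT t|lebesgue_on {0..T}. LINT x|\<mu> t. (u t x)\<^sup>2)"
    by (rule Bochner_Integration.integral_cong)
      (use borel_measurable_space in \<open>simp_all add: integral_solution borel_measurable_power\<close>)
  finally show ?thesis .
qed

lemma cost_ge_static_cost: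
  "static_cost T lam mu_init (\<lambda>a. a) (\<lambda>a. (flow T a - a) / T) \<le> cost_inf T lam u \<mu>"
proof -
  have TT: "T \<in> {0..T}" using T by simp
  have "T / 2 * (LINT a|mu_init. ((flow T a - a) / T)\<^sup>2) = 1 / 2 * (LINT a|mu_init. (flow T a - a)\<^sup>2 / T)"
  proof -
    have "(LINT a|mu_init. ((flow T a - a) / T)\<^sup>2) = (LINT a|mu_init. (flow T a - a)\<^sup>2 / T * (1 / T))"
      by (simp add: power_divide power2_eq_square)
    then show ?thesis using T by simp
  qed
  moreover have "var_measure (\<mu> T) = (LINT a|mu_init. (a + T * ((flow T a - a) / T))\<^sup>2) -
      (LINT a|mu_init. a + T * ((flow T a - a) / T))\<^sup>2"
    using T unfolding var_measure_def by (simp add: integral_solution[OF TT])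
  ultimately show ?thesis
    unfolding static_cost_def cost_inf_def using action_ge by simp
qed

end

section \<open>Minimality of the clipped velocity\<close>

definition clip :: "real \<Rightarrow> real" where
  "clip r = max (-1) (min 1 r)"

lemma clip_bound: "\<bar>clip r\<bar> \<le> 1"
  by (simp add: clip_def)

lemma clip_lipschitz: "\<bar>clip r - clip s\<bar> \<le> \<bar>r - s\<bar>"
  by (simp add: clip_def max_def min_def abs_if)

lemma clip_uminus: "clip (- r) = - clip r"
  by (simp add: clip_def max_def min_def)

lemma clip_measurable [measurable]: "clip \<in> borel_measurable borel"
  unfolding clip_def[abs_def] by measurable

text \<open>The variational inequality of the projection onto the convex set
  \<open>{-1..1}\<close>.\<close>

lemma clip_projection: "\<bar>w\<bar> \<le> 1 \<Longrightarrow> 0 \<le> (w - clip r) * (clip r - r)"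
  by (auto simp: clip_def max_def min_def abs_le_iff intro: mult_nonneg_nonneg mult_nonpos_nonpos)

text \<open>The linearised integrand has a sign because \<open>v\<close> is the projection of \<open>a / (lam - T)\<close> to \<open>{-1..1}\<close>.\<close>

lemma static_integrand_ge:
  fixes T lam a v w :: real
  assumes lam: "lam > T \<or> lam < 0" and T: "T > 0" and w: "\<bar>w\<bar> \<le> 1" and v: "v = clip (a / (lam - T))"
  shows "T / 2 * v\<^sup>2 - 1 / (2 * lam) * (a + T * v)\<^sup>2 + T / 2 * (1 - T / lam) * (w - v)\<^sup>2
    \<le> T / 2 * w\<^sup>2 - 1 / (2 * lam) * (a + T * w)\<^sup>2"
proof -
  have lam0: "lam \<noteq> 0" "lam - T \<noteq> 0" using lam T by auto
  have pos: "0 \<le> (lam - T) / lam" using lam T by (auto simp: zero_le_divide_iff)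
  \<comment> \<open>An exact expansion around \<open>v\<close>: the quadratic remainder sits on the
    left of the claim, so only the first-order term is left.\<close>
  have "(T / 2 * w\<^sup>2 - 1 / (2 * lam) * (a + T * w)\<^sup>2) -
      (T / 2 * v\<^sup>2 - 1 / (2 * lam) * (a + T * v)\<^sup>2 + T / 2 * (1 - T / lam) * (w - v)\<^sup>2)
      = T * ((lam - T) / lam) * ((w - v) * (v - a / (lam - T)))"
    using lam0 by (simp add: field_simps power2_eq_square)
  also have "\<dots> \<ge> 0"
    unfolding v by (rule mult_nonneg_nonneg[OF mult_nonneg_nonneg[OF less_imp_le[OF T] pos] clip_projection[OF w]])
  finally show ?thesis by simp
qed

text \<open>Integrating the pointwise inequality leaves the squared mean of the competitor,
  \<open>(T * D)\<^sup>2 / (2 * lam)\<close>, where \<open>D\<close> is the mean of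
  \<open>w - v\<close>. For \<open>lam > T\<close> it is nonnegative. For \<open>lam < 0\<close> it
  is compensated by the curvature term in \<open>D2\<close>, the mean of
  \<open>(w - v)\<^sup>2\<close>, because \<open>D\<^sup>2 \<le> D2\<close>.\<close>

lemma static_cost_minimal:
  fixes a w :: "'a \<Rightarrow> real"
  assumes M: "prob_space M" and lam: "lam > T \<or> lam < 0" and T: "T > 0"
    and a: "a \<in> borel_measurable M" "AE x in M. \<bar>a x\<bar> \<le> 1"
    and w: "w \<in> borel_measurable M" "\<And>x. x \<in> space M \<Longrightarrow> \<bar>w x\<bar> \<le> 1"
    and mean: "(LINT x|M. a x + T * clip (a x / (lam - T))) = 0"
  shows "static_cost T lam M a (\<lambda>x. clip (a x / (lam - T))) \<le> static_cost T lam M a w"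
proof -
  interpret prob_space M by (rule M)
  define v where "v x = clip (a x / (lam - T))" for x
  have [measurable]: "v \<in> borel_measurable M" "a \<in> borel_measurable M" "w \<in> borel_measurable M"
    using a w unfolding v_def[abs_def] by measurable
  have vb: "\<bar>v x\<bar> \<le> 1" for x unfolding v_def by (rule clip_bound)
  \<comment> \<open>Integrability is shown once for general coefficients; the functions needed below
    are instances.\<close>
  have sq: "integrable M (\<lambda>x. (b * a x + c * w x + d * v x)\<^sup>2)" "integrable M (\<lambda>x. b * a x + c * w x + d * v x)" for b c d
  proof -
    have bd: "AE x in M. \<bar>b * a x + c * w x + d * v x\<bar> \<le> \<bar>b\<bar> + \<bar>c\<bar> + \<bar>d\<bar>"
      using a(2) AE_space
    proof eventually_elim
      fix x assume x: "\<bar>a x\<bar> \<le> 1" "x \<in> space M"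
      have "\<bar>b * a x\<bar> \<le> \<bar>b\<bar>" "\<bar>c * w x\<bar> \<le> \<bar>c\<bar>" "\<bar>d * v x\<bar> \<le> \<bar>d\<bar>"
        unfolding abs_mult using x(1) w(2)[OF x(2)] vb[of x] by (simp_all add: mult_left_le)
      then show "\<bar>b * a x + c * w x + d * v x\<bar> \<le> \<bar>b\<bar> + \<bar>c\<bar> + \<bar>d\<bar>" by linarith
    qed
    then show "integrable M (\<lambda>x. b * a x + c * w x + d * v x)"
      by (intro integrable_const_bound[of _ "\<bar>b\<bar> + \<bar>c\<bar> + \<bar>d\<bar>"]) auto
    have "AE x in M. norm ((b * a x + c * w x + d * v x)\<^sup>2) \<le> (\<bar>b\<bar> + \<bar>c\<bar> + \<bar>d\<bar>)\<^sup>2"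
      using bd
    proof (rule eventually_mono)
      fix x assume "\<bar>b * a x + c * w x + d * v x\<bar> \<le> \<bar>b\<bar> + \<bar>c\<bar> + \<bar>d\<bar>"
      from power_mono[OF this abs_ge_zero, of 2]
      show "norm ((b * a x + c * w x + d * v x)\<^sup>2) \<le> (\<bar>b\<bar> + \<bar>c\<bar> + \<bar>d\<bar>)\<^sup>2"
        by (simp only: real_norm_def power2_abs abs_power2)
    qed
    then show "integrable M (\<lambda>x. (b * a x + c * w x + d * v x)\<^sup>2)"
      by (rule integrable_const_bound) measurable
  qed
  have iw2: "integrable M (\<lambda>x. (w x)\<^sup>2)" and iv2: "integrable M (\<lambda>x. (v x)\<^sup>2)"
    and iaw2: "integrable M (\<lambda>x. (a x + T * w x)\<^sup>2)" and iav2: "integrable M (\<lambda>x. (a x + T * v x)\<^sup>2)"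
    and iD2: "integrable M (\<lambda>x. (w x - v x)\<^sup>2)" and iD: "integrable M (\<lambda>x. w x - v x)"
    and iav: "integrable M (\<lambda>x. a x + T * v x)" and iaw: "integrable M (\<lambda>x. a x + T * w x)"
    using sq(1)[of 0 1 0] sq(1)[of 0 0 1] sq(1)[of 1 T 0] sq(1)[of 1 0 T] sq(1)[of 0 1 "-1"]
      sq(2)[of 0 1 "-1"] sq(2)[of 1 0 T] sq(2)[of 1 T 0]
    by (simp_all only: mult_zero_left mult_1_left add_0_left add_0_right mult_minus_left diff_conv_add_uminus)
  define D where "D = (LINT x|M. w x - v x)"
  define D2 where "D2 = (LINT x|M. (w x - v x)\<^sup>2)"
  have "(LINT x|M. T / 2 * (v x)\<^sup>2 - 1 / (2 * lam) * (a x + T * v x)\<^sup>2 + T / 2 * (1 - T / lam) * (w x - v x)\<^sup>2)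
      \<le> (LINT x|M. T / 2 * (w x)\<^sup>2 - 1 / (2 * lam) * (a x + T * w x)\<^sup>2)"
    by (intro integral_mono Bochner_Integration.integrable_add Bochner_Integration.integrable_diff
        integrable_mult_right iw2 iv2 iaw2 iav2 iD2 static_integrand_ge[OF lam T w(2)] v_def)
  moreover have "(LINT x|M. T / 2 * (v x)\<^sup>2 - 1 / (2 * lam) * (a x + T * v x)\<^sup>2 + T / 2 * (1 - T / lam) * (w x - v x)\<^sup>2)
      = T / 2 * (LINT x|M. (v x)\<^sup>2) - 1 / (2 * lam) * (LINT x|M. (a x + T * v x)\<^sup>2) + T / 2 * (1 - T / lam) * D2"
    unfolding D2_def
    by (subst Bochner_Integration.integral_add Bochner_Integration.integral_diff;
        (intro Bochner_Integration.integrable_add Bochner_Integration.integrable_diff integrable_mult_right iv2 iav2 iD2)?)+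
      (simp only: integral_mult_right_zero)
  moreover have "(LINT x|M. T / 2 * (w x)\<^sup>2 - 1 / (2 * lam) * (a x + T * w x)\<^sup>2)
      = T / 2 * (LINT x|M. (w x)\<^sup>2) - 1 / (2 * lam) * (LINT x|M. (a x + T * w x)\<^sup>2)"
    by (subst Bochner_Integration.integral_diff) (auto intro!: integrable_mult_right iw2 iaw2)
  moreover have mw: "(LINT x|M. a x + T * w x) = T * D"
  proof -
    have "(LINT x|M. a x + T * w x) = (LINT x|M. (a x + T * v x) + T * (w x - v x))"
      by (rule Bochner_Integration.integral_cong) (simp_all add: algebra_simps)
    also have "\<dots> = (LINT x|M. a x + T * v x) + (LINT x|M. T * (w x - v x))"
      by (rule Bochner_Integration.integral_add[OF iav integrable_mult_right[OF iD]])
    finally show ?thesis using mean by (simp add: D_def v_def)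
  qed
  moreover have mv: "(LINT x|M. a x + T * v x) = 0" using mean by (simp add: v_def)
  moreover have DD: "D\<^sup>2 \<le> D2"
  proof -
    have "0 \<le> (LINT x|M. (w x - v x - D)\<^sup>2)" by (rule Bochner_Integration.integral_nonneg) simp
    also have "\<dots> = (LINT x|M. (w x - v x)\<^sup>2 - (2 * D) * (w x - v x) + D\<^sup>2)"
      by (rule Bochner_Integration.integral_cong) (simp_all add: power2_eq_square algebra_simps)
    also have "\<dots> = D2 - 2 * D * D + D\<^sup>2"
      using iD iD2 by (simp add: D_def D2_def prob_space)
    finally show ?thesis by (simp add: power2_eq_square)
  qed
  moreover have "0 \<le> T / 2 * (1 - T / lam) * D2 + 1 / (2 * lam) * (T * D)\<^sup>2"
  proof -
    have D20: "0 \<le> D2" using DD by (meson order_trans zero_le_power2)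
    show ?thesis
    proof (cases "lam > T")
      case True
      then show ?thesis using T D20 by (intro add_nonneg_nonneg mult_nonneg_nonneg) auto
    next
      case False
      then have "lam < 0" using lam by simp
      have "T / 2 * (1 - T / lam) * D2 + 1 / (2 * lam) * (T * D)\<^sup>2 = T / 2 * D2 + (- (T\<^sup>2 / (2 * lam))) * (D2 - D\<^sup>2)"
        using \<open>lam < 0\<close> by (simp add: field_simps power2_eq_square)
      also have "\<dots> \<ge> 0"
        using T D20 DD \<open>lam < 0\<close> by (intro add_nonneg_nonneg mult_nonneg_nonneg) (auto simp: divide_nonneg_neg divide_nonpos_neg)
      finally show ?thesis .
    qed
  qed
  ultimately have "static_cost T lam M a v \<le> static_cost T lam M a w"
    unfolding static_cost_def mw mv right_diff_distrib by simp
  then show ?thesis by (simp add: v_def[abs_def])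
qed

subsection \<open>The problem with finitely many particles\<close>

text \<open>The fundamental theorem for absolutely continuous functions, proved directly on
  gauge-fine divisions. At tags where \<open>f\<close> is differentiable the gauge makes the
  linearisation accurate. The other tags form a null set, and the gauge confines their cells to an
  open set of measure below \<open>\<delta>\<close>, where absolute continuity bounds the
  increments.\<close>

lemma abs_continuous_on_has_integral:
  assumes ac: "abs_continuous_on {0..T} f" and T: "0 < T"
    and D: "AE t in lebesgue_on {0..T}. (f has_real_derivative u t) (at t within {0..T})"
  shows "(u has_integral f T - f 0) {0..T}"
proof -
  define E where "E = {t \<in> {0..T}. \<not> (f has_real_derivative u t) (at t within {0..T})}"
  have "AE t in lebesgue. t \<in> {0..T} \<longrightarrow> (f has_real_derivative u t) (at t within {0..T})"
    using D by (subst (asm) AE_restrict_space_iff) auto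
  then have "{t \<in> space lebesgue. \<not> (t \<in> {0..T} \<longrightarrow> (f has_real_derivative u t) (at t within {0..T}))} \<in> null_sets lebesgue"
    by (simp only: completion.AE_iff_null_sets)
  then have E0: "E \<in> null_sets lebesgue" by (simp add: E_def)
  \<comment> \<open>With the value 0 on \<open>E\<close>, cells tagged in \<open>E\<close>
    contribute nothing to the Riemann sum, so only their increments of \<open>f\<close> have to be
    estimated.\<close>
  define u' where "u' t = (if t \<in> E then 0 else u t)" for t
  have "(u' has_integral f T - f 0) {0..T}"
    unfolding has_integral_real
  proof (intro allI impI)
    fix e :: real assume e: "0 < e"
    then obtain \<delta> where \<delta>: "\<delta> > 0" "\<And>D. D division_of \<Union>D \<Longrightarrow> \<Union>D \<subseteq> {0..T} \<Longrightarrow>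
        (\<Sum>K\<in>D. measure lborel K) < \<delta> \<Longrightarrow> (\<Sum>K\<in>D. \<bar>f (Sup K) - f (Inf K)\<bar>) < e / 2"
      using ac unfolding abs_continuous_on_def by (meson half_gt_zero)
    obtain G where G: "open G" "E \<subseteq> G" "emeasure lebesgue (G - E) < ennreal \<delta>"
      by (rule sets_lebesgue_outer_open[OF null_setsD2[OF E0] \<delta>(1)], rule that)
    have Gs: "G \<in> sets lebesgue" using G(1) by auto
    have "emeasure lebesgue G = emeasure lebesgue (G - E)"
      by (rule emeasure_Diff_null_set[symmetric, OF E0 Gs])
    then have Gm: "emeasure lebesgue G < ennreal \<delta>" using G(3) by simp
    \<comment> \<open>The cells have total length \<open>T\<close>, so the regular tags cost at most
      \<open>e / 4\<close>; together with \<open>e / 2\<close> from the exceptional tags this stays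
      below \<open>e\<close>.\<close>
    define \<eta> where "\<eta> = e / (4 * T)"
    have \<eta>: "\<eta> > 0" using e T by (simp add: \<eta>_def)
    have "\<exists>r>0. (x \<in> E \<longrightarrow> ball x r \<subseteq> G) \<and> (x \<in> {0..T} - E \<longrightarrow>
        (\<forall>y\<in>{0..T}. \<bar>y - x\<bar> < r \<longrightarrow> \<bar>f y - f x - u x * (y - x)\<bar> \<le> \<eta> * \<bar>y - x\<bar>))" for x
    proof (cases "x \<in> E")
      case True
      then obtain r where "r > 0" "ball x r \<subseteq> G" using G(1,2) open_contains_ball by blast
      then show ?thesis using True by auto
    next
      case xE: False
      show ?thesis
      proof (cases "x \<in> {0..T}")
        case True
        then have "(f has_real_derivative u x) (at x within {0..T})" using xE by (simp add: E_def)
        then have "(f has_derivative (*) (u x)) (at x within {0..T})" by (simp add: has_field_derivative_def)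
        then obtain r where "r > 0" "\<forall>y\<in>{0..T}. norm (y - x) < r \<longrightarrow> norm (f y - f x - u x * (y - x)) \<le> \<eta> * norm (y - x)"
          unfolding has_derivative_within_alt using \<eta> by blast
        then show ?thesis using xE by auto
      qed (use xE in \<open>auto intro: exI[of _ 1]\<close>)
    qed
    then obtain r where r: "\<And>x. r x > 0" "\<And>x. x \<in> E \<Longrightarrow> ball x (r x) \<subseteq> G"
      "\<And>x y. x \<in> {0..T} - E \<Longrightarrow> y \<in> {0..T} \<Longrightarrow> \<bar>y - x\<bar> < r x \<Longrightarrow> \<bar>f y - f x - u x * (y - x)\<bar> \<le> \<eta> * \<bar>y - x\<bar>"
      by metis
    define \<gamma> where "\<gamma> x = ball x (r x)" for x
    have gauge: "gauge \<gamma>" unfolding \<gamma>_def gauge_def using r(1) by auto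
    have main: "norm ((\<Sum>(x, K)\<in>p. measure lborel K *\<^sub>R u' x) - (f T - f 0)) < e"
      if p: "p tagged_division_of {0..T}" and fine: "\<gamma> fine p" for p
    proof -
      have fin: "finite p" by (rule tagged_division_of_finite[OF p])
      have cell: "\<exists>a b. K = {a..b} \<and> a \<le> x \<and> x \<le> b \<and> 0 \<le> a \<and> b \<le> T \<and> {a..b} \<subseteq> ball x (r x)"
        if xK: "(x, K) \<in> p" for x K
      proof -
        obtain a b where K: "K = {a..b}" using tagged_division_ofD(4)[OF p xK] by (auto simp: box_real)
        have "x \<in> K" "K \<subseteq> {0..T}" using tagged_division_ofD(2,3)[OF p xK] by auto
        moreover have "K \<subseteq> ball x (r x)" using fineD[OF fine xK] by (simp add: \<gamma>_def)
        ultimately show ?thesis using K by (intro exI[of _ a] exI[of _ b]) auto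
      qed
      define g where "g = (\<lambda>(x, K). measure lborel K *\<^sub>R u' x - (f (Sup K) - f (Inf K)))"
      define p1 where "p1 = {q \<in> p. fst q \<notin> E}"
      define p2 where "p2 = {q \<in> p. fst q \<in> E}"
      have "(\<Sum>(x, K)\<in>p. measure lborel K *\<^sub>R u' x) - (f T - f 0) = sum g p"
        using additive_tagged_division_1[OF less_imp_le[OF T] p, of f, symmetric]
        by (simp add: g_def split_beta sum_subtractf)
      also have "\<dots> = sum g p1 + sum g p2"
      proof -
        have "p = p1 \<union> p2" "p1 \<inter> p2 = {}" by (auto simp: p1_def p2_def)
        then show ?thesis using fin by (metis finite_Un sum.union_disjoint)
      qed
      finally have split: "(\<Sum>(x, K)\<in>p. measure lborel K *\<^sub>R u' x) - (f T - f 0) = sum g p1 + sum g p2" .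
      have "\<bar>sum g p1\<bar> \<le> (\<Sum>(x, K)\<in>p1. \<eta> * measure lborel K)"
      proof (rule order_trans[OF sum_abs sum_mono])
        fix q assume "q \<in> p1"
        then obtain x K where q: "q = (x, K)" "(x, K) \<in> p" "x \<notin> E" by (cases q) (auto simp: p1_def)
        obtain a b where K: "K = {a..b}" "a \<le> x" "x \<le> b" "0 \<le> a" "b \<le> T" "{a..b} \<subseteq> ball x (r x)"
          using cell[OF q(2)] by blast
        have ab: "a \<in> ball x (r x)" "b \<in> ball x (r x)" using K(2,3) by (intro subsetD[OF K(6)]; simp)+
        have xT: "x \<in> {0..T} - E" using K q by auto
        have 1: "\<bar>f b - f x - u x * (b - x)\<bar> \<le> \<eta> * \<bar>b - x\<bar>"
          by (rule r(3)[OF xT]) (use K ab in \<open>auto simp: dist_real_def abs_minus_commute\<close>)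
        have 2: "\<bar>f a - f x - u x * (a - x)\<bar> \<le> \<eta> * \<bar>a - x\<bar>"
          by (rule r(3)[OF xT]) (use K ab in \<open>auto simp: dist_real_def abs_minus_commute\<close>)
        \<comment> \<open>The tag splits its cell, so the error is a difference of two linearisation
          errors at \<open>x\<close>, bounded by \<open>\<eta>\<close> times the lengths of the two
          pieces.\<close>
        have "g q = - (f b - f x - u x * (b - x)) + (f a - f x - u x * (a - x))"
          using K q by (simp add: g_def u'_def algebra_simps)
        then have "\<bar>g q\<bar> \<le> \<eta> * (b - x) + \<eta> * (x - a)" using 1 2 K by (simp add: abs_if split: if_splits)
        also have "\<dots> = \<eta> * measure lborel K" using K by (simp add: algebra_simps)
        finally show "\<bar>g q\<bar> \<le> (case q of (x, K) \<Rightarrow> \<eta> * measure lborel K)" by (simp add: q)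
      qed
      also have "\<dots> \<le> (\<Sum>(x, K)\<in>p. \<eta> * measure lborel K)"
      proof (rule sum_mono2[OF fin])
        show "0 \<le> (case q of (x, K) \<Rightarrow> \<eta> * measure lborel K)" for q :: "real \<times> real set"
          using \<eta> by (simp add: split_beta)
      qed (simp add: p1_def subset_eq)
      also have "\<dots> = \<eta> * (\<Sum>(x, K)\<in>p. measure lborel K)" by (simp add: sum_distrib_left split_beta)
      also have "\<dots> = \<eta> * T" using additive_content_tagged_division[of p 0 T, unfolded box_real, OF p] T by simp
      also have "\<dots> = e / 4" using T by (simp add: \<eta>_def)
      finally have s1: "\<bar>sum g p1\<bar> \<le> e / 4" .
      have p2: "p2 tagged_partial_division_of {0..T}"
      proof (rule tagged_partial_division_subset)
        show "p tagged_partial_division_of {0..T}" using p by (simp only: tagged_division_of_def)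
      qed (simp add: p2_def subset_eq)
      define D where "D = snd ` p2"
      have div: "D division_of \<Union>D" unfolding D_def by (rule partial_division_of_tagged_division[OF p2])
      have sub: "\<Union>D \<subseteq> {0..T}" using tagged_partial_division_ofD(3)[OF p2] by (fastforce simp: D_def)
      have DG: "\<Union>D \<subseteq> G"
      proof
        fix y assume "y \<in> \<Union>D"
        then obtain x K where "(x, K) \<in> p" "x \<in> E" "y \<in> K" by (auto simp: D_def p2_def)
        then show "y \<in> G" using cell[of x K] r(2)[of x] by blast
      qed
      have "(\<Sum>K\<in>D. measure lborel K) = measure lebesgue (\<Union>D)"
      proof -
        have "measure lborel K = measure lebesgue K" if KD: "K \<in> D" for K
        proof -
          obtain c d where "K = cbox c d" using division_ofD(4)[OF div KD] by blast
          then show ?thesis by (simp add: measure_completion)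
        qed
        then show ?thesis using content_division[OF div] by simp
      qed
      also have "\<dots> < \<delta>"
      proof -
        have "emeasure lebesgue (\<Union>D) \<le> emeasure lebesgue G" by (rule emeasure_mono[OF DG Gs])
        with Gm have "emeasure lebesgue (\<Union>D) < ennreal \<delta>" by (rule le_less_trans[rotated])
        then show ?thesis using \<delta>(1) unfolding measure_def
          by (metis enn2real_less_iff ennreal_less_top less_imp_le order.strict_trans)
      qed
      finally have "(\<Sum>K\<in>D. \<bar>f (Sup K) - f (Inf K)\<bar>) < e / 2" by (rule \<delta>(2)[OF div sub])
      moreover have "\<bar>sum g p2\<bar> \<le> (\<Sum>K\<in>D. \<bar>f (Sup K) - f (Inf K)\<bar>)"
      proof -
        \<comment> \<open>Passing from tagged cells to the set of cells requires a function that
          vanishes on degenerate boxes. The empty box is among them, hence the separate value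
          0.\<close>
        define d where "d K = (if K = {} then 0 else \<bar>f (Sup K) - f (Inf K)\<bar>)" for K
        have "\<bar>sum g p2\<bar> \<le> (\<Sum>(x, K)\<in>p2. d K)"
        proof (rule order_trans[OF sum_abs sum_mono])
          fix q assume "q \<in> p2"
          then obtain x K where q: "q = (x, K)" "(x, K) \<in> p" "x \<in> E" by (cases q) (auto simp: p2_def)
          have "K \<noteq> {}" using tagged_division_ofD(2)[OF p q(2)] by blast
          then show "\<bar>g q\<bar> \<le> (case q of (x, K) \<Rightarrow> d K)"
            using q(3) unfolding q(1) g_def u'_def d_def by simp
        qed
        also have "\<dots> = sum d D"
          unfolding D_def
        proof (rule sum.over_tagged_division_lemma[OF tagged_partial_division_of_Union_self[OF p2]])
          fix a b :: real assume "box a b = {}"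
          then have "b \<le> a" by (simp add: box_real)
          then show "d (cbox a b) = 0" by (cases "a = b") (auto simp: d_def)
        qed
        also have "\<dots> \<le> (\<Sum>K\<in>D. \<bar>f (Sup K) - f (Inf K)\<bar>)"
          by (rule sum_mono) (simp add: d_def)
        finally show ?thesis .
      qed
      ultimately show ?thesis using split s1 e by simp
    qed
    show "\<exists>\<gamma>. gauge \<gamma> \<and> (\<forall>\<D>. \<D> tagged_division_of {0..T} \<and> \<gamma> fine \<D> \<longrightarrow>
        norm ((\<Sum>(x, K)\<in>\<D>. measure lborel K *\<^sub>R u' x) - (f T - f 0)) < e)"
      by (rule exI[of _ \<gamma>], rule conjI[OF gauge], intro allI impI, elim conjE, rule main)
  qed
  moreover have "negligible E" using E0 by (simp add: negligible_iff_null_sets)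
  ultimately show ?thesis
    by (rule has_integral_spike[rotated 2]) (simp add: u'_def)
qed

lemma abs_continuous_on_affine:
  assumes T: "0 \<le> T"
  shows "abs_continuous_on {0..T} (\<lambda>t. a + t * v)"
  unfolding abs_continuous_on_def
proof (intro allI impI)
  fix e :: real assume e: "0 < e"
  show "\<exists>\<delta>>0. \<forall>D. D division_of \<Union>D \<longrightarrow> \<Union>D \<subseteq> {0..T} \<longrightarrow> (\<Sum>K\<in>D. measure lborel K) < \<delta> \<longrightarrow>
      (\<Sum>K\<in>D. \<bar>a + Sup K * v - (a + Inf K * v)\<bar>) < e"
  proof (intro exI[of _ "e / (\<bar>v\<bar> + 1)"] conjI allI impI)
    show "0 < e / (\<bar>v\<bar> + 1)" using e by (simp add: add_nonneg_pos)
    fix D :: "real set set" assume D: "D division_of \<Union>D" and small: "(\<Sum>K\<in>D. measure lborel K) < e / (\<bar>v\<bar> + 1)"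
    have "(\<Sum>K\<in>D. \<bar>a + Sup K * v - (a + Inf K * v)\<bar>) = (\<Sum>K\<in>D. \<bar>v\<bar> * measure lborel K)"
    proof (rule sum.cong[OF refl])
      fix K assume "K \<in> D"
      then obtain c d where K: "K = {c..d}" "c \<le> d"
        using division_ofD(3,4)[OF D] by (metis atLeastatMost_empty_iff box_real(2))
      then have "a + Sup K * v - (a + Inf K * v) = v * (d - c)" by (simp add: algebra_simps)
      then show "\<bar>a + Sup K * v - (a + Inf K * v)\<bar> = \<bar>v\<bar> * measure lborel K" using K by (simp add: abs_mult)
    qed
    also have "\<dots> = \<bar>v\<bar> * (\<Sum>K\<in>D. measure lborel K)" by (simp add: sum_distrib_left)
    also have "\<dots> \<le> (\<bar>v\<bar> + 1) * (\<Sum>K\<in>D. measure lborel K)" by (intro mult_right_mono sum_nonneg) auto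
    also have "\<dots> < (\<bar>v\<bar> + 1) * (e / (\<bar>v\<bar> + 1))" by (rule mult_strict_left_mono[OF small]) simp
    also have "\<dots> = e" by (simp add: add_nonneg_eq_0_iff)
    finally show "(\<Sum>K\<in>D. \<bar>a + Sup K * v - (a + Inf K * v)\<bar>) < e" .
  qed
qed

text \<open>Presents the particles as a static problem over the index set, so that
  \<open>static_cost_minimal\<close> serves both the finite and the limit problem.\<close>

lemma static_cost_uniform_count:
  "static_cost T lam (uniform_count_measure {1..N}) a w
    = T / 2 * ((\<Sum>i=1..N. (w i)\<^sup>2) / real N) - 1 / (2 * lam) * var_vec N (\<lambda>i. a i + T * w i)"
  unfolding static_cost_def var_vec_def by (simp add: integral_uniform_count_measure)

lemma cost_N_ge_static_cost:
  assumes T: "T > 0" and N: "N \<ge> 2" and u: "admissible_N T N u" and x: "trajectory_N T N u x"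
  shows "static_cost T lam (uniform_count_measure {1..N}) (x_init N) (\<lambda>i. (x i T - x_init N i) / T) \<le> cost_N T lam N u x"
    and "i \<in> {1..N} \<Longrightarrow> \<bar>(x i T - x_init N i) / T\<bar> \<le> 1"
proof -
  have u1: "u i \<in> borel_measurable (lebesgue_on {0..T})" "\<And>t. t \<in> {0..T} \<Longrightarrow> \<bar>u i t\<bar> \<le> 1" if "i \<in> {1..N}" for i
    using u that by (auto simp: admissible_N_def abs_le_iff)
  have int: "integral {0..T} (u i) = x i T - x_init N i" if "i \<in> {1..N}" for i
    using abs_continuous_on_has_integral[of T "x i" "u i"] x that T
    by (auto simp: trajectory_N_def intro!: integral_unique)
  have "T / 2 * ((\<Sum>i=1..N. ((x i T - x_init N i) / T)\<^sup>2) / real N) = 1 / (2 * real N) * (\<Sum>i=1..N. (x i T - x_init N i)\<^sup>2 / T)"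
    using T by (simp add: power_divide sum_divide_distrib[symmetric] power2_eq_square)
  also have "\<dots> \<le> 1 / (2 * real N) * (\<Sum>i=1..N. LINT t|lebesgue_on {0..T}. (u i t)\<^sup>2)"
  proof (intro mult_left_mono sum_mono)
    fix i assume i: "i \<in> {1..N}"
    from integral_square_ge[OF u1[OF i] T]
    show "(x i T - x_init N i)\<^sup>2 / T \<le> (LINT t|lebesgue_on {0..T}. (u i t)\<^sup>2)" by (simp only: int[OF i])
  qed simp
  finally have "T / 2 * ((\<Sum>i=1..N. ((x i T - x_init N i) / T)\<^sup>2) / real N)
      \<le> 1 / (2 * real N) * (\<Sum>i=1..N. LINT t|lebesgue_on {0..T}. (u i t)\<^sup>2)" .
  then show "static_cost T lam (uniform_count_measure {1..N}) (x_init N) (\<lambda>i. (x i T - x_init N i) / T) \<le> cost_N T lam N u x"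
    unfolding static_cost_uniform_count cost_N_def using T by simp
  show "\<bar>(x i T - x_init N i) / T\<bar> \<le> 1" if i: "i \<in> {1..N}"
  proof -
    have "\<bar>integral {0..T} (u i)\<bar> \<le> 1 * (T - 0)"
      by (rule integral_abs_le[OF lebesgue_on_interval_bounded(1)[OF u1[OF i]]]) (use T u1[OF i] in auto)
    then show ?thesis using T by (simp add: int[OF i])
  qed
qed

lemma x_init_bound:
  assumes N: "N \<ge> 2" and i: "i \<in> {1..N}" shows "\<bar>x_init N i\<bar> \<le> 1"
  using assms by (auto simp: x_init_def field_simps abs_le_iff)

lemma x_init_reflect:
  assumes N: "N \<ge> 2" and i: "i \<in> {1..N}" shows "x_init N (N + 1 - i) = - x_init N i"
  using assms by (auto simp: x_init_def field_simps of_nat_diff)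

text \<open>The reflection of indices \<open>N + 1 - i\<close> changes the sign of the initial
  position. This supplies the mean-zero hypothesis of the static problem;
  \<open>integral_mu_init_odd\<close> does the same for the limit.\<close>

lemma odd_sum_x_init:
  assumes N: "N \<ge> 2" and g: "\<And>r :: real. g (- r) = - g r"
  shows "(\<Sum>i=1..N. g (x_init N i)) = (0 :: real)"
proof -
  have "(\<Sum>i=1..N. g (x_init N i)) = (\<Sum>i=1..N. g (x_init N (N + 1 - i)))"
    by (rule sum.reindex_bij_witness[of _ "\<lambda>i. N + 1 - i" "\<lambda>i. N + 1 - i"]) auto
  also have "\<dots> = - (\<Sum>i=1..N. g (x_init N i))"
    unfolding sum_negf[symmetric] by (rule sum.cong) (simp_all only: x_init_reflect[OF N] g)
  finally show ?thesis by simp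
qed

text \<open>For controls constant in time Jensen's inequality is an equality, so the static minimum
  is attained.\<close>

lemma optimal_control_N_constant:
  assumes T: "T > 0" and lam: "lam > T \<or> lam < 0" and N: "N \<ge> 2"
  defines "v \<equiv> (\<lambda>i. clip (x_init N i / (lam - T)))"
  shows "optimal_control_N T lam N (\<lambda>i t. v i)" "trajectory_N T N (\<lambda>i t. v i) (\<lambda>i t. x_init N i + t * v i)"
proof -
  let ?M = "uniform_count_measure {1..N}"
  have M: "prob_space ?M" using N by (intro prob_space_uniform_count_measure) auto
  show tr: "trajectory_N T N (\<lambda>i t. v i) (\<lambda>i t. x_init N i + t * v i)"
    unfolding trajectory_N_def
  proof (intro ballI conjI)
    fix i
    show "abs_continuous_on {0..T} (\<lambda>t. x_init N i + t * v i)" by (rule abs_continuous_on_affine) (use T in simp)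
    show "AE t in lebesgue_on {0..T}. ((\<lambda>t. x_init N i + t * v i) has_real_derivative v i) (at t within {0..T})"
      by (rule AE_I2) (auto intro!: derivative_eq_intros)
  qed simp
  have ad: "admissible_N T N (\<lambda>i t. v i)"
    using clip_bound by (auto simp: admissible_N_def v_def abs_le_iff)
  have c: "cost_N T lam N (\<lambda>i t. v i) (\<lambda>i t. x_init N i + t * v i) = static_cost T lam ?M (x_init N) v"
    unfolding static_cost_uniform_count cost_N_def using T by (simp add: sum_distrib_left[symmetric] measure_restrict_space)
  have mean: "(LINT i|?M. x_init N i + T * clip (x_init N i / (lam - T))) = 0"
    using odd_sum_x_init[OF N, of "\<lambda>r. r + T * clip (r / (lam - T))"]
    by (simp add: integral_uniform_count_measure clip_uminus)
  have "cost_N T lam N (\<lambda>i t. v i) (\<lambda>i t. x_init N i + t * v i) \<le> cost_N T lam N w y"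
    if w: "admissible_N T N w" "trajectory_N T N w y" for w y
  proof -
    have "static_cost T lam ?M (x_init N) v \<le> static_cost T lam ?M (x_init N) (\<lambda>i. (y i T - x_init N i) / T)"
      unfolding v_def
      by (rule static_cost_minimal[OF M lam T _ _ _ _ mean])
        (use x_init_bound[OF N] cost_N_ge_static_cost(2)[OF T N w] in \<open>auto simp: space_uniform_count_measure intro!: AE_I2\<close>)
    also have "\<dots> \<le> cost_N T lam N w y" by (rule cost_N_ge_static_cost(1)[OF T N w])
    finally show ?thesis unfolding c .
  qed
  with ad tr show "optimal_control_N T lam N (\<lambda>i t. v i)" unfolding optimal_control_N_def by blast
qed

subsection \<open>Controls with straight characteristics\<close>

lemma AE_mu_init_nonzero: "AE x in mu_init. x \<noteq> 0"
  unfolding mu_init_def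
  by (rule AE_uniform_measureI) (use AE_lborel_singleton[of 0] in \<open>auto elim: eventually_mono\<close>)

lemma integral_mu_init:
  fixes f :: "real \<Rightarrow> real"
  assumes [measurable]: "f \<in> borel_measurable borel"
  shows "(LINT x|mu_init. f x) = (LINT x|lborel. indicator {-1..1} x / 2 * f x)"
proof -
  have eq: "mu_init = density lborel (\<lambda>x. ennreal (indicator {-1..1} x / 2))"
    unfolding mu_init_def uniform_measure_def
    by (rule arg_cong[where f = "density lborel"]) (auto simp: fun_eq_iff indicator_def divide_ennreal[symmetric])
  have "(LINT x|density lborel (\<lambda>x. ennreal (indicator {-1..1} x / 2)). f x)
      = (LINT x|lborel. (indicator {-1..1} x / 2) *\<^sub>R f x)"
    by (rule integral_density) auto
  then show ?thesis unfolding eq[symmetric] real_scaleR_def .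
qed

lemma integral_mu_init_odd:
  fixes f :: "real \<Rightarrow> real"
  assumes f: "f \<in> borel_measurable borel" and odd: "\<And>x. f (- x) = - f x"
  shows "(LINT x|mu_init. f x) = 0"
proof -
  have "(LINT x|mu_init. f x) = (LINT x|lborel. indicator {-1..1} (0 + (-1) * x) / 2 * f (0 + (-1) * x))"
    unfolding integral_mu_init[OF f]
    using lborel_integral_real_affine[of "-1" "\<lambda>x. indicator {-1..1} x / 2 * f x" 0] by simp
  also have "\<dots> = (LINT x|lborel. - (indicator {-1..1} x / 2 * f x))"
    by (rule Bochner_Integration.integral_cong) (auto simp: odd indicator_def)
  also have "\<dots> = - (LINT x|mu_init. f x)"
    unfolding integral_mu_init[OF f] by simp
  finally show ?thesis by simp
qed

lemma bounded_if_compact_support: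
  fixes g :: "'a::euclidean_space \<Rightarrow> real"
  assumes "continuous_on UNIV g" "compact K" "\<And>p. p \<notin> K \<Longrightarrow> g p = 0"
  obtains B where "\<And>p. \<bar>g p\<bar> \<le> B"
proof -
  have "bounded (g ` K)"
    by (intro compact_imp_bounded compact_continuous_image continuous_on_subset[OF assms(1)] assms) simp
  then obtain B where B: "\<And>p. p \<in> K \<Longrightarrow> \<bar>g p\<bar> \<le> B" unfolding bounded_iff by force
  have "\<bar>g p\<bar> \<le> max B 0" for p
  proof (cases "p \<in> K")
    case True
    from B[OF this] show ?thesis by simp
  qed (simp add: assms(3))
  then show ?thesis by (rule that)
qed

lemma test_function_bounded:
  assumes "test_function_on S f"
  obtains B where "continuous_on UNIV f" "\<And>p. \<bar>f p\<bar> \<le> B"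
proof -
  have c: "continuous_on UNIV f" 
    using assms Ck.simps(1)[of f] by (simp add: test_function_on_def del: Ck.simps)
  have k: "compact (closure {x. f x \<noteq> 0})" using assms by (simp add: test_function_on_def)
  have z: "f p = 0" if "p \<notin> closure {x. f x \<noteq> 0}" for p
    using that subsetD[OF closure_subset, of p "{x. f x \<noteq> 0}"] by auto
  show ?thesis by (rule bounded_if_compact_support[OF c k], erule z, rule that[OF c])
qed

text \<open>Directional derivatives vanish off the closed support, whose complement is open, and are
  therefore bounded.\<close>

lemma test_function_directional:
  assumes "test_function_on S f"
  shows "(f has_derivative frechet_derivative f (at p)) (at p)"
    and "continuous_on UNIV (\<lambda>p. frechet_derivative f (at p) v)"
    and "\<exists>B. \<forall>p. \<bar>frechet_derivative f (at p) v\<bar> \<le> B"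
proof -
  have 1: "Ck (Suc 0) f" using assms by (simp add: test_function_on_def del: Ck.simps)
  then have d: "f differentiable (at p)" for p by simp
  then show "(f has_derivative frechet_derivative f (at p)) (at p)" by (simp add: frechet_derivative_works)
  from 1 show c: "continuous_on UNIV (\<lambda>p. frechet_derivative f (at p) v)" by simp
  have k: "compact (closure {x. f x \<noteq> 0})" using assms by (simp add: test_function_on_def)
  have z: "frechet_derivative f (at p) v = 0" if "p \<notin> closure {x. f x \<noteq> 0}" for p
  proof -
    have "((\<lambda>_. 0) has_derivative (\<lambda>_. 0)) (at p)" by simp
    moreover have "open (- closure {x. f x \<noteq> 0})" by auto
    moreover have "p \<in> - closure {x. f x \<noteq> 0}" using that by simp
    moreover have "0 = f q" if "q \<in> - closure {x. f x \<noteq> 0}" for q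
      using that subsetD[OF closure_subset, of q "{x. f x \<noteq> 0}"] by auto
    ultimately have "(f has_derivative (\<lambda>_. 0)) (at p)" by (rule has_derivative_transform_within_open)
    then have "frechet_derivative f (at p) = (\<lambda>_. 0)" by (rule frechet_derivative_at[symmetric])
    then show ?thesis by simp
  qed
  obtain B where "\<And>p. \<bar>frechet_derivative f (at p) v\<bar> \<le> B"
    by (rule bounded_if_compact_support[OF c k], erule z, rule that)
  then show "\<exists>B. \<forall>p. \<bar>frechet_derivative f (at p) v\<bar> \<le> B" by (intro exI[of _ B] allI)
qed

text \<open>All controls needed below have straight characteristics: mass starting at \<open>a\<close> moves with the constant
  velocity \<open>clip (a / \<kappa>)\<close>, and \<open>ctrl t\<close> is this velocity expressed at the position \<open>X t a\<close>.\<close>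

locale straight_flow =
  fixes T \<kappa> :: real
  assumes T: "T > 0" and \<kappa>: "\<kappa> > 0 \<or> \<kappa> < - T"
begin

definition X :: "real \<Rightarrow> real \<Rightarrow> real" where
  "X t a = a + t * clip (a / \<kappa>)"

definition ctrl :: "real \<Rightarrow> real \<Rightarrow> real" where
  "ctrl t x = clip (x / (\<kappa> + t))"

definition sol :: "real \<Rightarrow> real measure" where
  "sol t = distr mu_init borel (X t)"

text \<open>On the range \<open>\<bar>a / \<kappa>\<bar> \<le> 1\<close> the position is
  \<open>(a / \<kappa>) * (\<kappa> + t)\<close>, so dividing by \<open>\<kappa> + t\<close>
  recovers the velocity. Outside it both sides are saturated with the same sign. The condition on
  \<open>\<kappa>\<close> keeps \<open>\<kappa> + t\<close> nonzero and of the sign of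
  \<open>\<kappa>\<close> throughout \<open>{0..T}\<close>.\<close>

lemma ctrl_X:
  assumes t: "t \<in> {0..T}" shows "ctrl t (X t a) = clip (a / \<kappa>)"
proof -
  consider "\<bar>a / \<kappa>\<bar> \<le> 1" | "a / \<kappa> > 1" | "a / \<kappa> < -1" by linarith
  then show ?thesis
  proof cases
    case 1
    then have c: "clip (a / \<kappa>) = a / \<kappa>" unfolding abs_le_iff clip_def by linarith
    have nz: "\<kappa> \<noteq> 0" "\<kappa> + t \<noteq> 0" using \<kappa> t T by auto
    have "X t a = (a / \<kappa>) * (\<kappa> + t)" using nz by (simp add: X_def c field_simps)
    then have "X t a / (\<kappa> + t) = a / \<kappa>" using nz by simp
    then show ?thesis by (simp add: ctrl_def)
  next
    case 2
    then have c: "clip (a / \<kappa>) = 1" by (simp add: clip_def)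
    have "1 \<le> (a + t) / (\<kappa> + t)"
    proof (cases "\<kappa> > 0")
      case True then show ?thesis using 2 t by (simp add: field_simps)
    next
      case False
      then have "\<kappa> < - T" using \<kappa> by simp
      then have "\<kappa> < 0" "\<kappa> + t < 0" using T t by auto
      then show ?thesis using 2 by (simp add: field_simps)
    qed
    then show ?thesis by (simp add: ctrl_def X_def c) (simp add: clip_def)
  next
    case 3
    then have c: "clip (a / \<kappa>) = -1" by (simp add: clip_def)
    have "(a - t) / (\<kappa> + t) \<le> -1"
    proof (cases "\<kappa> > 0")
      case True then show ?thesis using 3 t by (simp add: field_simps)
    next
      case False
      then have "\<kappa> < - T" using \<kappa> by simp
      then have "\<kappa> < 0" "\<kappa> + t < 0" using T t by auto
      then show ?thesis using 3 by (simp add: field_simps)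
    qed
    then show ?thesis by (simp add: ctrl_def X_def c) (simp add: clip_def)
  qed
qed

lemma ctrl_lipschitz: "\<exists>L\<ge>0. \<forall>t\<in>{0..T}. \<forall>x y. \<bar>ctrl t x - ctrl t y\<bar> \<le> L * \<bar>x - y\<bar>"
proof -
  \<comment> \<open>The smallest value of \<open>\<bar>\<kappa> + t\<bar>\<close> on
    \<open>{0..T}\<close>, taken at \<open>t = 0\<close> or at \<open>t = T\<close> according to the
    sign of \<open>\<kappa>\<close>.\<close>
  define m where "m = (if \<kappa> > 0 then \<kappa> else - \<kappa> - T)"
  have m: "m > 0" using \<kappa> by (auto simp: m_def)
  have "\<bar>ctrl t x - ctrl t y\<bar> \<le> 1 / m * \<bar>x - y\<bar>" if t: "t \<in> {0..T}" for t x y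
  proof -
    have mt: "m \<le> \<bar>\<kappa> + t\<bar>" using \<kappa> t by (auto simp: m_def)
    have "\<bar>ctrl t x - ctrl t y\<bar> \<le> \<bar>x / (\<kappa> + t) - y / (\<kappa> + t)\<bar>" unfolding ctrl_def by (rule clip_lipschitz)
    also have "\<dots> = \<bar>x - y\<bar> / \<bar>\<kappa> + t\<bar>" by (simp add: diff_divide_distrib[symmetric])
    also have "\<dots> \<le> \<bar>x - y\<bar> / m" using mt m by (intro divide_left_mono) auto
    finally show ?thesis by simp
  qed
  then show ?thesis using m by (intro exI[of _ "1 / m"]) simp
qed

lemma ctrl_admissible: "admissible_inf T ctrl"
  unfolding admissible_inf_def
proof (intro conjI ballI allI ctrl_lipschitz)
  show "ctrl t x \<in> {-1..1}" for t x
    using clip_bound[of "x / (\<kappa> + t)"] by (auto simp: ctrl_def abs_le_iff)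
  show "(\<lambda>t. ctrl t x) \<in> borel_measurable (lebesgue_on {0..T})" for x
    unfolding ctrl_def by (intro measurable_restrict_space1 measurable_completion) measurable
qed

lemma X_measurable [measurable]: "X t \<in> borel_measurable borel"
  unfolding X_def[abs_def] by measurable

lemma X_measurable' [measurable]: "X t \<in> mu_init \<rightarrow>\<^sub>M borel"
  by (simp add: borel_measurable_mu_init)

lemma integral_sol: "f \<in> borel_measurable borel \<Longrightarrow> (LINT x|sol t. f x) = (LINT a|mu_init. f (X t a))" for f :: "real \<Rightarrow> real"
  unfolding sol_def by (rule integral_distr) measurable

lemma sol_Pc:
  assumes t: "t \<in> {0..T}" shows "sol t \<in> Pc"
proof -
  interpret prob_space "sol t"
    unfolding sol_def by (rule prob_space.prob_space_distr[OF prob_space_mu_init X_measurable'])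
  have "AE a in mu_init. X t a \<in> {-1 - T..1 + T}"
    using AE_mu_init
  proof (rule eventually_mono)
    fix a :: real assume a: "\<bar>a\<bar> \<le> 1"
    have "\<bar>t * clip (a / \<kappa>)\<bar> \<le> T * 1"
      unfolding abs_mult using t clip_bound[of "a / \<kappa>"] by (intro mult_mono) auto
    with a show "X t a \<in> {-1 - T..1 + T}" by (auto simp: X_def abs_le_iff)
  qed
  then have "AE x in sol t. x \<in> {-1 - T..1 + T}"
    unfolding sol_def by (subst AE_distr_iff) auto
  moreover have "{-1 - T..1 + T} \<in> events" by (simp add: sol_def)
  ultimately have "prob {-1 - T..1 + T} = 1" by (simp add: prob_eq_1)
  then show ?thesis
    unfolding Pc_def using prob_space_axioms by (auto simp: sol_def intro!: exI[of _ "{-1 - T..1 + T}"])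
qed

lemma sol_weakly_continuous:
  assumes f: "test_function_on UNIV f"
  shows "continuous_on {0..T} (\<lambda>t. LINT x|sol t. f x)"
proof -
  obtain B where c: "continuous_on UNIV f" and B: "\<And>p. \<bar>f p\<bar> \<le> B" 
    by (rule test_function_bounded[OF f], rule that)
  have m: "f \<in> borel_measurable borel" by (rule borel_measurable_continuous_onI[OF c])
  interpret prob_space mu_init by (rule prob_space_mu_init)
  show ?thesis
    unfolding integral_sol[OF m] continuous_on_sequentially comp_def
  proof (intro allI ballI impI, elim conjE)
    fix s :: "nat \<Rightarrow> real" and t assume "t \<in> {0..T}" and s: "s \<longlonglongrightarrow> t"
    show "(\<lambda>n. LINT a|mu_init. f (X (s n) a)) \<longlonglongrightarrow> (LINT a|mu_init. f (X t a))"
    proof (rule integral_dominated_convergence[where w = "\<lambda>_. B"])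
      show "(\<lambda>a. f (X t a)) \<in> borel_measurable mu_init" "(\<lambda>a. f (X (s n) a)) \<in> borel_measurable mu_init" for n
        by (rule measurable_compose[OF X_measurable' m])+
      show "AE a in mu_init. (\<lambda>n. f (X (s n) a)) \<longlonglongrightarrow> f (X t a)"
      proof (rule AE_I2)
        fix a
        have "(\<lambda>n. X (s n) a) \<longlonglongrightarrow> X t a" unfolding X_def by (intro tendsto_intros s)
        then show "(\<lambda>n. f (X (s n) a)) \<longlonglongrightarrow> f (X t a)"
          using c by (intro continuous_on_tendsto_compose[OF c]) auto
      qed
    qed (use B in auto)
  qed
qed

text \<open>Pulled back to the starting point \<open>a\<close>, the integrand is the derivative of
  \<open>\<xi> (t, X t a)\<close> in \<open>t\<close>. Integrating first in time gives the
  difference of the values at \<open>T\<close> and 0, where \<open>\<xi>\<close> vanishes.\<close>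

lemma sol_distributional:
  assumes \<xi>: "test_function_on ({0<..<T} \<times> UNIV) \<xi>"
  shows "(LINT t|lebesgue_on {0..T}. LINT x|sol t.
      deriv (\<lambda>s. \<xi> (s, x)) t + ctrl t x * deriv (\<lambda>y. \<xi> (t, y)) x) = 0"
proof -
  note D = test_function_directional[OF \<xi>]
  define P where "P p = frechet_derivative \<xi> (at p) (1, 0)" for p
  define Q where "Q p = frechet_derivative \<xi> (at p) (0, 1)" for p
  have Pc: "continuous_on UNIV P" and Qc: "continuous_on UNIV Q" unfolding P_def Q_def by (rule D(2))+
  obtain BP where BP: "\<And>p. \<bar>P p\<bar> \<le> BP" using D(3) unfolding P_def by blast
  obtain BQ where BQ: "\<And>p. \<bar>Q p\<bar> \<le> BQ" using D(3) unfolding Q_def by blast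
  have lin: "frechet_derivative \<xi> (at p) (c, d) = c * P p + d * Q p" for p c d
  proof -
    interpret linear "frechet_derivative \<xi> (at p)" by (rule has_derivative_linear[OF D(1)])
    have "frechet_derivative \<xi> (at p) (c *\<^sub>R (1, 0) + d *\<^sub>R (0, 1)) = c *\<^sub>R P p + d *\<^sub>R Q p"
      unfolding P_def Q_def by (simp only: add scale)
    then show ?thesis by simp
  qed
  \<comment> \<open>One chain rule serves for the two coordinate lines, which give the partial
    derivatives, and for the trajectory.\<close>
  have curve: "((\<lambda>s. \<xi> (\<alpha> s, \<beta> s)) has_real_derivative \<alpha>' * P (\<alpha> t, \<beta> t) + \<beta>' * Q (\<alpha> t, \<beta> t)) (at t)"
    if a: "(\<alpha> has_real_derivative \<alpha>') (at t)" and b: "(\<beta> has_real_derivative \<beta>') (at t)" for \<alpha> \<beta> \<alpha>' \<beta>' t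
  proof -
    have "((\<lambda>s. (\<alpha> s, \<beta> s)) has_derivative (\<lambda>h. (\<alpha>' * h, \<beta>' * h))) (at t)"
      using a b unfolding has_field_derivative_def by (rule has_derivative_Pair)
    from has_derivative_compose[OF this D(1)[of "(\<alpha> t, \<beta> t)"]]
    show ?thesis unfolding has_field_derivative_def
      by (rule has_derivative_eq_rhs) (simp add: fun_eq_iff lin algebra_simps)
  qed
  have dt: "deriv (\<lambda>s. \<xi> (s, x)) t = P (t, x)" and dx: "deriv (\<lambda>y. \<xi> (t, y)) x = Q (t, x)" for t x
    using curve[of "\<lambda>s. s" 1 t "\<lambda>_. x" 0] curve[of "\<lambda>_. t" 0 x "\<lambda>y. y" 1] by (auto intro: DERIV_imp_deriv)
  have [measurable]: "P \<in> borel_measurable borel" "Q \<in> borel_measurable borel"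
    by (rule borel_measurable_continuous_onI, fact)+
  define g where "g t a = P (t, X t a) + clip (a / \<kappa>) * Q (t, X t a)" for t a
  have inner: "(LINT x|sol t. deriv (\<lambda>s. \<xi> (s, x)) t + ctrl t x * deriv (\<lambda>y. \<xi> (t, y)) x) = (LINT a|mu_init. g t a)"
    if t: "t \<in> {0..T}" for t
  proof -
    have "(\<lambda>x. (t, x)) \<in> borel_measurable (borel :: real measure)" by (intro borel_measurable_continuous_onI continuous_intros)
    then have [measurable]: "(\<lambda>x. P (t, x)) \<in> borel_measurable borel" "(\<lambda>x. Q (t, x)) \<in> borel_measurable borel"
      by (auto intro: measurable_compose)
    have "(\<lambda>x. P (t, x) + ctrl t x * Q (t, x)) \<in> borel_measurable borel"
      unfolding ctrl_def by measurable
    from integral_sol[OF this, of t] show ?thesis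
      unfolding dt dx g_def by (simp add: ctrl_X[OF t])
  qed
  have gm: "(\<lambda>(t, a). g t a) \<in> borel_measurable (lebesgue_on {0..T} \<Otimes>\<^sub>M borel)"
  proof -
    have id: "(\<lambda>t. t) \<in> borel_measurable (lebesgue_on {0..T})"
      by (rule continuous_lebesgue_on_measurable) (rule continuous_on_id)
    have f1: "fst \<in> borel_measurable (lebesgue_on {0..T} \<Otimes>\<^sub>M (borel :: real measure))"
      by (rule measurable_compose[OF measurable_fst id])
    have s1: "snd \<in> borel_measurable (lebesgue_on {0..T} \<Otimes>\<^sub>M (borel :: real measure))"
      by (rule measurable_snd)
    have c1: "(\<lambda>p. clip (snd p / \<kappa>)) \<in> borel_measurable (lebesgue_on {0..T} \<Otimes>\<^sub>M (borel :: real measure))"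
      using s1 by measurable
    have x1: "(\<lambda>p. X (fst p) (snd p)) \<in> borel_measurable (lebesgue_on {0..T} \<Otimes>\<^sub>M (borel :: real measure))"
      unfolding X_def using f1 s1 c1 by (intro borel_measurable_add borel_measurable_times)
    have p1: "(\<lambda>p. (fst p, X (fst p) (snd p))) \<in> borel_measurable (lebesgue_on {0..T} \<Otimes>\<^sub>M (borel :: real measure))"
      by (rule borel_measurable_Pair[OF f1 x1])
    show ?thesis
      unfolding g_def split_beta
      by (intro borel_measurable_add borel_measurable_times c1 measurable_compose[OF p1]) measurable
  qed
  have gb: "\<bar>g t a\<bar> \<le> BP + 1 * BQ" for t a
  proof -
    have "\<bar>clip (a / \<kappa>) * Q (t, X t a)\<bar> \<le> 1 * BQ"
      unfolding abs_mult by (intro mult_mono clip_bound BQ) auto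
    then show ?thesis using BP[of "(t, X t a)"] unfolding g_def by linarith
  qed
  have time: "(LINT t|lebesgue_on {0..T}. g t a) = 0" for a
  proof -
    have Xd: "((\<lambda>t. X t a) has_real_derivative clip (a / \<kappa>)) (at t)" for t
      unfolding X_def by (auto intro!: derivative_eq_intros)
    have d: "((\<lambda>t. \<xi> (t, X t a)) has_real_derivative g t a) (at t)" for t
      using curve[OF DERIV_ident Xd] by (simp add: g_def)
    have "((\<lambda>t. g t a) has_integral \<xi> (T, X T a) - \<xi> (0, X 0 a)) {0..T}"
    proof (rule fundamental_theorem_of_calculus)
      show "((\<lambda>t. \<xi> (t, X t a)) has_vector_derivative g t a) (at t within {0..T})" for t
        unfolding has_real_derivative_iff_has_vector_derivative[symmetric]
        by (rule has_field_derivative_at_within[OF d])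
    qed (use T in simp)
    moreover have "\<xi> p = 0" if "fst p \<notin> {0<..<T}" for p
    proof (rule ccontr)
      assume "\<xi> p \<noteq> 0"
      then have "p \<in> closure {p. \<xi> p \<noteq> 0}" by (intro subsetD[OF closure_subset]) simp
      then have "p \<in> {0<..<T} \<times> UNIV" using \<xi> unfolding test_function_on_def by blast
      then show False using that by (simp add: mem_Times_iff)
    qed
    ultimately have hi: "((\<lambda>t. g t a) has_integral 0) {0..T}" by simp
    have "(\<lambda>t. g t a) \<in> borel_measurable (lebesgue_on {0..T})"
      using measurable_compose[OF measurable_Pair2' gm, of a] by simp
    from lebesgue_on_interval_bounded(3)[OF this gb] show ?thesis
      using integral_unique[OF hi] by simp
  qed
  have "(LINT t|lebesgue_on {0..T}. LINT x|sol t. deriv (\<lambda>s. \<xi> (s, x)) t + ctrl t x * deriv (\<lambda>y. \<xi> (t, y)) x)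
      = (LINT t|lebesgue_on {0..T}. LINT a|mu_init. g t a)"
    by (rule Bochner_Integration.integral_cong) (simp_all add: inner)
  also have "\<dots> = (LINT a|mu_init. LINT t|lebesgue_on {0..T}. g t a)"
    by (rule fubini_mu_init(1)[OF gm gb])
  finally show ?thesis by (simp add: time)
qed

lemma sol_continuity_equation: "continuity_equation T ctrl sol"
  unfolding continuity_equation_def
proof (intro conjI ballI allI impI sol_Pc sol_weakly_continuous sol_distributional)
  have "X 0 = (\<lambda>a. a)" by (simp add: X_def fun_eq_iff)
  then show "sol 0 = mu_init" by (simp add: sol_def distr_id2)
qed

text \<open>The velocity is constant along each trajectory, so the static lower bound becomes an
  equality.\<close>

lemma cost_sol: "cost_inf T lam ctrl sol = static_cost T lam mu_init (\<lambda>a. a) (\<lambda>a. clip (a / \<kappa>))"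
proof -
  have "(LINT x|sol t. (ctrl t x)\<^sup>2) = (LINT a|mu_init. (clip (a / \<kappa>))\<^sup>2)" if "t \<in> {0..T}" for t
  proof -
    have "(\<lambda>x. (ctrl t x)\<^sup>2) \<in> borel_measurable borel" unfolding ctrl_def by measurable
    from integral_sol[OF this, of t] show ?thesis by (simp add: ctrl_X[OF that])
  qed
  then have "(LINT t|lebesgue_on {0..T}. LINT x|sol t. (ctrl t x)\<^sup>2)
      = (LINT t|lebesgue_on {0..T}. LINT a|mu_init. (clip (a / \<kappa>))\<^sup>2)"
    by (intro Bochner_Integration.integral_cong[OF refl]) simp
  also have "\<dots> = T * (LINT a|mu_init. (clip (a / \<kappa>))\<^sup>2)" using T by (simp add: measure_restrict_space)
  moreover have "var_measure (sol T) = (LINT a|mu_init. (X T a)\<^sup>2) - (LINT a|mu_init. X T a)\<^sup>2"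
    unfolding var_measure_def by (simp add: integral_sol)
  ultimately show ?thesis unfolding cost_inf_def static_cost_def by (simp add: X_def)
qed

end

subsection \<open>Existence and non-existence of minimizers\<close>

lemma cont_eq_if_admissible:
  assumes "T > 0" "admissible_inf T u" "continuity_equation T u \<mu>"
  obtains L where "cont_eq T u L \<mu>"
proof -
  obtain L where "L \<ge> 0" "\<And>t x y. t \<in> {0..T} \<Longrightarrow> \<bar>u t x - u t y\<bar> \<le> L * \<bar>x - y\<bar>"
    using assms(2) unfolding admissible_inf_def by blast
  moreover have "\<bar>u t x\<bar> \<le> 1" if "t \<in> {0..T}" for t x
  proof -
    have "u t x \<in> {-1..1}" using assms(2) that unfolding admissible_inf_def by blast
    then show ?thesis by (simp add: abs_le_iff)
  qed
  moreover have "(\<lambda>t. u t x) \<in> borel_measurable (lebesgue_on {0..T})" for x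
    using assms(2) unfolding admissible_inf_def by blast
  ultimately have "cont_eq T u L \<mu>"
    using assms(1,3) by unfold_locales
  then show ?thesis by (rule that)
qed

lemma (in velocity) displacement_facts:
  shows "(\<lambda>a. (flow T a - a) / T) \<in> borel_measurable borel" "\<bar>(flow T a - a) / T\<bar> \<le> 1"
proof -
  have TT: "T \<in> {0..T}" using T by simp
  show "(\<lambda>a. (flow T a - a) / T) \<in> borel_measurable borel" using flow_measurable[OF TT] by simp
  show "\<bar>(flow T a - a) / T\<bar> \<le> 1" using flow_displacement[OF TT, of a] T by simp
qed

lemma borel_measurable_ident_real: "(\<lambda>a :: real. a) \<in> borel_measurable borel"
  by measurable

lemma (in straight_flow) mean_terminal_zero:
  "(LINT a|mu_init. a + c * clip (a / \<kappa>)) = 0"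
  by (rule integral_mu_init_odd) (simp_all add: clip_uminus)

text \<open>With \<open>\<kappa> = lam - T\<close> the straight flow realises the static minimiser;
  \<open>lam > T\<close> and \<open>lam < 0\<close> are exactly the two cases allowed for
  \<open>\<kappa>\<close>.\<close>

lemma minimizer_inf_straight:
  assumes T: "T > 0" and lam: "lam > T \<or> lam < 0"
  shows "minimizer_inf T lam (straight_flow.ctrl (lam - T))"
proof -
  interpret straight_flow T "lam - T" using T lam by unfold_locales auto
  have "cost_inf T lam ctrl sol \<le> cost_inf T lam v \<nu>" if v: "admissible_inf T v" "continuity_equation T v \<nu>" for v \<nu>
  proof -
    obtain L where "cont_eq T v L \<nu>" by (rule cont_eq_if_admissible[OF T v])
    then interpret V: cont_eq T v L \<nu> .
    have "static_cost T lam mu_init (\<lambda>a. a) (\<lambda>a. clip (a / (lam - T)))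
        \<le> static_cost T lam mu_init (\<lambda>a. a) (\<lambda>a. (V.flow T a - a) / T)"
      by (rule static_cost_minimal[OF prob_space_mu_init lam T _ AE_mu_init _ _ mean_terminal_zero])
        (simp_all only: borel_measurable_mu_init V.displacement_facts borel_measurable_ident_real)
    with V.cost_ge_static_cost[of lam] show ?thesis unfolding cost_sol by linarith
  qed
  then show ?thesis
    unfolding minimizer_inf_def using ctrl_admissible sol_continuity_equation by blast
qed

text \<open>Each optimal particle control equals the limit feedback evaluated at the particle's own
  position, for every \<open>N\<close>. Convergence of positions therefore passes to the controls
  through the Lipschitz bound.\<close>

lemma optimal_controls_converge:
  assumes T: "T > 0" and lam: "lam > T \<or> lam < 0" and t: "t \<in> {0..T}"
    and lim: "(\<lambda>N. \<bar>x_init N (i N) + t * clip (x_init N (i N) / (lam - T)) - x\<bar>) \<longlonglongrightarrow> 0"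
  shows "(\<lambda>N. \<bar>clip (x_init N (i N) / (lam - T)) - straight_flow.ctrl (lam - T) t x\<bar>) \<longlonglongrightarrow> 0"
proof -
  interpret straight_flow T "lam - T" using T lam by unfold_locales auto
  obtain L where L: "\<And>x y. \<bar>ctrl t x - ctrl t y\<bar> \<le> L * \<bar>x - y\<bar>" using ctrl_lipschitz t by blast
  have "norm \<bar>clip (x_init N (i N) / (lam - T)) - ctrl t x\<bar>
      \<le> L * \<bar>x_init N (i N) + t * clip (x_init N (i N) / (lam - T)) - x\<bar>" for N
    using L[of "X t (x_init N (i N))" x] unfolding ctrl_X[OF t] by (simp add: X_def)
  moreover have "(\<lambda>N. L * \<bar>x_init N (i N) + t * clip (x_init N (i N) / (lam - T)) - x\<bar>) \<longlonglongrightarrow> 0"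
    using tendsto_mult_left[OF lim, of L] by simp
  ultimately show ?thesis by (rule Lim_null_comparison[OF always_eventually[OF allI]])
qed

text \<open>The difference \<open>(\<bar>a\<bar> + T)\<^sup>2 - (a + T * w)\<^sup>2\<close> is
  nonnegative, so \<open>lam \<le> T\<close> allows the factor \<open>1 / (2 * lam)\<close> to be
  lowered to \<open>1 / (2 * T)\<close>. For that factor the comparison is an identity whose surplus
  is \<open>\<bar>a\<bar> - a * w\<close>.\<close>

lemma sgn_integrand_le:
  fixes T lam a w :: real
  assumes lam: "0 < lam" "lam \<le> T" and w: "\<bar>w\<bar> \<le> 1" and a: "a \<noteq> 0"
  shows "T / 2 * (sgn a)\<^sup>2 - 1 / (2 * lam) * (a + T * sgn a)\<^sup>2 + (\<bar>a\<bar> - a * w)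
    \<le> T / 2 * w\<^sup>2 - 1 / (2 * lam) * (a + T * w)\<^sup>2"
proof -
  have s: "(sgn a)\<^sup>2 = 1" "(a + T * sgn a)\<^sup>2 = (\<bar>a\<bar> + T)\<^sup>2" using a by (auto simp: sgn_if abs_if power2_eq_square algebra_simps)
  have "\<bar>a + T * w\<bar> \<le> \<bar>a\<bar> + T * 1"
    using abs_triangle_ineq[of a "T * w"] mult_left_mono[OF w, of T] lam
    unfolding abs_mult by (simp only: abs_of_pos) linarith
  then have "(a + T * w)\<^sup>2 \<le> (\<bar>a\<bar> + T)\<^sup>2" using power_mono[of "\<bar>a + T * w\<bar>" "\<bar>a\<bar> + T" 2] by simp
  then have "1 / (2 * T) * ((\<bar>a\<bar> + T)\<^sup>2 - (a + T * w)\<^sup>2) \<le> 1 / (2 * lam) * ((\<bar>a\<bar> + T)\<^sup>2 - (a + T * w)\<^sup>2)"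
    using lam by (intro mult_right_mono divide_left_mono) auto
  moreover have "1 / (2 * T) * ((\<bar>a\<bar> + T)\<^sup>2 - (a + T * w)\<^sup>2) = \<bar>a\<bar> - a * w + T / 2 * (1 - w\<^sup>2)"
  proof -
    have "(\<bar>a\<bar> + T)\<^sup>2 - (a + T * w)\<^sup>2 = 2 * T * (\<bar>a\<bar> - a * w) + T * T * (1 - w\<^sup>2)"
      using power2_abs[of a] by algebra
    then show ?thesis using lam by (simp add: add_divide_distrib)
  qed
  ultimately have "\<bar>a\<bar> - a * w + T / 2 * (1 - w\<^sup>2) \<le> 1 / (2 * lam) * (\<bar>a\<bar> + T)\<^sup>2 - 1 / (2 * lam) * (a + T * w)\<^sup>2"
    unfolding right_diff_distrib[symmetric] by simp
  then show ?thesis unfolding s right_diff_distrib by linarith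
qed

text \<open>The static cost of \<open>sgn\<close>, whose mean term vanishes by symmetry. For
  \<open>0 < lam \<le> T\<close> it is the infimum of the problem.\<close>

definition sgn_cost :: "real \<Rightarrow> real \<Rightarrow> real" where
  "sgn_cost T lam = (LINT a|mu_init. T / 2 * (sgn a)\<^sup>2 - 1 / (2 * lam) * (a + T * sgn a)\<^sup>2)"

lemma integrable_mu_init_quadratic:
  assumes w: "w \<in> borel_measurable borel" "\<And>a. \<bar>w a\<bar> \<le> 1"
  shows "integrable mu_init (\<lambda>a. (w a)\<^sup>2)" "integrable mu_init (\<lambda>a. (a + T * w a)\<^sup>2)"
    "integrable mu_init (\<lambda>a. \<bar>a\<bar> - a * w a)"
proof -
  have [measurable]: "w \<in> borel_measurable borel" by (rule w(1))
  show "integrable mu_init (\<lambda>a. (w a)\<^sup>2)"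
    by (rule integrable_mu_init[of _ 1]) (use w(2) in \<open>auto simp: abs_square_le_1\<close>)
  show "integrable mu_init (\<lambda>a. (a + T * w a)\<^sup>2)"
  proof (rule integrable_mu_init[of _ "(1 + \<bar>T\<bar>)\<^sup>2"])
    fix a :: real assume a: "\<bar>a\<bar> \<le> 1"
    have "\<bar>a + T * w a\<bar> \<le> 1 + \<bar>T\<bar>"
      using abs_triangle_ineq[of a "T * w a"] mult_left_mono[OF w(2)[of a], of "\<bar>T\<bar>"] a by (simp add: abs_mult)
    from power_mono[OF this, of 2] show "\<bar>(a + T * w a)\<^sup>2\<bar> \<le> (1 + \<bar>T\<bar>)\<^sup>2" by simp
  qed measurable
  show "integrable mu_init (\<lambda>a. \<bar>a\<bar> - a * w a)"
  proof (rule integrable_mu_init[of _ 2])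
    fix a :: real assume a: "\<bar>a\<bar> \<le> 1"
    have "\<bar>a * w a\<bar> \<le> 1 * 1" unfolding abs_mult using a w(2) by (intro mult_mono) auto
    then show "\<bar>\<bar>a\<bar> - a * w a\<bar> \<le> 2" using a by linarith
  qed measurable
qed

lemma static_cost_ge_sgn_cost:
  assumes lam: "0 < lam" "lam \<le> T" and w: "w \<in> borel_measurable borel" "\<And>a. \<bar>w a\<bar> \<le> 1"
  shows "sgn_cost T lam + (LINT a|mu_init. \<bar>a\<bar> - a * w a) \<le> static_cost T lam mu_init (\<lambda>a. a) w"
proof -
  note I = integrable_mu_init_quadratic(1)[OF w] integrable_mu_init_quadratic(2)[OF w, of T]
    integrable_mu_init_quadratic(3)[OF w]
  have sg: "sgn \<in> borel_measurable (borel :: real measure)" "\<And>a :: real. \<bar>sgn a\<bar> \<le> 1"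
    by (auto simp: sgn_if)
  note S = integrable_mu_init_quadratic(1)[OF sg] integrable_mu_init_quadratic(2)[OF sg, of T]
    integrable_mu_init_quadratic(3)[OF sg]
  have iS: "integrable mu_init (\<lambda>a. T / 2 * (sgn a)\<^sup>2 - 1 / (2 * lam) * (a + T * sgn a)\<^sup>2)"
    by (intro Bochner_Integration.integrable_diff integrable_mult_right S)
  have iI: "integrable mu_init (\<lambda>a. T / 2 * (w a)\<^sup>2 - 1 / (2 * lam) * (a + T * w a)\<^sup>2)"
    by (intro Bochner_Integration.integrable_diff integrable_mult_right I)
  have "sgn_cost T lam + (LINT a|mu_init. \<bar>a\<bar> - a * w a)
      = (LINT a|mu_init. T / 2 * (sgn a)\<^sup>2 - 1 / (2 * lam) * (a + T * sgn a)\<^sup>2 + (\<bar>a\<bar> - a * w a))"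
    unfolding sgn_cost_def by (rule Bochner_Integration.integral_add[OF iS I(3), symmetric])
  also have "\<dots> \<le> (LINT a|mu_init. T / 2 * (w a)\<^sup>2 - 1 / (2 * lam) * (a + T * w a)\<^sup>2)"
  proof (rule integral_mono_AE[OF Bochner_Integration.integrable_add[OF iS I(3)] iI])
    show "AE a in mu_init. T / 2 * (sgn a)\<^sup>2 - 1 / (2 * lam) * (a + T * sgn a)\<^sup>2 + (\<bar>a\<bar> - a * w a)
        \<le> T / 2 * (w a)\<^sup>2 - 1 / (2 * lam) * (a + T * w a)\<^sup>2"
      using AE_mu_init_nonzero by (rule eventually_mono) (rule sgn_integrand_le[OF lam w(2)])
  qed
  also have "\<dots> = T / 2 * (LINT a|mu_init. (w a)\<^sup>2) - 1 / (2 * lam) * (LINT a|mu_init. (a + T * w a)\<^sup>2)"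
    by (simp only: Bochner_Integration.integral_diff[OF integrable_mult_right[OF I(1)] integrable_mult_right[OF I(2)]]
        integral_mult_right_zero)
  also have "\<dots> \<le> static_cost T lam mu_init (\<lambda>a. a) w"
    unfolding static_cost_def right_diff_distrib using lam by simp
  finally show ?thesis .
qed

text \<open>Equality in the lower bound forces \<open>w = sgn\<close> almost everywhere, which is impossible for a continuous \<open>w\<close>.\<close>

lemma continuous_excess_pos:
  assumes c: "continuous_on UNIV w" and w: "\<And>a. \<bar>w a\<bar> \<le> 1"
  shows "0 < (LINT a|mu_init. \<bar>a\<bar> - a * w a)"
proof (rule ccontr)
  assume neg: "\<not> 0 < (LINT a|mu_init. \<bar>a\<bar> - a * w a)"
  have wm: "w \<in> borel_measurable borel" by (rule borel_measurable_continuous_onI[OF c])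
  have nonneg: "0 \<le> \<bar>a\<bar> - a * w a" for a
  proof -
    have "\<bar>a * w a\<bar> \<le> \<bar>a\<bar> * 1" unfolding abs_mult by (intro mult_left_mono w) simp
    then show ?thesis by linarith
  qed
  then have "0 \<le> (LINT a|mu_init. \<bar>a\<bar> - a * w a)" by (intro Bochner_Integration.integral_nonneg)
  with neg have "(LINT a|mu_init. \<bar>a\<bar> - a * w a) = 0" by linarith
  then have ae: "AE a in mu_init. \<bar>a\<bar> - a * w a = 0"
    using integral_nonneg_eq_0_iff_AE[OF integrable_mu_init_quadratic(3)[OF wm w]] nonneg by simp
  have "isCont w 0" using c by (simp add: continuous_on_eq_continuous_at)
  then obtain d where d: "d > 0" "\<And>a. \<bar>a\<bar> < d \<Longrightarrow> \<bar>w a - w 0\<bar> < 1"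
    unfolding continuous_at_eps_delta dist_real_def by (metis diff_zero zero_less_one)
  define m where "m = min d 1"
  have m: "0 < m" "m \<le> d" "m \<le> 1" using d by (auto simp: m_def)
  \<comment> \<open>A set that meets \<open>{-1..1}\<close> in positive measure cannot avoid the
    points of equality, which have full measure; it is applied to small intervals on either side of
    0.\<close>
  have pick: "\<exists>a\<in>S. \<bar>a\<bar> - a * w a = 0" if S: "S \<in> sets borel" "emeasure lborel ({-1..1} \<inter> S) > 0" for S
  proof (rule ccontr)
    assume "\<not> (\<exists>a\<in>S. \<bar>a\<bar> - a * w a = 0)"
    then have "AE a in mu_init. a \<notin> S" using ae by (auto elim: eventually_mono)
    then have "emeasure mu_init S = 0" using S(1) by (subst (asm) AE_iff_null_sets[symmetric]) auto
    moreover have "emeasure mu_init S = emeasure lborel ({-1..1} \<inter> S) / emeasure lborel {-1..1::real}"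
      unfolding mu_init_def using S(1) by (intro emeasure_uniform_measure) auto
    ultimately show False using S(2) by (simp add: ennreal_divide_eq_0_iff)
  qed
  obtain a where a: "a \<in> {0<..<m}" "\<bar>a\<bar> - a * w a = 0"
  proof -
    have "{-1..1} \<inter> {0<..<m} = {0<..<m}" using m by auto
    with m have "emeasure lborel ({-1..1} \<inter> {0<..<m}) > 0" by simp
    from pick[OF _ this] show ?thesis using that by auto
  qed
  obtain b where b: "b \<in> {-m<..<0}" "\<bar>b\<bar> - b * w b = 0"
  proof -
    have "{-1..1} \<inter> {-m<..<0} = {-m<..<0}" using m by auto
    with m have "emeasure lborel ({-1..1} \<inter> {-m<..<0}) > 0" by simp
    from pick[OF _ this] show ?thesis using that by auto
  qed
  \<comment> \<open>Equality gives \<open>w a = 1\<close> on the right and \<open>w b = -1\<close>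
    on the left, but both values lie at distance less than 1 from \<open>w 0\<close>.\<close>
  have "a * (1 - w a) = 0" "b * (1 + w b) = 0" using a b by (auto simp: algebra_simps)
  then have "w a = 1" "w b = -1" using a(1) b(1) by auto
  moreover have "\<bar>w a - w 0\<bar> < 1" "\<bar>w b - w 0\<bar> < 1"
    by (rule d(2), use a(1) b(1) m in simp)+
  ultimately show False by linarith
qed

text \<open>At each point \<open>clip (a * Suc n)\<close> is eventually equal to
  \<open>sgn a\<close>, and the mean is zero for every \<open>n\<close>, so only two bounded
  quadratic terms have to pass to the limit.\<close>

lemma static_cost_clip_tendsto:
  assumes T: "0 < T" and lam: "lam \<noteq> 0"
  shows "(\<lambda>n. static_cost T lam mu_init (\<lambda>a. a) (\<lambda>a. clip (a / (1 / real (Suc n))))) \<longlonglongrightarrow> sgn_cost T lam"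
proof -
  interpret prob_space mu_init by (rule prob_space_mu_init)
  define c where "c n a = clip (a / (1 / real (Suc n)))" for n a
  have cm [measurable]: "c n \<in> borel_measurable borel" for n unfolding c_def[abs_def] by measurable
  have cm' [measurable]: "c n \<in> borel_measurable mu_init" for n by (simp add: borel_measurable_mu_init)
  have c1: "\<bar>c n a\<bar> \<le> 1" for n a unfolding c_def by (rule clip_bound)
  have sg: "sgn \<in> borel_measurable (borel :: real measure)" "\<And>a :: real. \<bar>sgn a\<bar> \<le> 1"
    by (auto simp: sgn_if)
  note S = integrable_mu_init_quadratic(1)[OF sg] integrable_mu_init_quadratic(2)[OF sg, of T]
    integrable_mu_init_quadratic(3)[OF sg]
  have lim: "(\<lambda>n. c n a) \<longlonglongrightarrow> sgn a" for a
  proof (cases "a = 0")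
    case False
    obtain n0 where n0: "1 / real (Suc n0) < \<bar>a\<bar>" by (rule nat_approx_posE[of "\<bar>a\<bar>"]) (use False in simp)
    have "c n a = sgn a" if "n \<ge> n0" for n
    proof -
      have "1 / real (Suc n) \<le> 1 / real (Suc n0)" using that by (intro divide_left_mono) auto
      then have "1 / real (Suc n) < \<bar>a\<bar>" using n0 by linarith
      then have big: "1 < \<bar>a\<bar> * real (Suc n)" by (simp add: field_simps)
      show ?thesis
      proof (cases "a > 0")
        case True
        then have "1 < a * real (Suc n)" using big by simp
        then show ?thesis using True unfolding c_def clip_def by simp
      next
        case neg: False
        then have "a < 0" using False by simp
        then have "a * real (Suc n) < -1" using big by (simp add: abs_of_neg)
        then show ?thesis using \<open>a < 0\<close> unfolding c_def clip_def by simp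
      qed
    qed
    then have "\<forall>\<^sub>F n in sequentially. c n a = sgn a" unfolding eventually_sequentially by blast
    then show ?thesis by (rule tendsto_eventually)
  qed (simp add: c_def clip_def)
  have l1: "(\<lambda>n. LINT a|mu_init. (c n a)\<^sup>2) \<longlonglongrightarrow> (LINT a|mu_init. (sgn a)\<^sup>2)"
  proof (rule integral_dominated_convergence[where w = "\<lambda>_. 1"])
    show "AE a in mu_init. (\<lambda>n. (c n a)\<^sup>2) \<longlonglongrightarrow> (sgn a)\<^sup>2" by (intro AE_I2 tendsto_power lim)
    show "AE a in mu_init. norm ((c n a)\<^sup>2) \<le> 1" for n using c1 by (intro AE_I2) (simp add: abs_square_le_1)
  qed (use S(1) in auto)
  have l2: "(\<lambda>n. LINT a|mu_init. (a + T * c n a)\<^sup>2) \<longlonglongrightarrow> (LINT a|mu_init. (a + T * sgn a)\<^sup>2)"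
  proof (rule integral_dominated_convergence[where w = "\<lambda>_. (1 + T)\<^sup>2"])
    show "AE a in mu_init. (\<lambda>n. (a + T * c n a)\<^sup>2) \<longlonglongrightarrow> (a + T * sgn a)\<^sup>2"
      by (intro AE_I2 tendsto_intros lim)
    show "AE a in mu_init. norm ((a + T * c n a)\<^sup>2) \<le> (1 + T)\<^sup>2" for n
      using AE_mu_init
    proof (rule eventually_mono)
      fix a :: real assume a: "\<bar>a\<bar> \<le> 1"
      have "\<bar>a + T * c n a\<bar> \<le> 1 + T"
      proof -
        have "T * \<bar>c n a\<bar> \<le> T * 1" by (rule mult_left_mono[OF c1]) (use T in simp)
        then have "\<bar>T * c n a\<bar> \<le> T" using T by (simp add: abs_mult)
        then show ?thesis using abs_triangle_ineq[of a "T * c n a"] a by linarith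
      qed
      from power_mono[OF this, of 2] show "norm ((a + T * c n a)\<^sup>2) \<le> (1 + T)\<^sup>2" by simp
    qed
    show "(\<lambda>a. (a + T * c n a)\<^sup>2) \<in> borel_measurable mu_init" for n
      unfolding borel_measurable_mu_init by measurable
  qed (use S(2) in auto)
  have mean: "(LINT a|mu_init. a + T * c n a) = 0" for n
  proof -
    interpret straight_flow T "1 / real (Suc n)" by unfold_locales (use T in simp_all)
    show ?thesis unfolding c_def by (rule mean_terminal_zero)
  qed
  have "(\<lambda>n. T / 2 * (LINT a|mu_init. (c n a)\<^sup>2) - 1 / (2 * lam) * (LINT a|mu_init. (a + T * c n a)\<^sup>2))
      \<longlonglongrightarrow> T / 2 * (LINT a|mu_init. (sgn a)\<^sup>2) - 1 / (2 * lam) * (LINT a|mu_init. (a + T * sgn a)\<^sup>2)"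
    by (intro tendsto_diff tendsto_mult_left l1 l2)
  moreover have "T / 2 * (LINT a|mu_init. (sgn a)\<^sup>2) - 1 / (2 * lam) * (LINT a|mu_init. (a + T * sgn a)\<^sup>2) = sgn_cost T lam"
    unfolding sgn_cost_def
    by (simp only: Bochner_Integration.integral_diff[OF integrable_mult_right[OF S(1)] integrable_mult_right[OF S(2)]]
        integral_mult_right_zero)
  moreover have "static_cost T lam mu_init (\<lambda>a. a) (\<lambda>a. clip (a / (1 / real (Suc n))))
      = T / 2 * (LINT a|mu_init. (c n a)\<^sup>2) - 1 / (2 * lam) * (LINT a|mu_init. (a + T * c n a)\<^sup>2)" for n
    unfolding static_cost_def c_def[symmetric] mean by simp
  ultimately show ?thesis by simp
qed

lemma no_minimizer_inf:
  assumes lam: "0 < lam" "lam \<le> T"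
  shows "\<not> minimizer_inf T lam u"
proof
  assume "minimizer_inf T lam u"
  then obtain \<mu> where u: "admissible_inf T u" "continuity_equation T u \<mu>"
    and min: "\<And>v \<nu>. admissible_inf T v \<Longrightarrow> continuity_equation T v \<nu> \<Longrightarrow> cost_inf T lam u \<mu> \<le> cost_inf T lam v \<nu>"
    unfolding minimizer_inf_def by blast
  have T: "0 < T" using lam by simp
  obtain L where "cont_eq T u L \<mu>" by (rule cont_eq_if_admissible[OF T u])
  then interpret cont_eq T u L \<mu> .
  have "T \<in> {0..T}" using T by simp
  then have c: "continuous_on UNIV (\<lambda>a. (flow T a - a) / T)"
    using T by (intro continuous_intros flow_continuous) auto
  have "sgn_cost T lam < sgn_cost T lam + (LINT a|mu_init. \<bar>a\<bar> - a * ((flow T a - a) / T))"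
    using continuous_excess_pos[OF c displacement_facts(2)] by simp
  also have "\<dots> \<le> static_cost T lam mu_init (\<lambda>a. a) (\<lambda>a. (flow T a - a) / T)"
    by (rule static_cost_ge_sgn_cost[OF lam displacement_facts])
  also have "\<dots> \<le> cost_inf T lam u \<mu>" by (rule cost_ge_static_cost)
  finally have less: "sgn_cost T lam < cost_inf T lam u \<mu>" .
  have "cost_inf T lam u \<mu> \<le> static_cost T lam mu_init (\<lambda>a. a) (\<lambda>a. clip (a / (1 / real (Suc n))))" for n
  proof -
    \<comment> \<open>A positive \<open>\<kappa>\<close> is allowed for every \<open>T\<close>, so
      these competitors are Lipschitz in space although their constants blow up with
      \<open>n\<close>.\<close>
    interpret S: straight_flow T "1 / real (Suc n)" by unfold_locales (use T in simp_all)
    show ?thesis using min[OF S.ctrl_admissible S.sol_continuity_equation] unfolding S.cost_sol .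
  qed
  moreover have "(\<lambda>n. static_cost T lam mu_init (\<lambda>a. a) (\<lambda>a. clip (a / (1 / real (Suc n))))) \<longlonglongrightarrow> sgn_cost T lam"
    by (rule static_cost_clip_tendsto[OF T]) (use lam in simp)
  ultimately have "cost_inf T lam u \<mu> \<le> sgn_cost T lam"
    by (intro LIMSEQ_le_const) auto
  with less show False by simp
qed

theorem theorem1:
  fixes T lam :: real
  assumes "T > 0" and "lam \<noteq> 0"
  shows
    "(lam > T \<or> lam < 0 \<longrightarrow>
        (\<exists>u :: real \<Rightarrow> real \<Rightarrow> real. minimizer_inf T lam u \<and>
          (\<exists>(uN :: nat \<Rightarrow> nat \<Rightarrow> real \<Rightarrow> real) (xN :: nat \<Rightarrow> nat \<Rightarrow> real \<Rightarrow> real).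
             (\<forall>N\<ge>2. optimal_control_N T lam N (uN N) \<and> trajectory_N T N (uN N) (xN N)) \<and>
             (\<forall>t\<in>{0..T}. \<forall>x :: real. \<forall>i :: nat \<Rightarrow> nat. (\<forall>N\<ge>2. i N \<in> {1..N}) \<longrightarrow>
                ((\<lambda>N. \<bar>xN N (i N) t - x\<bar>) \<longlonglongrightarrow> 0) \<longrightarrow>
                ((\<lambda>N. \<bar>uN N (i N) t - u t x\<bar>) \<longlonglongrightarrow> 0)))))
     \<and> (lam \<in> {0<..T} \<longrightarrow> \<not> (\<exists>u. minimizer_inf T lam u))"
proof (intro conjI impI)
  assume lam: "lam > T \<or> lam < 0"
  let ?v = "\<lambda>N i. clip (x_init N i / (lam - T))"
  show "\<exists>u. minimizer_inf T lam u \<and>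
      (\<exists>(uN :: nat \<Rightarrow> nat \<Rightarrow> real \<Rightarrow> real) (xN :: nat \<Rightarrow> nat \<Rightarrow> real \<Rightarrow> real).
         (\<forall>N\<ge>2. optimal_control_N T lam N (uN N) \<and> trajectory_N T N (uN N) (xN N)) \<and>
         (\<forall>t\<in>{0..T}. \<forall>x :: real. \<forall>i :: nat \<Rightarrow> nat. (\<forall>N\<ge>2. i N \<in> {1..N}) \<longrightarrow>
            ((\<lambda>N. \<bar>xN N (i N) t - x\<bar>) \<longlonglongrightarrow> 0) \<longrightarrow>
            ((\<lambda>N. \<bar>uN N (i N) t - u t x\<bar>) \<longlonglongrightarrow> 0)))"
  proof (rule exI[of _ "straight_flow.ctrl (lam - T)"], rule conjI[OF minimizer_inf_straight[OF assms(1) lam]],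
      rule exI[of _ "\<lambda>N i t. ?v N i"], rule exI[of _ "\<lambda>N i t. x_init N i + t * ?v N i"], intro conjI allI impI ballI)
    fix N :: nat assume "N \<ge> 2"
    from optimal_control_N_constant[OF assms(1) lam this]
    show "optimal_control_N T lam N (\<lambda>i t. ?v N i)"
      "trajectory_N T N (\<lambda>i t. ?v N i) (\<lambda>i t. x_init N i + t * ?v N i)" .
  next
    fix t x :: real and i :: "nat \<Rightarrow> nat"
    assume "t \<in> {0..T}" "(\<lambda>N. \<bar>x_init N (i N) + t * ?v N (i N) - x\<bar>) \<longlonglongrightarrow> 0"
    then show "(\<lambda>N. \<bar>?v N (i N) - straight_flow.ctrl (lam - T) t x\<bar>) \<longlonglongrightarrow> 0"
      by (rule optimal_controls_converge[OF assms(1) lam])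
  qed
next
  assume "lam \<in> {0<..T}"
  then show "\<not> (\<exists>u. minimizer_inf T lam u)" using no_minimizer_inf[of lam T] by auto
qed

end
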